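(* Let $(n_k)_{k\ge 1}$ be a sequence of positive integers and let $(r_k)_{k\ge 1}$ be a sequence in $[0,1)$ with $r_k\to 1$ as $k\to\infty$. Put $$\lambda_{k,j} = r_k e^{2\pi i j/n_k},\qquad k\ge 1,\ j=0,1,\dots,n_k-1 .$$ If there exists $M>0$ such that $n_k(1-r_k)\ge M$ for all $k\ge 1$, then for every $p\in(1,\infty)$ the system of Cauchy kernels $\{k_{\lambda_{k,j}}\}_{k\ge 1,\ 0\le j\le n_k-1}$, ordered lexicographically in $(k,j)$, is a representing system for the Hardy space $H^p$.
   Context: $\mathbb{D}$ is the open unit disk in $\mathbb{C}$, $\mathbb{T}$ the unit circle, and $m$ the normalized Lebesgue measure on $\mathbb{T}$. For $1\le p<\infty$ the Hardy space $H^p$ consists of all functions $f$ analytic in $\mathbb{D}$ with $\|f\|_{H^p}^p=\sup_{0<r<1}\int_{\mathbb{T}}|f(r\zeta)|^p\,dm(\zeta)<\infty$. For $\lambda\in\mathbb{D}$ the Cauchy (Szegő) kernel is $k_\lambda(z)=\dfrac{1}{1-\bar\lambda z}$. A sequence $\{x_n\}_{n\ge 1}$ in a separable infinite-dimensional Banach space $X$ is a representing system for $X$ if for every $x\in X$ there exists a sequence of complex numbers $\{c_n\}_{n\ge1}$ (not necessarily unique) such that $x=\sum_{n\ge 1}c_nx_n$, where the sequence of partial sums of the series, taken in the given order, converges to $x$ in the norm of $X$. Lexicographic order on the double index means the order $(1,0),(1,1),\dots,(1,n_1-1),(2,0),\dots,(2,n_2-1),(3,0),\dots$. *)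

theory Defs
  imports "HOL-Analysis.Analysis"
begin

(* The target sigma-algebra is that of the circle, not of the plane: integrands such as
   z |-> f (r * z) need only be well behaved on the circle in order to be measurable. *)
definition circle_measure :: "complex measure" where
  "circle_measure =
     distr (uniform_measure lborel {0..2 * pi}) (restrict_space borel (sphere 0 1)) cis"

definition hardy_mean :: "real \<Rightarrow> (complex \<Rightarrow> complex) \<Rightarrow> real \<Rightarrow> real" where
  "hardy_mean p f r = (LINT \<zeta>|circle_measure. norm (f (of_real r * \<zeta>)) powr p)"

(* Functions on the disc are total functions whose values outside the disc are irrelevant:
   neither hardy_space nor hardy_norm depends on them. *)
definition hardy_space :: "real \<Rightarrow> (complex \<Rightarrow> complex) set" where
  "hardy_space p =
     {f. f holomorphic_on ball 0 1 \<and> bdd_above (hardy_mean p f ` {0<..<1})}"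

(* Meaningful for members of hardy_space p, for which the supremum is finite. *)
definition hardy_norm :: "real \<Rightarrow> (complex \<Rightarrow> complex) \<Rightarrow> real" where
  "hardy_norm p f = (SUP r\<in>{0<..<1}. hardy_mean p f r) powr (1 / p)"

definition cauchy_kernel :: "complex \<Rightarrow> complex \<Rightarrow> complex" where
  "cauchy_kernel w z = 1 / (1 - cnj w * z)"

(* X is a space of complex-valued functions, normed by nrm; sequences are indexed from 0. *)
definition representing_system ::
    "('a \<Rightarrow> complex) set \<Rightarrow> (('a \<Rightarrow> complex) \<Rightarrow> real) \<Rightarrow> (nat \<Rightarrow> 'a \<Rightarrow> complex) \<Rightarrow> bool" where
  "representing_system X nrm x \<longleftrightarrow>
     range x \<subseteq> X \<and>
     (\<forall>f\<in>X. \<exists>c :: nat \<Rightarrow> complex.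
        (\<lambda>N. nrm (\<lambda>z. f z - (\<Sum>i<N. c i * x i z))) \<longlonglongrightarrow> 0)"

definition grid_point :: "(nat \<Rightarrow> nat) \<Rightarrow> (nat \<Rightarrow> real) \<Rightarrow> nat \<times> nat \<Rightarrow> complex" where
  "grid_point n r =
     (\<lambda>(k, j). of_real (r k) * exp (2 * of_real pi * \<i> * of_nat j / of_nat (n k)))"

(* Enumerates (1,0), ..., (1, n 1 - 1), (2,0), ..., (2, n 2 - 1), (3,0), ... *)
primrec lex_enum :: "(nat \<Rightarrow> nat) \<Rightarrow> nat \<Rightarrow> nat \<times> nat" where
  "lex_enum n 0 = (1, 0)"
| "lex_enum n (Suc i) =
     (case lex_enum n i of (k, j) \<Rightarrow> if Suc j < n k then (k, Suc j) else (Suc k, 0))"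

lemma lex_enum_range:
  assumes pos: "\<And>k. k \<ge> 1 \<Longrightarrow> n k > 0"
  shows "range (lex_enum n) = {(k, j). k \<ge> 1 \<and> j < n k}"
proof
  have "fst (lex_enum n i) \<ge> 1 \<and> snd (lex_enum n i) < n (fst (lex_enum n i))" for i
    by (induction i) (use pos in \<open>auto split: prod.splits\<close>)
  then show "range (lex_enum n) \<subseteq> {(k, j). k \<ge> 1 \<and> j < n k}"
    by (simp add: case_prod_beta image_subset_iff)
next
  have row: "(k, j) \<in> range (lex_enum n)"
    if "(k, 0) \<in> range (lex_enum n)" "j < n k" for k j
    using that
  proof (induction j)
    case (Suc j)
    then obtain i where "lex_enum n i = (k, j)"
      by (metis Suc_lessD rangeE)
    with Suc.prems have "lex_enum n (Suc i) = (k, Suc j)" by simp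
    then show ?case by (metis rangeI)
  qed simp
  have start: "(Suc k, 0) \<in> range (lex_enum n)" for k
  proof (induction k)
    case 0
    have "lex_enum n 0 = (Suc 0, 0)" by simp
    then show ?case by (metis rangeI)
  next
    case (Suc k)
    have "n (Suc k) > 0" using pos by simp
    then obtain i where "lex_enum n i = (Suc k, n (Suc k) - 1)"
      using row[OF Suc, of "n (Suc k) - 1"] by force
    then have "lex_enum n (Suc i) = (Suc (Suc k), 0)" by simp
    then show ?case by (metis rangeI)
  qed
  show "{(k, j). k \<ge> 1 \<and> j < n k} \<subseteq> range (lex_enum n)"
  proof clarify
    fix k j assume "1 \<le> k" "j < n k"
    then show "(k, j) \<in> range (lex_enum n)"
      using start[of "k - 1"] row[of k j] by simp
  qed
qed

lemma lex_enum_strict: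
  assumes "i < i'"
  shows "(lex_enum n i, lex_enum n i') \<in> less_than <*lex*> less_than"
proof -
  have tr: "trans (less_than <*lex*> less_than)"
    by (intro trans_lex_prod trans_less_than)
  have "(lex_enum n i, lex_enum n (Suc i)) \<in> less_than <*lex*> less_than" for i
    by (auto split: prod.splits)
  then show ?thesis
    by (rule less_Suc_induct[OF assms]) (rule transD[OF tr])
qed

end

theory Submission
  imports Defs "HOL-Complex_Analysis.Complex_Analysis" "HOL-Probability.Probability_Measure"
begin

text \<open>Let \<open>\<omega>\<close> be a primitive \<open>n\<close>-th root of unity, \<open>n = n\<^sub>k\<close>, \<open>r = r\<^sub>k\<close> and \<open>\<rho> = r ^ n\<close>, so \<open>\<rho> \<le> exp (- M)\<close>.
  For a polynomial \<open>P\<close> of degree less than \<open>n\<close>, the combination of the kernels of block \<open>k\<close> with coefficients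
  \<open>(1 - \<rho>\<^sup>2) P (\<omega> ^ j / r) / n\<close> equals \<open>(1 - \<rho>\<^sup>2) P(z) / (1 - \<rho> z ^ n)\<close>; it differs from \<open>P\<close> by
  \<open>P\<close> times \<open>\<rho> (\<rho> - z ^ n) / (1 - \<rho> z ^ n)\<close>, which is bounded by \<open>\<rho> < 1\<close> on the disc. Polynomials are dense in
  \<open>H\<^sup>p\<close>, so one block reduces the norm of the remainder by a fixed factor, and iterating over later and later blocks
  yields convergence along the ends of the chosen blocks.

  The partial sums within a block are controlled as follows. A combination \<open>w\<close> of the kernels with nonnegative
  coefficients has positive real part, so the argument of M. Riesz bounds the \<open>p\<close>-norm of \<open>w\<close> by that
  of \<open>Re w\<close>. The latter is bounded by Jensen's inequality, since the real parts of the kernels of a block sum up to at most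
  \<open>n / (1 - \<rho>)\<close>. For \<open>p < 2\<close> the Riesz inequality comes from the mean value of \<open>w\<^sup>p\<close>, for \<open>p \<ge> 2\<close> from the
  subharmonicity of \<open>2 (Re w)\<^sup>2 |w| powr (p - 2) - (4 / p\<^sup>2) |w| powr p\<close>.\<close>

section \<open>Integration over the circle\<close>

text \<open>Boundary values are avoided: apart from polynomials, functions are evaluated inside the
  disc only, and suprema of means replace limits at the boundary. The obstacle is that a
  lexicographic partial sum may stop anywhere inside a block of unbounded length, where the algebra
  of roots of unity gives no cancellation. Positivity does survive truncation. The price is that
  only absolute values of coefficients count; it is affordable because \<open>n powr (p - 1)\<close>
  times the sum of the p-th powers of the coefficients is, for coefficients of the form P / n, a
  Riemann sum for the p-th mean of P. The hypothesis on n_k (1 - r_k), together with r_k tending to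
  1, forces n_k to tend to infinity. Late blocks therefore admit polynomials of any given degree and
  make these Riemann sums accurate. Density of polynomials rests on the convergence of dilations to
  f, which is usually read off the boundary function; here it comes from uniform convexity and from
  the monotonicity of the means in the radius.\<close>

lemma space_circle_measure [simp]: "space circle_measure = sphere 0 1"
  by (simp add: circle_measure_def space_restrict_space)

lemma sets_circle_measure [measurable_cong, simp]:
  "sets circle_measure = sets (restrict_space borel (sphere 0 1))"
  by (simp add: circle_measure_def)

lemma cis_measurable_circle:
  "cis \<in> measurable (uniform_measure lborel {0..2 * pi}) (restrict_space borel (sphere 0 1))"
proof -
  have "continuous_on UNIV cis"
    by (intro continuous_intros)
  then have "cis \<in> borel_measurable borel"
    by (rule borel_measurable_continuous_onI)
  then have "cis \<in> borel_measurable (uniform_measure lborel {0..2 * pi})"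
    by (simp add: measurable_def)
  then show ?thesis
    by (intro measurable_restrict_space2) auto
qed

interpretation circle: prob_space circle_measure
proof -
  have "prob_space (uniform_measure lborel {0..2 * pi})"
    by (rule prob_space_uniform_measure) auto
  then show "prob_space circle_measure"
    unfolding circle_measure_def by (rule prob_space.prob_space_distr[OF _ cis_measurable_circle])
qed

lemma circle_measurable:
  fixes g :: "complex \<Rightarrow> 'b::topological_space"
  shows "continuous_on (sphere 0 1) g \<Longrightarrow> g \<in> borel_measurable circle_measure"
  by (subst measurable_cong_sets[OF sets_circle_measure refl])
    (rule borel_measurable_continuous_on_restrict)

lemma circle_integrable:
  fixes g :: "complex \<Rightarrow> 'b::{banach,second_countable_topology}"
  assumes "continuous_on (sphere 0 1) g"
  shows "integrable circle_measure g"
proof -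
  have "bounded (g ` sphere 0 1)"
    by (intro compact_imp_bounded compact_continuous_image assms) simp
  then obtain B where "\<And>x. x \<in> sphere 0 1 \<Longrightarrow> norm (g x) \<le> B"
    unfolding bounded_iff by blast
  then show ?thesis
    by (intro circle.integrable_const_bound[of g B] circle_measurable assms AE_I2) auto
qed

text \<open>The gauge integral over [0, 2 pi] is where Cauchy's formula, translation of the variable
  and the Leibniz rule are available; this is the bridge from the measure on the circle.\<close>

lemma circle_integral:
  fixes g :: "complex \<Rightarrow> 'b::euclidean_space"
  assumes "continuous_on (sphere 0 1) g"
  shows "(LINT \<zeta>|circle_measure. g \<zeta>) = integral {0..2 * pi} (\<lambda>t. g (cis t)) /\<^sub>R (2 * pi)"
proof -
  have cont: "continuous_on UNIV (\<lambda>t. g (cis t))"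
    by (intro continuous_on_compose2[OF assms] continuous_intros) auto
  have int: "set_integrable lborel {0..2 * pi} (\<lambda>t. g (cis t))"
    unfolding set_integrable_def
    by (intro borel_integrable_compact continuous_on_subset[OF cont]) auto
  have dens: "uniform_measure lborel {0..2*pi} = density lborel (\<lambda>x. ennreal (indicator {0..2*pi} x / (2*pi)))"
    unfolding uniform_measure_def
  proof (intro arg_cong[where f = "density lborel"] ext)
    fix x :: real
    have "emeasure lborel {0..2*pi} = ennreal (2*pi)" by simp
    moreover have "ennreal 1 / ennreal (2*pi) = ennreal (1 / (2*pi))"
      by (rule divide_ennreal) auto
    ultimately show "indicator {0..2*pi} x / emeasure lborel {0..2*pi} = ennreal (indicator {0..2*pi} x / (2*pi))"
      by (cases "x \<in> {0..2*pi}") simp_all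
  qed
  have "(LINT \<zeta>|circle_measure. g \<zeta>) = (LINT t|uniform_measure lborel {0..2 * pi}. g (cis t))"
    unfolding circle_measure_def
    using circle_measurable[OF assms]
    by (subst integral_distr[OF cis_measurable_circle]) (auto simp: circle_measure_def)
  also have "\<dots> = (LINT t|lborel. (indicator {0..2*pi} t / (2*pi)) *\<^sub>R g (cis t))"
    unfolding dens
    by (subst integral_density)
      (use borel_measurable_continuous_onI[OF cont] in auto)
  also have "\<dots> = (LINT t:{0..2*pi}|lborel. g (cis t)) /\<^sub>R (2*pi)"
    unfolding set_lebesgue_integral_def
    by (subst integral_scaleR_right[symmetric]) (auto simp: divide_simps intro!: Bochner_Integration.integral_cong)
  also have "\<dots> = integral {0..2 * pi} (\<lambda>t. g (cis t)) /\<^sub>R (2 * pi)"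
    using set_borel_integral_eq_integral(2)[OF int] by simp
  finally show ?thesis .
qed

lemma circle_integral_mono:
  fixes g h :: "complex \<Rightarrow> real"
  assumes "continuous_on (sphere 0 1) g" "continuous_on (sphere 0 1) h"
    and "\<And>\<zeta>. norm \<zeta> = 1 \<Longrightarrow> g \<zeta> \<le> h \<zeta>"
  shows "(LINT \<zeta>|circle_measure. g \<zeta>) \<le> (LINT \<zeta>|circle_measure. h \<zeta>)"
  by (intro integral_mono circle_integrable assms) (use assms(3) in auto)

lemma circle_prob_sphere [simp]: "measure circle_measure (sphere 0 1) = 1"
  using circle.prob_space by simp

lemma integral_periodic_shift:
  fixes f :: "real \<Rightarrow> 'b::euclidean_space"
  assumes cont: "continuous_on UNIV f" and per: "\<And>t. f (t + c) = f t" and a: "0 \<le> a" "a \<le> c"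
  shows "integral {0..c} (\<lambda>t. f (t + a)) = integral {0..c} f"
proof -
  have int: "f integrable_on {u..v}" for u v
    by (intro integrable_continuous_interval continuous_on_subset[OF cont]) auto
  have *: "integral {u..v} (\<lambda>t. f (t + w)) = integral {u+w..v+w} f" for u v w
  proof -
    have "f \<circ> (+) w = (\<lambda>t. f (t + w))" by (auto simp: add.commute)
    then show ?thesis using integral_shift_Icc_real[of u v f w] by simp
  qed
  have "integral {0..c} (\<lambda>t. f (t + a)) = integral {a..c+a} f"
    using *[of 0 c a] by simp
  also have "\<dots> = integral {a..c} f + integral {c..c+a} f"
    using a by (intro Henstock_Kurzweil_Integration.integral_combine[symmetric] int) auto
  also have "integral {c..c+a} f = integral {0..a} f"
    using *[of 0 c a] *[of 0 a c] per by (simp add: add.commute)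
  also have "integral {a..c} f + integral {0..a} f = integral {0..c} f"
    using a Henstock_Kurzweil_Integration.integral_combine[OF a int] by (simp add: add.commute)
  finally show ?thesis .
qed

text \<open>In the maximum principle behind \<open>hardy_mean_mono\<close> a point runs over a whole
  circle, whereas \<open>hardy_mean\<close> knows real radii only.\<close>

lemma circle_integral_rotate:
  fixes g :: "complex \<Rightarrow> 'b::euclidean_space"
  assumes "continuous_on (sphere 0 1) g" "norm u = 1"
  shows "(LINT \<zeta>|circle_measure. g (u * \<zeta>)) = (LINT \<zeta>|circle_measure. g \<zeta>)"
proof -
  obtain a where a: "0 \<le> a" "a < 2 * pi" "u = cis a"
    using assms(2) by (metis Arg2pi_eq Arg2pi_ge_0 Arg2pi_lt_2pi cis_conv_exp mult_1 of_real_1 mult.commute)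
  have c1: "continuous_on (sphere 0 1) (\<lambda>\<zeta>. g (u * \<zeta>))"
    by (intro continuous_on_compose2[OF assms(1)] continuous_intros) (auto simp: norm_mult assms)
  have c2: "continuous_on UNIV (\<lambda>t. g (cis t))"
    by (intro continuous_on_compose2[OF assms(1)] continuous_intros) auto
  have "integral {0..2*pi} (\<lambda>t. g (cis (t + a))) = integral {0..2*pi} (\<lambda>t. g (cis t))"
    by (rule integral_periodic_shift[OF c2]) (use a in \<open>auto simp: cis_mult[symmetric]\<close>)
  then show ?thesis
    unfolding circle_integral[OF assms(1)] circle_integral[OF c1] unfolding a(3)
    by (simp add: cis_mult add.commute)
qed

lemma circle_mean_value:
  assumes "h holomorphic_on ball 0 1" "0 \<le> s" "s < 1"
  shows "(LINT \<zeta>|circle_measure. h (of_real s * \<zeta>)) = h 0"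
proof (cases "s = 0")
  case False
  with assms have s: "0 < s" "s < 1" by auto
  have c: "continuous_on (sphere 0 1) (\<lambda>\<zeta>. h (of_real s * \<zeta>))"
    by (intro continuous_on_compose2[OF holomorphic_on_imp_continuous_on[OF assms(1)]] continuous_intros)
      (use s in \<open>auto simp: norm_mult\<close>)
  have "((\<lambda>u. h u / (u - 0)) has_contour_integral (2 * of_real pi * \<i> * h 0)) (circlepath 0 s)"
    by (rule Cauchy_integral_circlepath_simple)
      (use s in \<open>auto intro: holomorphic_on_subset[OF assms(1)]\<close>)
  then have "((\<lambda>u. h u / u) has_contour_integral (2 * of_real pi * \<i> * h 0)) (part_circlepath 0 s 0 (2*pi))"
    by (simp add: circlepath_def)
  moreover have "0 < 2 * pi" by simp
  ultimately have "((\<lambda>t. h (0 + of_real s * cis t) / (0 + of_real s * cis t) * of_real s * \<i> * cis t)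
      has_integral (2 * of_real pi * \<i> * h 0)) {0..2*pi}"
    using has_contour_integral_part_circlepath_iff[of 0 "2*pi" "\<lambda>u. h u / u" _ 0 s] by blast
  then have "((\<lambda>t. \<i> * h (of_real s * cis t)) has_integral (2 * of_real pi * \<i> * h 0)) {0..2*pi}"
    by (rule has_integral_eq[rotated]) (use s in \<open>simp add: field_simps\<close>)
  then have "((\<lambda>t. (-\<i>) * (\<i> * h (of_real s * cis t))) has_integral (-\<i>) * (2 * of_real pi * \<i> * h 0)) {0..2*pi}"
    by (rule has_integral_mult_right)
  then have "((\<lambda>t. h (of_real s * cis t)) has_integral (2 * of_real pi * h 0)) {0..2*pi}"
    by (simp add: algebra_simps)
  then show ?thesis
    unfolding circle_integral[OF c]
    by (simp add: integral_unique scaleR_conv_of_real)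
qed auto

section \<open>Hardy norms\<close>

text \<open>Young's inequality arranged as the tangent line of the convex function t^p / p at
  \<open>m\<close>. Jensen's inequality for powers and the duality estimate in
  \<open>hardy_mean_mono\<close> are derived from it.\<close>

lemma Young_powr:
  fixes x m p :: real
  assumes "p > 1" "0 \<le> x" "0 \<le> m"
  shows "m powr (p - 1) * x \<le> x powr p / p + (1 - 1 / p) * m powr p"
proof -
  have "x * m powr (p - 1) \<le> x powr p / p + (m powr (p - 1)) powr (p / (p - 1)) / (p / (p - 1))"
    by (rule Youngs_inequality) (use assms in \<open>auto simp: field_simps\<close>)
  also have "(m powr (p - 1)) powr (p / (p - 1)) = m powr p"
    using assms by (simp add: powr_powr)
  also have "m powr p / (p / (p - 1)) = (1 - 1 / p) * m powr p"
    using assms by (simp add: field_simps)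
  finally show ?thesis by (simp add: mult.commute)
qed

text \<open>Jensen's inequality for weights of total mass at most \<open>K\<close>: the tangent is
  taken at \<open>m = u / K\<close>, and missing mass only helps. An upper bound on the mass is what
  is known about the real parts of the kernels at a point.\<close>

lemma powr_sum_le:
  fixes w c :: "'a \<Rightarrow> real"
  assumes p: "p > 1" and "\<And>i. i \<in> I \<Longrightarrow> 0 \<le> w i" "\<And>i. i \<in> I \<Longrightarrow> 0 \<le> c i"
    and K: "(\<Sum>i\<in>I. w i) \<le> K" "K > 0"
  shows "(\<Sum>i\<in>I. w i * c i) powr p \<le> K powr (p - 1) * (\<Sum>i\<in>I. w i * c i powr p)"
proof -
  define u where "u = (\<Sum>i\<in>I. w i * c i)"
  define m where "m = u / K"
  have u: "0 \<le> u" unfolding u_def using assms by (intro sum_nonneg) auto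
  then have m: "0 \<le> m" using K by (simp add: m_def)
  have "m powr (p - 1) * u = (\<Sum>i\<in>I. w i * (m powr (p - 1) * c i))"
    by (simp add: u_def sum_distrib_left mult_ac)
  also have "\<dots> \<le> (\<Sum>i\<in>I. w i * (c i powr p / p + (1 - 1 / p) * m powr p))"
    using assms m by (intro sum_mono mult_left_mono Young_powr) auto
  also have "\<dots> = (\<Sum>i\<in>I. w i * c i powr p) / p + (1 - 1 / p) * m powr p * (\<Sum>i\<in>I. w i)"
    by (simp add: sum.distrib distrib_left sum_divide_distrib sum_distrib_right[symmetric] mult_ac)
  also have "\<dots> \<le> (\<Sum>i\<in>I. w i * c i powr p) / p + (1 - 1 / p) * m powr p * K"
    using p K by (intro add_left_mono mult_left_mono) auto
  also have "m powr (p - 1) * u = m powr p * K"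
    using m u K by (cases "m = 0") (auto simp: powr_diff m_def)
  finally have "m powr p * K / p \<le> (\<Sum>i\<in>I. w i * c i powr p) / p"
    by (simp add: algebra_simps)
  then have *: "m powr p * K \<le> (\<Sum>i\<in>I. w i * c i powr p)"
    using p by (simp add: divide_le_cancel)
  have "u powr p = K powr (p - 1) * (m powr p * K)"
    using K u by (simp add: m_def powr_divide powr_diff)
  also have "\<dots> \<le> K powr (p - 1) * (\<Sum>i\<in>I. w i * c i powr p)"
    using * by (intro mult_left_mono) auto
  finally show ?thesis by (simp add: u_def)
qed

text \<open>Two-point Jensen applied to \<open>a / t\<close> and \<open>b / (1 - t)\<close>. With
  \<open>t\<close> left free, Minkowski's inequality follows by one integration with a fixed
  weight.\<close>

lemma powr_add_le:
  fixes a b t p :: real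
  assumes "p > 1" "0 \<le> a" "0 \<le> b" "0 < t" "t < 1"
  shows "(a + b) powr p \<le> t powr (1 - p) * a powr p + (1 - t) powr (1 - p) * b powr p"
proof -
  have "(\<Sum>i\<in>UNIV. (if i then t else 1 - t) * (if i then a / t else b / (1 - t))) powr p
     \<le> 1 powr (p - 1) * (\<Sum>i\<in>UNIV. (if i then t else 1 - t) * (if i then a / t else b / (1 - t)) powr p)"
    by (rule powr_sum_le) (use assms in \<open>auto simp: UNIV_bool\<close>)
  moreover have "t * (a / t) powr p = t powr (1 - p) * a powr p" if "0 < t" "0 \<le> a" for a t
    using that by (simp add: powr_divide powr_diff)
  ultimately show ?thesis
    using assms by (simp add: UNIV_bool add.commute)
qed

section \<open>Elementary properties of the means and the norm\<close>

lemma continuous_on_hardy: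
  assumes "f holomorphic_on ball 0 1" "0 \<le> s" "s < 1"
  shows "continuous_on (sphere 0 1) (\<lambda>\<zeta>. f (of_real s * \<zeta>))"
  by (intro continuous_on_compose2[OF holomorphic_on_imp_continuous_on[OF assms(1)]] continuous_intros)
    (use assms in \<open>auto simp: norm_mult\<close>)

lemma continuous_on_norm_powr:
  fixes g :: "'a::topological_space \<Rightarrow> 'b::real_normed_vector"
  assumes "continuous_on S g" "p > 0"
  shows "continuous_on S (\<lambda>x. norm (g x) powr p)"
  by (intro continuous_on_powr' continuous_intros assms) (use assms in auto)

lemmas continuous_on_hardy_powr = continuous_on_norm_powr[OF continuous_on_hardy]

lemma hardy_mean_nonneg: "0 \<le> hardy_mean p f r"
  unfolding hardy_mean_def by (intro integral_nonneg_AE AE_I2) auto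

lemma hardy_norm_nonneg: "0 \<le> hardy_norm p f"
  by (simp add: hardy_norm_def)

lemma hardy_mean_le_norm:
  assumes "f \<in> hardy_space p" "0 < r" "r < 1" "p > 0"
  shows "hardy_mean p f r \<le> hardy_norm p f powr p"
proof -
  have "hardy_mean p f r \<le> (SUP r\<in>{0<..<1}. hardy_mean p f r)"
    using assms by (intro cSUP_upper) (auto simp: hardy_space_def)
  moreover have "0 \<le> hardy_mean p f r"
    by (rule hardy_mean_nonneg)
  ultimately show ?thesis
    using assms by (simp add: hardy_norm_def powr_powr)
qed

lemma hardy_spaceI:
  assumes "f holomorphic_on ball 0 1"
    and "\<And>r. 0 < r \<Longrightarrow> r < 1 \<Longrightarrow> hardy_mean p f r \<le> B powr p"
  shows "f \<in> hardy_space p"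
  using assms by (auto simp: hardy_space_def intro!: bdd_aboveI2[where M = "B powr p"])

lemma hardy_norm_le:
  assumes "\<And>r. 0 < r \<Longrightarrow> r < 1 \<Longrightarrow> hardy_mean p f r \<le> B powr p" "p > 0" "B \<ge> 0"
  shows "hardy_norm p f \<le> B"
proof -
  have "(SUP r\<in>{0<..<1}. hardy_mean p f r) \<le> B powr p"
    using assms by (intro cSUP_least) auto
  moreover have "0 \<le> (SUP r\<in>{0<..<1}. hardy_mean p f r)"
    by (rule order_trans[OF hardy_mean_nonneg], rule cSUP_upper[where x = "1/2"])
      (use assms in \<open>auto intro!: bdd_aboveI2[where M = "B powr p"]\<close>)
  ultimately have "hardy_norm p f \<le> (B powr p) powr (1 / p)"
    unfolding hardy_norm_def using assms by (intro powr_mono2) auto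
  then show ?thesis
    using assms by (simp add: powr_powr)
qed

lemma hardy_space_holomorphic: "f \<in> hardy_space p \<Longrightarrow> f holomorphic_on ball 0 1"
  by (simp add: hardy_space_def)

lemma hardy_mean_le_sup:
  assumes "f holomorphic_on ball 0 1" "0 < r" "r < 1" "p > 0" "0 \<le> B"
    and "\<And>z. norm z = r \<Longrightarrow> norm (f z) \<le> B"
  shows "hardy_mean p f r \<le> B powr p"
proof -
  have "hardy_mean p f r \<le> (LINT \<zeta>|circle_measure. B powr p)"
    unfolding hardy_mean_def
    by (intro circle_integral_mono continuous_on_hardy_powr continuous_intros powr_mono2)
      (use assms in \<open>auto simp: norm_mult\<close>)
  then show ?thesis by simp
qed

lemma
  assumes "f holomorphic_on ball 0 1" "p > 0" "0 \<le> B" "\<And>z. norm z < 1 \<Longrightarrow> norm (f z) \<le> B"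
  shows bounded_in_hardy_space: "f \<in> hardy_space p"
    and hardy_norm_le_sup: "hardy_norm p f \<le> B"
proof -
  have "hardy_mean p f r \<le> B powr p" if "0 < r" "r < 1" for r
    using that assms by (intro hardy_mean_le_sup) auto
  then show "f \<in> hardy_space p" "hardy_norm p f \<le> B"
    using assms by (auto intro: hardy_spaceI hardy_norm_le)
qed

lemma
  assumes p: "p > 1" and f: "f \<in> hardy_space p" and g: "g \<in> hardy_space p"
  shows hardy_space_add: "(\<lambda>z. f z + g z) \<in> hardy_space p"
    and hardy_norm_triangle: "hardy_norm p (\<lambda>z. f z + g z) \<le> hardy_norm p f + hardy_norm p g"
proof -
  have hol: "(\<lambda>z. f z + g z) holomorphic_on ball 0 1"
    using f g by (intro holomorphic_intros hardy_space_holomorphic)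
  have key: "hardy_mean p (\<lambda>z. f z + g z) r \<le> (hardy_norm p f + hardy_norm p g + 2 * e) powr p"
    if r: "0 < r" "r < 1" and e: "e > 0" for r e
  proof -
    \<comment> \<open>The share of \<open>A\<close> in the sum is the weight for which
      \<open>powr_add_le\<close> gives exactly \<open>(A + B) powr p\<close>. Adding
      \<open>e\<close> keeps both numbers positive, hence \<open>t\<close> strictly between 0 and 1,
      even when a norm vanishes.\<close>
    define A B t where "A = hardy_norm p f + e" "B = hardy_norm p g + e" "t = A / (A + B)"
    have AB: "A > 0" "B > 0" using hardy_norm_nonneg[of p f] hardy_norm_nonneg[of p g] e
      by (auto simp: A_B_t_def)
    then have t: "0 < t" "t < 1" by (auto simp: A_B_t_def(3))
    have 1: "1 - t = B / (A + B)" using AB by (simp add: A_B_t_def(3) field_simps)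
    have "hardy_mean p (\<lambda>z. f z + g z) r
      \<le> (LINT \<zeta>|circle_measure. t powr (1 - p) * norm (f (of_real r * \<zeta>)) powr p
                           + (1 - t) powr (1 - p) * norm (g (of_real r * \<zeta>)) powr p)"
      unfolding hardy_mean_def
    proof (rule circle_integral_mono)
      fix \<zeta> :: complex
      let ?a = "f (of_real r * \<zeta>)" and ?b = "g (of_real r * \<zeta>)"
      have "norm (?a + ?b) powr p \<le> (norm ?a + norm ?b) powr p"
        using p by (intro powr_mono2 norm_triangle_ineq) auto
      also have "\<dots> \<le> t powr (1 - p) * norm ?a powr p + (1 - t) powr (1 - p) * norm ?b powr p"
        using p t by (intro powr_add_le) auto
      finally show "norm (?a + ?b) powr p \<le> \<dots>" .
    qed (use p r hardy_space_holomorphic[OF f] hardy_space_holomorphic[OF g] in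
        \<open>auto intro!: continuous_on_add continuous_on_mult_left continuous_on_hardy_powr
           continuous_on_hardy_powr[OF hol]\<close>)
    also have "\<dots> = t powr (1 - p) * hardy_mean p f r + (1 - t) powr (1 - p) * hardy_mean p g r"
      unfolding hardy_mean_def using p r hardy_space_holomorphic[OF f] hardy_space_holomorphic[OF g]
      by (subst Bochner_Integration.integral_add)
        (auto intro!: circle_integrable continuous_on_mult_left continuous_on_hardy_powr)
    also have "\<dots> \<le> t powr (1 - p) * A powr p + (1 - t) powr (1 - p) * B powr p"
      using r p e hardy_norm_nonneg
      by (intro add_mono mult_left_mono order_trans[OF hardy_mean_le_norm[OF f]]
           order_trans[OF hardy_mean_le_norm[OF g]] powr_mono2) (auto simp: A_B_t_def(1,2))
    also have "t powr (1 - p) * A powr p = (A + B) powr (p - 1) * A"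
      using AB by (simp add: A_B_t_def(3) powr_divide powr_diff)
    also have "(1 - t) powr (1 - p) * B powr p = (A + B) powr (p - 1) * B"
      using AB unfolding 1 by (simp add: powr_divide powr_diff)
    also have "(A + B) powr (p - 1) * A + (A + B) powr (p - 1) * B = (A + B) powr p"
      using AB by (simp add: powr_diff add_divide_distrib[symmetric] distrib_left[symmetric])
    finally show ?thesis by (simp add: A_B_t_def algebra_simps)
  qed
  show "(\<lambda>z. f z + g z) \<in> hardy_space p"
    by (rule hardy_spaceI[OF hol key[of _ 1]]) auto
  show "hardy_norm p (\<lambda>z. f z + g z) \<le> hardy_norm p f + hardy_norm p g"
  proof (rule field_le_epsilon)
    fix e :: real assume "e > 0"
    then show "hardy_norm p (\<lambda>z. f z + g z) \<le> hardy_norm p f + hardy_norm p g + e"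
      using key[of _ "e / 2"] hardy_norm_nonneg[of p f] hardy_norm_nonneg[of p g] p
      by (intro hardy_norm_le) auto
  qed
qed

text \<open>Comparing moduli pointwise in the disc is enough for scalar multiples and, later, for
  the contraction factor of a block.\<close>

lemma
  assumes p: "p > 1" and f: "f \<in> hardy_space p"
    and le: "\<And>z. norm z < 1 \<Longrightarrow> norm (g z) \<le> C * norm (f z)" and C: "C \<ge> 0" and g: "g holomorphic_on ball 0 1"
  shows hardy_space_dominated: "g \<in> hardy_space p"
    and hardy_norm_dominated: "hardy_norm p g \<le> C * hardy_norm p f"
proof -
  have *: "hardy_mean p g r \<le> (C * hardy_norm p f) powr p" if r: "0 < r" "r < 1" for r
  proof -
    have "hardy_mean p g r \<le> (LINT \<zeta>|circle_measure. C powr p * norm (f (of_real r * \<zeta>)) powr p)"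
      unfolding hardy_mean_def
    proof (rule circle_integral_mono)
      fix \<zeta> :: complex assume "norm \<zeta> = 1"
      then have "norm (g (of_real r * \<zeta>)) powr p \<le> (C * norm (f (of_real r * \<zeta>))) powr p"
        using p r by (intro powr_mono2 le) (auto simp: norm_mult)
      then show "norm (g (of_real r * \<zeta>)) powr p \<le> C powr p * norm (f (of_real r * \<zeta>)) powr p"
        using C by (simp add: powr_mult)
    qed (use p r g hardy_space_holomorphic[OF f] in
        \<open>auto intro!: continuous_on_mult_left continuous_on_hardy_powr\<close>)
    also have "\<dots> = C powr p * hardy_mean p f r"
      by (simp add: hardy_mean_def)
    also have "\<dots> \<le> C powr p * hardy_norm p f powr p"
      using p r f by (intro mult_left_mono hardy_mean_le_norm) auto
    finally show ?thesis
      using C hardy_norm_nonneg by (simp add: powr_mult)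
  qed
  show "g \<in> hardy_space p" "hardy_norm p g \<le> C * hardy_norm p f"
    using * p C hardy_norm_nonneg g by (auto intro!: hardy_spaceI[OF g] hardy_norm_le)
qed

lemma
  assumes p: "p > 1" and f: "f \<in> hardy_space p"
  shows hardy_space_cmult: "(\<lambda>z. c * f z) \<in> hardy_space p"
    and hardy_norm_cmult_le: "hardy_norm p (\<lambda>z. c * f z) \<le> norm c * hardy_norm p f"
  by (auto intro!: hardy_space_dominated[OF p f, of _ "norm c"] hardy_norm_dominated[OF p f]
       holomorphic_on_mult hardy_space_holomorphic[OF f] simp: norm_mult)

lemma
  assumes p: "p > 1" and f: "f \<in> hardy_space p" and g: "g \<in> hardy_space p"
  shows hardy_space_diff: "(\<lambda>z. f z - g z) \<in> hardy_space p"
    and hardy_norm_diff_le: "hardy_norm p (\<lambda>z. f z - g z) \<le> hardy_norm p f + hardy_norm p g"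
  using hardy_space_add[OF p f hardy_space_cmult[OF p g, of "-1"]]
    hardy_norm_triangle[OF p f hardy_space_cmult[OF p g, of "-1"]]
    hardy_norm_cmult_le[OF p g, of "-1"] by auto

lemma hardy_space_sum:
  assumes p: "p > 1" and f: "\<And>i. i \<in> I \<Longrightarrow> f i \<in> hardy_space p"
  shows "(\<lambda>z. \<Sum>i\<in>I. c i * f i z) \<in> hardy_space p"
  using f
proof (induction I rule: infinite_finite_induct)
  case (insert x F)
  then have "(\<lambda>z. c x * f x z + (\<Sum>i\<in>F. c i * f i z)) \<in> hardy_space p"
    by (intro hardy_space_add hardy_space_cmult p) auto
  with insert show ?case by simp
qed (use p in \<open>auto intro!: bounded_in_hardy_space[where B = 0]\<close>)

section \<open>Parseval's identity and submean values\<close>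

lemma circle_integral_sums:
  fixes a :: "nat \<Rightarrow> complex"
  assumes a: "summable (\<lambda>n. norm (a n))" and G: "continuous_on (sphere 0 1) G"
  shows "(\<lambda>n. a n * (LINT \<zeta>|circle_measure. \<zeta> ^ n * G \<zeta>))
           sums (LINT \<zeta>|circle_measure. (\<Sum>n. a n * \<zeta> ^ n) * G \<zeta>)"
proof -
  have "bounded (G ` sphere 0 1)"
    by (intro compact_imp_bounded compact_continuous_image G) simp
  then obtain B where B: "\<And>x. x \<in> sphere 0 1 \<Longrightarrow> norm (G x) \<le> B"
    unfolding bounded_iff by blast
  have sm: "summable (\<lambda>n. norm (a n * \<zeta> ^ n * G \<zeta>))" if "norm \<zeta> = 1" for \<zeta>
    using a that by (simp add: norm_mult norm_power summable_mult2)
  have cont: "continuous_on (sphere 0 1) (\<lambda>\<zeta>. a n * \<zeta> ^ n * G \<zeta>)" for n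
    by (intro continuous_intros G)
  have "(\<lambda>n. LINT \<zeta>|circle_measure. a n * \<zeta> ^ n * G \<zeta>)
      sums (LINT \<zeta>|circle_measure. (\<Sum>n. a n * \<zeta> ^ n * G \<zeta>))"
  proof (rule sums_integral)
    show "integrable circle_measure (\<lambda>\<zeta>. a n * \<zeta> ^ n * G \<zeta>)" for n
      by (intro circle_integrable cont)
    show "AE \<zeta> in circle_measure. summable (\<lambda>n. norm (a n * \<zeta> ^ n * G \<zeta>))"
      using sm by (intro AE_I2) auto
    show "summable (\<lambda>n. LINT \<zeta>|circle_measure. norm (a n * \<zeta> ^ n * G \<zeta>))"
    proof (rule summable_comparison_test')
      show "summable (\<lambda>n. norm (a n) * B)"
        using a by (rule summable_mult2)
      fix n
      have "(LINT \<zeta>|circle_measure. norm (a n * \<zeta> ^ n * G \<zeta>)) \<le> (LINT \<zeta>|circle_measure. norm (a n) * B)"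
        by (intro circle_integral_mono continuous_on_norm cont continuous_intros)
          (use B in \<open>auto simp: norm_mult norm_power intro!: mult_left_mono\<close>)
      then show "norm (LINT \<zeta>|circle_measure. norm (a n * \<zeta> ^ n * G \<zeta>)) \<le> norm (a n) * B"
        by simp
    qed
  qed
  moreover have "(LINT \<zeta>|circle_measure. (\<Sum>n. a n * \<zeta> ^ n * G \<zeta>))
      = (LINT \<zeta>|circle_measure. (\<Sum>n. a n * \<zeta> ^ n) * G \<zeta>)"
  proof (rule Bochner_Integration.integral_cong[OF refl])
    fix \<zeta> :: complex assume "\<zeta> \<in> space circle_measure"
    then have "summable (\<lambda>n. norm (a n * \<zeta> ^ n))"
      using a by (simp add: norm_mult norm_power)
    then show "(\<Sum>n. a n * \<zeta> ^ n * G \<zeta>) = (\<Sum>n. a n * \<zeta> ^ n) * G \<zeta>"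
      by (simp add: suminf_mult2 summable_norm_cancel)
  qed
  ultimately show ?thesis
    by (simp add: mult.assoc)
qed

lemma circle_integral_power: "(LINT \<zeta>|circle_measure. \<zeta> ^ k) = (0::complex) ^ k"
proof -
  \<comment> \<open>The mean value property is available for radii below 1 only; the factor (1/2)^k
    is cancelled afterwards.\<close>
  have "(LINT \<zeta>|circle_measure. (of_real (1/2) * \<zeta>) ^ k) = (0::complex) ^ k"
    by (rule circle_mean_value) (auto intro!: holomorphic_intros)
  then have "of_real (1/2) ^ k * (LINT \<zeta>|circle_measure. \<zeta> ^ k) = (0::complex) ^ k"
    by (simp only: power_mult_distrib integral_mult_right_zero)
  then show ?thesis by (cases "k = 0") (auto simp: power_0_left)
qed

lemma circle_orthogonality:
  "(LINT \<zeta>|circle_measure. \<zeta> ^ m * cnj \<zeta> ^ n) = (if m = n then 1 else (0::complex))"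
proof -
  have *: "(LINT \<zeta>|circle_measure. \<zeta> ^ m * cnj \<zeta> ^ n) = (if m = n then 1 else (0::complex))"
    if "n \<le> m" for m n
  proof -
    have "(LINT \<zeta>|circle_measure. \<zeta> ^ m * cnj \<zeta> ^ n) = (LINT \<zeta>|circle_measure. \<zeta> ^ (m - n))"
    proof (rule Bochner_Integration.integral_cong[OF refl])
      fix \<zeta> :: complex assume "\<zeta> \<in> space circle_measure"
      then have "\<zeta> * cnj \<zeta> = 1" by (simp add: complex_norm_square[symmetric])
      then have "\<zeta> ^ n * cnj \<zeta> ^ n = 1" by (simp add: power_mult_distrib[symmetric])
      then have "\<zeta> ^ (m - n) * (\<zeta> ^ n * cnj \<zeta> ^ n) = \<zeta> ^ (m - n)" by simp
      then show "\<zeta> ^ m * cnj \<zeta> ^ n = \<zeta> ^ (m - n)"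
        using that by (simp add: mult.assoc[symmetric] power_add[symmetric])
    qed
    then show ?thesis using that by (auto simp: circle_integral_power)
  qed
  show ?thesis
  proof (cases "n \<le> m")
    case False
    have "(LINT \<zeta>|circle_measure. \<zeta> ^ m * cnj \<zeta> ^ n) = (LINT \<zeta>|circle_measure. cnj (\<zeta> ^ n * cnj \<zeta> ^ m))"
      by (simp add: mult.commute)
    also have "\<dots> = cnj (LINT \<zeta>|circle_measure. \<zeta> ^ n * cnj \<zeta> ^ m)"
      by (rule Bochner_Integration.integral_cnj)
    also have "\<dots> = (if m = n then 1 else 0)"
      using *[of m n] False by auto
    finally show ?thesis .
  qed (rule *)
qed

lemma summable_norm_disc:
  fixes a :: "nat \<Rightarrow> complex"
  assumes "\<And>z. norm z < 1 \<Longrightarrow> (\<lambda>n. a n * z ^ n) sums A z" and s: "0 \<le> s" "s < 1"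
  shows "summable (\<lambda>n. norm (a n * of_real s ^ n))"
proof (rule powser_insidea)
  show "summable (\<lambda>n. a n * (of_real ((1 + s) / 2)) ^ n)"
    using s by (intro sums_summable[OF assms(1)]) (simp del: of_real_divide of_real_add)
  show "norm (complex_of_real s) < norm (complex_of_real ((1 + s) / 2))"
    using s by (simp del: of_real_divide of_real_add)
qed

text \<open>The polarised form is needed for the cross term in \<open>circle_submean\<close>, where
  \<open>X\<close> and \<open>Y\<close> are different functions.\<close>

lemma circle_parseval:
  assumes x: "\<And>z. norm z < 1 \<Longrightarrow> (\<lambda>n. x n * z ^ n) sums X z"
    and y: "\<And>z. norm z < 1 \<Longrightarrow> (\<lambda>n. y n * z ^ n) sums Y z"
    and s: "0 \<le> s" "s < 1"
  shows "(\<lambda>n. x n * cnj (y n) * of_real ((s ^ 2) ^ n))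
    sums (LINT \<zeta>|circle_measure. X (of_real s * \<zeta>) * cnj (Y (of_real s * \<zeta>)))"
proof -
  note abs = summable_norm_disc[OF _ s]
  have eq: "A (of_real s * \<zeta>) = (\<Sum>n. (a n * of_real s ^ n) * \<zeta> ^ n)"
    if "\<And>z. norm z < 1 \<Longrightarrow> (\<lambda>n. a n * z ^ n) sums (A z :: complex)" "norm \<zeta> = 1" for a A \<zeta>
    using that(1)[of "of_real s * \<zeta>"] that(2) s
    by (simp add: norm_mult sums_iff power_mult_distrib mult.assoc)
  have contY: "continuous_on (sphere 0 1) (\<lambda>\<zeta>. Y (of_real s * \<zeta>))"
  proof (rule continuous_on_hardy)
    have "(\<lambda>n. y n * (z - 0) ^ n) sums Y z" if "z \<in> ball 0 1" for z
      using y that by simp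
    then show "Y holomorphic_on ball 0 1"
      by (rule power_series_holomorphic)
  qed (use s in auto)
  \<comment> \<open>Computed with the roles exchanged: the series of \<open>Y\<close> is integrated
    against \<open>cnj \<zeta> ^ n\<close>, and the result is conjugated.\<close>
  have coeff: "(LINT \<zeta>|circle_measure. \<zeta> ^ n * cnj (Y (of_real s * \<zeta>))) = cnj (y n * of_real s ^ n)" for n
  proof -
    have "(\<lambda>m. (y m * of_real s ^ m) * (LINT \<zeta>|circle_measure. \<zeta> ^ m * cnj \<zeta> ^ n))
        sums (LINT \<zeta>|circle_measure. (\<Sum>m. (y m * of_real s ^ m) * \<zeta> ^ m) * cnj \<zeta> ^ n)"
      by (intro circle_integral_sums abs[OF y] continuous_intros)
    then have 1: "(\<lambda>m. if m = n then y m * of_real s ^ m else 0)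
        sums (LINT \<zeta>|circle_measure. (\<Sum>m. (y m * of_real s ^ m) * \<zeta> ^ m) * cnj \<zeta> ^ n)"
      by (simp add: circle_orthogonality if_distrib cong: if_cong)
    have "(LINT \<zeta>|circle_measure. (\<Sum>m. (y m * of_real s ^ m) * \<zeta> ^ m) * cnj \<zeta> ^ n) = y n * of_real s ^ n"
      using sums_unique2[OF 1 sums_single[of n "\<lambda>m. y m * of_real s ^ m"]] .
    moreover have "(LINT \<zeta>|circle_measure. (\<Sum>m. (y m * of_real s ^ m) * \<zeta> ^ m) * cnj \<zeta> ^ n)
        = (LINT \<zeta>|circle_measure. cnj (\<zeta> ^ n * cnj (Y (of_real s * \<zeta>))))"
      by (intro Bochner_Integration.integral_cong refl) (simp add: eq[OF y])
    moreover have "\<dots> = cnj (LINT \<zeta>|circle_measure. \<zeta> ^ n * cnj (Y (of_real s * \<zeta>)))"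
      by (rule Bochner_Integration.integral_cnj)
    ultimately show ?thesis by (metis complex_cnj_cnj)
  qed
  have "(\<lambda>n. (x n * of_real s ^ n) * (LINT \<zeta>|circle_measure. \<zeta> ^ n * cnj (Y (of_real s * \<zeta>))))
      sums (LINT \<zeta>|circle_measure. (\<Sum>n. (x n * of_real s ^ n) * \<zeta> ^ n) * cnj (Y (of_real s * \<zeta>)))"
    by (intro circle_integral_sums abs[OF x] continuous_intros contY)
  also have "(LINT \<zeta>|circle_measure. (\<Sum>n. (x n * of_real s ^ n) * \<zeta> ^ n) * cnj (Y (of_real s * \<zeta>)))
      = (LINT \<zeta>|circle_measure. X (of_real s * \<zeta>) * cnj (Y (of_real s * \<zeta>)))"
    by (intro Bochner_Integration.integral_cong refl) (simp add: eq[OF x])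
  finally show ?thesis
    unfolding coeff by (simp add: mult_ac power2_eq_square power_mult_distrib)
qed

lemma powser_summable_unit:
  fixes d :: "nat \<Rightarrow> real"
  assumes "\<And>t. 0 \<le> t \<Longrightarrow> t < 1 \<Longrightarrow> summable (\<lambda>n. d n * t ^ n)" "norm t < 1"
  shows "summable (\<lambda>n. d n * t ^ n)"
proof (rule powser_inside)
  show "summable (\<lambda>n. d n * ((1 + \<bar>t\<bar>) / 2) ^ n)"
    using assms by (intro assms(1)) auto
qed (use assms(2) in auto)

text \<open>Let D be the derivative of the series. The hypothesis says that (t D)' is nonnegative;
  as t D vanishes at 0, D is nonnegative, and the series increases from its value
  \<open>d 0\<close>. For t = s^2 the expression (t D)' is a quarter of the radial Laplacian, so
  this is the submean inequality in terms of power series.\<close>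

lemma powser_ge_first:
  fixes d :: "nat \<Rightarrow> real"
  assumes sm: "\<And>t. 0 \<le> t \<Longrightarrow> t < 1 \<Longrightarrow> summable (\<lambda>n. d n * t ^ n)"
    and E: "\<And>t. 0 \<le> t \<Longrightarrow> t < 1 \<Longrightarrow> 0 \<le> (\<Sum>n. diffs (\<lambda>n. of_nat n * d n) n * t ^ n)"
    and t: "0 \<le> t" "t < 1"
  shows "d 0 \<le> (\<Sum>n. d n * t ^ n)"
proof -
  define e where "e = (\<lambda>n. real n * d n)"
  note sm' = powser_summable_unit[OF sm]
  have smd: "summable (\<lambda>n. diffs d n * t ^ n)" if "norm t < 1" for t
    using sm' that by (intro termdiff_converges[of t 1]) auto
  have e_eq: "e n * t ^ n = (if n = 0 then 0 else t * (diffs d (n - 1) * t ^ (n - 1)))" for n t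
    by (cases n) (auto simp: e_def diffs_def)
  have esums: "(\<lambda>n. e n * t ^ n) sums (t * (\<Sum>n. diffs d n * t ^ n))" if "norm t < 1" for t
  proof -
    have "(\<lambda>n. t * (diffs d n * t ^ n)) sums (t * (\<Sum>n. diffs d n * t ^ n))"
      using smd[OF that] by (intro sums_mult summable_sums)
    then have "(\<lambda>n. e (Suc n) * t ^ Suc n) sums (t * (\<Sum>n. diffs d n * t ^ n))"
      by (simp add: e_eq del: power_Suc)
    then have "(\<lambda>n. e n * t ^ n) sums (t * (\<Sum>n. diffs d n * t ^ n) + e 0 * t ^ 0)"
      by (rule sums_Suc_iff[THEN iffD1])
    then show ?thesis by (simp add: e_def)
  qed
  have D0: "0 \<le> (\<Sum>n. diffs d n * t ^ n)" if "0 \<le> t" "t < 1" for t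
  \<comment> \<open>Division by t is impossible at 0, but there both series reduce to the same
    constant term \<open>d 1\<close>.\<close>
  proof (cases "t = 0")
    case True
    have "0 \<le> (\<Sum>n. diffs e n * 0 ^ n)" using E[of 0] by (simp add: e_def)
    then show ?thesis using True by (simp add: e_def diffs_def)
  next
    case False
    have "(\<Sum>n. e n * 0 ^ n) \<le> (\<Sum>n. e n * t ^ n)"
    proof (rule DERIV_nonneg_imp_nondecreasing[where f = "\<lambda>x. \<Sum>n. e n * x ^ n"])
      fix x assume x: "0 \<le> x" "x \<le> t"
      have "((\<lambda>x. \<Sum>n. e n * x ^ n) has_real_derivative (\<Sum>n. diffs e n * x ^ n)) (at x)"
        by (rule termdiffs_strong'[where K = 1]) (use x that sums_summable[OF esums] in auto)
      moreover have "0 \<le> (\<Sum>n. diffs e n * x ^ n)"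
        using E x that by (simp add: e_def)
      ultimately show "\<exists>y. ((\<lambda>x. \<Sum>n. e n * x ^ n) has_real_derivative y) (at x) \<and> 0 \<le> y"
        by blast
    qed (use that in auto)
    also have "(\<Sum>n. e n * t ^ n) = t * (\<Sum>n. diffs d n * t ^ n)"
      using esums[of t] that by (simp add: sums_iff)
    also have "(\<Sum>n. e n * 0 ^ n) = 0" by (simp add: e_def)
    finally show ?thesis using False that by (simp add: zero_le_mult_iff)
  qed
  have "(\<Sum>n. d n * 0 ^ n) \<le> (\<Sum>n. d n * t ^ n)"
  proof (rule DERIV_nonneg_imp_nondecreasing[where f = "\<lambda>x. \<Sum>n. d n * x ^ n"])
    fix x assume x: "0 \<le> x" "x \<le> t"
    have "((\<lambda>x. \<Sum>n. d n * x ^ n) has_real_derivative (\<Sum>n. diffs d n * x ^ n)) (at x)"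
      by (rule termdiffs_strong'[where K = 1]) (use x t sm' in auto)
    then show "\<exists>y. ((\<lambda>x. \<Sum>n. d n * x ^ n) has_real_derivative y) (at x) \<and> 0 \<le> y"
      using D0 x t by fastforce
  qed (use t in auto)
  then show ?thesis by simp
qed

lemma holomorphic_sums_disc:
  assumes "X holomorphic_on ball 0 1"
  obtains x where "\<And>z. norm z < 1 \<Longrightarrow> (\<lambda>n. x n * z ^ n) sums X z"
    "\<And>z. norm z < 1 \<Longrightarrow> (\<lambda>n. diffs x n * z ^ n) sums deriv X z"
proof
  define x where "x = (\<lambda>n. (deriv ^^ n) X 0 / fact n)"
  show 1: "(\<lambda>n. x n * z ^ n) sums X z" if "norm z < 1" for z
    using holomorphic_power_series[OF assms, of z] that by (simp add: x_def)
  show "(\<lambda>n. diffs x n * z ^ n) sums deriv X z" if "norm z < 1" for z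
    by (rule termdiffs_sums_strong[OF 1 _ that])
      (use assms that in \<open>auto intro!: holomorphic_derivI[of _ "ball 0 1"]\<close>)
qed

text \<open>The hypothesis says that the integrand, as a function of \<open>s * \<zeta>\<close>, is subharmonic.\<close>
lemma circle_submean:
  assumes F: "F holomorphic_on ball 0 1" and X: "X holomorphic_on ball 0 1" and Y: "Y holomorphic_on ball 0 1"
    and lap: "\<And>z. norm z < 1 \<Longrightarrow> 0 \<le> \<kappa> * (norm (deriv F z))\<^sup>2 + Re (deriv X z * cnj (deriv Y z))"
    and s: "0 \<le> s" "s < 1"
  shows "\<kappa> * (norm (F 0))\<^sup>2 + Re (X 0 * cnj (Y 0))
     \<le> (LINT \<zeta>|circle_measure. \<kappa> * (norm (F (of_real s * \<zeta>)))\<^sup>2 + Re (X (of_real s * \<zeta>) * cnj (Y (of_real s * \<zeta>))))"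
proof -
  obtain f where f: "\<And>z. norm z < 1 \<Longrightarrow> (\<lambda>n. f n * z ^ n) sums F z"
    "\<And>z. norm z < 1 \<Longrightarrow> (\<lambda>n. diffs f n * z ^ n) sums deriv F z"
    using holomorphic_sums_disc[OF F] by blast
  obtain x where x: "\<And>z. norm z < 1 \<Longrightarrow> (\<lambda>n. x n * z ^ n) sums X z"
    "\<And>z. norm z < 1 \<Longrightarrow> (\<lambda>n. diffs x n * z ^ n) sums deriv X z"
    using holomorphic_sums_disc[OF X] by blast
  obtain y where y: "\<And>z. norm z < 1 \<Longrightarrow> (\<lambda>n. y n * z ^ n) sums Y z"
    "\<And>z. norm z < 1 \<Longrightarrow> (\<lambda>n. diffs y n * z ^ n) sums deriv Y z"
    using holomorphic_sums_disc[OF Y] by blast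
  define d where "d = (\<lambda>n. \<kappa> * (norm (f n))\<^sup>2 + Re (x n * cnj (y n)))"
  \<comment> \<open>Used twice: for \<open>F\<close>, \<open>X\<close>, \<open>Y\<close> and for
    their derivatives.\<close>
  have gen: "(\<lambda>n. (\<kappa> * (norm (a n))\<^sup>2 + Re (b n * cnj (c n))) * (s\<^sup>2) ^ n) sums
      (LINT \<zeta>|circle_measure. \<kappa> * (norm (A (of_real s * \<zeta>)))\<^sup>2 + Re (B (of_real s * \<zeta>) * cnj (C (of_real s * \<zeta>))))"
    if a: "\<And>z. norm z < 1 \<Longrightarrow> (\<lambda>n. a n * z ^ n) sums A z"
      and b: "\<And>z. norm z < 1 \<Longrightarrow> (\<lambda>n. b n * z ^ n) sums B z"
      and c: "\<And>z. norm z < 1 \<Longrightarrow> (\<lambda>n. c n * z ^ n) sums C z"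
      and s: "0 \<le> s" "s < 1" for a b c A B C s
  proof -
    have hol: "H holomorphic_on ball 0 1" if "\<And>z. norm z < 1 \<Longrightarrow> (\<lambda>n. h n * z ^ n) sums H z" for h H
      by (rule power_series_holomorphic[of 0 1 h]) (use that in auto)
    note cA = continuous_on_hardy[OF hol[OF a] s]
    note cB = continuous_on_hardy[OF hol[OF b] s]
    note cC = continuous_on_hardy[OF hol[OF c] s]
    have "(\<lambda>n. of_real \<kappa> * (a n * cnj (a n) * of_real ((s ^ 2) ^ n)) + b n * cnj (c n) * of_real ((s ^ 2) ^ n))
       sums (of_real \<kappa> * (LINT \<zeta>|circle_measure. A (of_real s * \<zeta>) * cnj (A (of_real s * \<zeta>)))
           + (LINT \<zeta>|circle_measure. B (of_real s * \<zeta>) * cnj (C (of_real s * \<zeta>))))"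
      by (intro sums_add sums_mult circle_parseval a b c s)
    also have "(of_real \<kappa> * (LINT \<zeta>|circle_measure. A (of_real s * \<zeta>) * cnj (A (of_real s * \<zeta>)))
           + (LINT \<zeta>|circle_measure. B (of_real s * \<zeta>) * cnj (C (of_real s * \<zeta>))))
      = (LINT \<zeta>|circle_measure. of_real \<kappa> * (A (of_real s * \<zeta>) * cnj (A (of_real s * \<zeta>)))
           + B (of_real s * \<zeta>) * cnj (C (of_real s * \<zeta>)))"
      by (subst Bochner_Integration.integral_add)
        (auto intro!: circle_integrable continuous_on_mult continuous_on_cnj continuous_on_const cA cB cC)
    finally have "(\<lambda>n. Re (of_real \<kappa> * (a n * cnj (a n) * of_real ((s ^ 2) ^ n)) + b n * cnj (c n) * of_real ((s ^ 2) ^ n)))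
       sums Re \<dots>" by (rule sums_Re)
    also have "Re (LINT \<zeta>|circle_measure. of_real \<kappa> * (A (of_real s * \<zeta>) * cnj (A (of_real s * \<zeta>)))
           + B (of_real s * \<zeta>) * cnj (C (of_real s * \<zeta>)))
       = (LINT \<zeta>|circle_measure. Re (of_real \<kappa> * (A (of_real s * \<zeta>) * cnj (A (of_real s * \<zeta>)))
           + B (of_real s * \<zeta>) * cnj (C (of_real s * \<zeta>))))"
      by (intro integral_Re[symmetric] circle_integrable continuous_on_add continuous_on_mult
          continuous_on_cnj continuous_on_const cA cB cC)
    finally show ?thesis
      by (simp add: complex_norm_square[symmetric] algebra_simps flip: of_real_power of_real_mult)
  qed
  have sd: "(\<lambda>n. d n * (s\<^sup>2) ^ n) sums
      (LINT \<zeta>|circle_measure. \<kappa> * (norm (F (of_real s * \<zeta>)))\<^sup>2 + Re (X (of_real s * \<zeta>) * cnj (Y (of_real s * \<zeta>))))"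
    if "0 \<le> s" "s < 1" for s
    unfolding d_def by (intro gen f x y that)
  have sdiff: "(\<lambda>n. diffs (\<lambda>n. of_nat n * d n) n * (s\<^sup>2) ^ n) sums
      (LINT \<zeta>|circle_measure. \<kappa> * (norm (deriv F (of_real s * \<zeta>)))\<^sup>2
         + Re (deriv X (of_real s * \<zeta>) * cnj (deriv Y (of_real s * \<zeta>))))"
    if "0 \<le> s" "s < 1" for s
  proof -
    have *: "(\<lambda>n. (\<kappa> * (norm (diffs f n))\<^sup>2 + Re (diffs x n * cnj (diffs y n))) * (s\<^sup>2) ^ n) sums
      (LINT \<zeta>|circle_measure. \<kappa> * (norm (deriv F (of_real s * \<zeta>)))\<^sup>2
         + Re (deriv X (of_real s * \<zeta>) * cnj (deriv Y (of_real s * \<zeta>))))"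
      by (intro gen f x y that)
    \<comment> \<open>Differentiation multiplies the coefficient of index n + 1 by n + 1 in each of
      the two factors of a product; the resulting (n + 1)^2 is also what \<open>diffs\<close> makes
      of \<open>n * d n\<close>.\<close>
    have "diffs (\<lambda>n. of_nat n * d n) n = \<kappa> * (norm (diffs f n))\<^sup>2 + Re (diffs x n * cnj (diffs y n))" for n
    proof -
      have "Re (diffs x n * cnj (diffs y n)) = Re (of_real ((1 + real n)\<^sup>2) * (x (Suc n) * cnj (y (Suc n))))"
        by (simp add: diffs_def power2_eq_square mult_ac del: times_complex.simps)
      also have "\<dots> = (1 + real n)\<^sup>2 * Re (x (Suc n) * cnj (y (Suc n)))"
        by simp
      finally have "Re (diffs x n * cnj (diffs y n)) = (1 + real n)\<^sup>2 * Re (x (Suc n) * cnj (y (Suc n)))" .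
      moreover have "norm (diffs f n) = (1 + real n) * norm (f (Suc n))"
        by (simp only: diffs_def norm_mult norm_of_nat) simp
      moreover have "diffs (\<lambda>n. of_nat n * d n) n = (1 + real n)\<^sup>2 * d (Suc n)"
        by (simp add: diffs_def power2_eq_square algebra_simps)
      ultimately show ?thesis
        unfolding d_def by (simp only: power_mult_distrib) (simp only: algebra_simps)
    qed
    with * show ?thesis by simp
  qed
  have "d 0 \<le> (\<Sum>n. d n * (s\<^sup>2) ^ n)"
  proof (rule powser_ge_first)
    fix t :: real assume t: "0 \<le> t" "t < 1"
    then have t': "0 \<le> sqrt t" "sqrt t < 1" "(sqrt t)\<^sup>2 = t" by auto
    show "summable (\<lambda>n. d n * t ^ n)"
      using sd[OF t'(1,2)] unfolding t'(3) by (rule sums_summable)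
    have "0 \<le> (LINT \<zeta>|circle_measure. \<kappa> * (norm (deriv F (of_real (sqrt t) * \<zeta>)))\<^sup>2
         + Re (deriv X (of_real (sqrt t) * \<zeta>) * cnj (deriv Y (of_real (sqrt t) * \<zeta>))))"
      using t' by (intro integral_nonneg_AE AE_I2 lap) (simp add: norm_mult)
    then show "0 \<le> (\<Sum>n. diffs (\<lambda>n. of_nat n * d n) n * t ^ n)"
      using sdiff[OF t'(1,2)] unfolding t'(3) by (simp add: sums_iff)
  qed (use s in \<open>auto simp: power_less_one_iff abs_square_less_1\<close>)
  moreover have "a 0 = (A 0 :: complex)" if "\<And>z. norm z < 1 \<Longrightarrow> (\<lambda>n. a n * z ^ n) sums A z" for a A
    by (rule sums_unique2[OF powser_sums_zero that[of 0]]) simp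
  from this[OF f(1)] this[OF x(1)] this[OF y(1)]
  have "d 0 = \<kappa> * (norm (F 0))\<^sup>2 + Re (X 0 * cnj (Y 0))"
    by (simp add: d_def)
  ultimately show ?thesis
    using sd[OF s] by (simp add: sums_iff)
qed

section \<open>Functions with positive real part\<close>

text \<open>Since 1 < p < 2, the angle \<open>p * \<theta>\<close> lies between pi / 2 and pi in
  absolute value when |\<theta>| is close to pi / 2, and the left side is negative there by a fixed
  amount. For the other angles \<open>cos \<theta>\<close> is bounded away from 0, and a large
  \<open>B\<close> pays for everything.\<close>

lemma cos_le_cos_powr:
  fixes p :: real
  assumes p: "1 < p" "p < 2"
  obtains c B where "c > 0" "B \<ge> 0" "\<And>\<theta>. \<bar>\<theta>\<bar> \<le> pi / 2 \<Longrightarrow> cos (p * \<theta>) \<le> B * cos \<theta> powr p - c"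
proof -
  \<comment> \<open>The midpoint of pi / (2 p) and pi / 2: \<open>p * t\<close> is already past pi /
    2 while \<open>t\<close> is still short of it.\<close>
  define t where "t = (pi / (2 * p) + pi / 2) / 2"
  have pp: "pi / (2 * p) < pi / 2" using p by (intro divide_strict_left_mono) auto
  then have t: "pi / (2 * p) < t" "t < pi / 2" by (auto simp: t_def)
  have "0 < pi / (2 * p)" using p by auto
  with t have t0: "0 < t" by linarith
  have "pi / 2 < p * t" using t(1) p by (simp add: field_simps)
  moreover have "p * t < 2 * (pi / 2)"
    using p t t0 by (intro mult_strict_mono) auto
  ultimately have "cos (p * t) < cos (pi / 2)"
    by (intro cos_monotone_0_pi) auto
  then have c: "- cos (p * t) > 0" by simp
  have ct: "cos t > 0" using t t0 by (intro cos_gt_zero) auto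
  \<comment> \<open>Calibrated so that at |\<theta>| = t the right side equals 1, the maximum of the
    cosine.\<close>
  define B where "B = (1 - cos (p * t)) / cos t powr p"
  show ?thesis
  proof
    show "- cos (p * t) > 0" by fact
    show "B \<ge> 0" by (simp add: B_def)
    fix \<theta> :: real assume \<theta>: "\<bar>\<theta>\<bar> \<le> pi / 2"
    show "cos (p * \<theta>) \<le> B * cos \<theta> powr p - - cos (p * t)"
    proof (cases "\<bar>\<theta>\<bar> \<le> t")
      case True
      then have "cos t \<le> cos \<bar>\<theta>\<bar>"
        using t t0 by (intro cos_monotone_0_pi_le) auto
      then have "cos t powr p \<le> cos \<theta> powr p"
        using ct p by (intro powr_mono2) auto
      then have "B * cos t powr p \<le> B * cos \<theta> powr p"
        by (intro mult_left_mono) (auto simp: B_def)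
      moreover have "B * cos t powr p = 1 - cos (p * t)"
        using ct by (simp add: B_def)
      ultimately show ?thesis using cos_le_one[of "p * \<theta>"] by linarith
    next
      case False
      have "p * \<bar>\<theta>\<bar> \<le> 2 * (pi / 2)" using \<theta> p by (intro mult_mono) auto
      then have "cos (p * \<bar>\<theta>\<bar>) \<le> cos (p * t)"
        using False p t0 by (intro cos_monotone_0_pi_le) auto
      moreover have "cos (p * \<bar>\<theta>\<bar>) = cos (p * \<theta>)"
        by (cases "\<theta> \<ge> 0") auto
      moreover have "0 \<le> B * cos \<theta> powr p" by (auto simp: B_def)
      ultimately show ?thesis by linarith
    qed
  qed
qed

lemma Re_powr_complex_of_real: "Re (w powr of_real p) = norm w powr p * cos (p * Arg w)"
proof (cases "w = 0")
  case False
  then show ?thesis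
    by (simp add: powr_def Re_exp Arg_eq_Im_Ln)
qed simp

lemma half_plane_powr:
  assumes "1 < p" "p < 2"
  obtains c B where "c > 0" "B \<ge> 0"
    "\<And>w. Re w > 0 \<Longrightarrow> Re (w powr of_real p) \<le> B * Re w powr p - c * norm w powr p"
proof -
  obtain c B where cB: "c > 0" "B \<ge> 0"
    "\<And>\<theta>. \<bar>\<theta>\<bar> \<le> pi / 2 \<Longrightarrow> cos (p * \<theta>) \<le> B * cos \<theta> powr p - c"
    using cos_le_cos_powr[OF assms] by blast
  show ?thesis
  proof (rule that[OF cB(1,2)])
    fix w :: complex assume w: "Re w > 0"
    then have "\<bar>Arg w\<bar> < pi / 2" by (metis Arg_Re_pos)
    then have "norm w powr p * cos (p * Arg w) \<le> norm w powr p * (B * cos (Arg w) powr p - c)"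
      using cB(3)[of "Arg w"] by (intro mult_left_mono) auto
    also have "\<dots> = B * (norm w * cos (Arg w)) powr p - c * norm w powr p"
      by (subst powr_mult) (auto simp: algebra_simps)
    also have "norm w * cos (Arg w) = Re w"
      using w by (subst cos_Arg) auto
    finally show "Re (w powr of_real p) \<le> B * Re w powr p - c * norm w powr p"
      by (simp add: Re_powr_complex_of_real)
  qed
qed

lemma norm_powr_of_real: "norm ((w::complex) powr of_real p) = norm w powr p"
  by (subst norm_powr_real_powr') auto

lemma continuous_on_nonneg_powr:
  fixes g :: "'a::topological_space \<Rightarrow> real"
  assumes "continuous_on S g" "p > 0" "\<And>x. x \<in> S \<Longrightarrow> 0 \<le> g x"
  shows "continuous_on S (\<lambda>x. g x powr p)"
  by (intro continuous_on_powr' continuous_intros assms) (use assms in auto)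

text \<open>The power w^p is holomorphic because the right half plane avoids the cut of the
  logarithm. Integrating the inequality of \<open>half_plane_powr\<close> turns its left side into
  the real part of w(0)^p; this must not be negative, and \<open>w 0\<close> is taken real for that
  reason.\<close>

lemma half_plane_mean_lt_2:
  assumes p: "1 < p" "p < 2"
  obtains A where "A \<ge> 0"
    "\<And>w s. w holomorphic_on ball 0 1 \<Longrightarrow> (\<And>z. norm z < 1 \<Longrightarrow> Re (w z) > 0) \<Longrightarrow> w 0 \<in> \<real> \<Longrightarrow> 0 \<le> s \<Longrightarrow> s < 1 \<Longrightarrow>
       (LINT \<zeta>|circle_measure. norm (w (of_real s * \<zeta>)) powr p)
         \<le> A * (LINT \<zeta>|circle_measure. Re (w (of_real s * \<zeta>)) powr p)"
proof -
  obtain c B where cB: "c > 0" "B \<ge> 0"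
    "\<And>w. Re w > 0 \<Longrightarrow> Re (w powr of_real p) \<le> B * Re w powr p - c * norm w powr p"
    using half_plane_powr[OF p] by blast
  show ?thesis
  proof
    show "B / c \<ge> 0" using cB by auto
    fix w s assume w: "w holomorphic_on ball 0 1" and pos: "\<And>z. norm z < 1 \<Longrightarrow> Re (w z) > 0" and w0: "w 0 \<in> \<real>"
      and s: "0 \<le> s" "s < (1::real)"
    let ?w = "\<lambda>\<zeta>. w (of_real s * \<zeta>)"
    have nn: "w z \<notin> \<real>\<^sub>\<le>\<^sub>0" if "norm z < 1" for z
      using pos[OF that] by (auto simp: complex_nonpos_Reals_iff)
    have hol: "(\<lambda>z. w z powr of_real p) holomorphic_on ball 0 1"
      by (intro holomorphic_intros w nn) auto
    have sz: "norm (of_real s * \<zeta>) < 1" if "norm \<zeta> = 1" for \<zeta> :: complex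
      using that s by (simp add: norm_mult)
    have c1: "continuous_on (sphere 0 1) (\<lambda>\<zeta>. Re (?w \<zeta>) powr p)"
      by (intro continuous_on_nonneg_powr continuous_on_Re continuous_on_hardy w s)
        (use p pos sz in \<open>auto simp: less_imp_le\<close>)
    have c2: "continuous_on (sphere 0 1) (\<lambda>\<zeta>. norm (?w \<zeta>) powr p)"
      using p by (intro continuous_on_norm_powr continuous_on_hardy w s) auto
    have c3: "continuous_on (sphere 0 1) (\<lambda>\<zeta>. ?w \<zeta> powr of_real p)"
      by (rule continuous_on_hardy[OF hol s])
    have "0 \<le> Re (w 0 powr of_real p)"
    proof -
      from w0 obtain x where x: "w 0 = of_real x" by (auto elim: Reals_cases)
      with pos[of 0] have "x > 0" by simp
      then show ?thesis by (simp add: x powr_of_real)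
    qed
    also have "\<dots> = Re (LINT \<zeta>|circle_measure. ?w \<zeta> powr of_real p)"
      by (subst circle_mean_value[OF hol s]) simp
    also have "\<dots> = (LINT \<zeta>|circle_measure. Re (?w \<zeta> powr of_real p))"
      by (intro integral_Re[symmetric] circle_integrable c3)
    also have "\<dots> \<le> (LINT \<zeta>|circle_measure. B * Re (?w \<zeta>) powr p - c * norm (?w \<zeta>) powr p)"
      using cB(3) pos sz
      by (intro circle_integral_mono continuous_on_Re c3 continuous_on_diff continuous_on_mult_left c1 c2) auto
    also have "\<dots> = B * (LINT \<zeta>|circle_measure. Re (?w \<zeta>) powr p) - c * (LINT \<zeta>|circle_measure. norm (?w \<zeta>) powr p)"
      by (subst Bochner_Integration.integral_diff)
        (auto intro!: circle_integrable continuous_on_mult_left c1 c2)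
    finally show "(LINT \<zeta>|circle_measure. norm (?w \<zeta>) powr p) \<le> B / c * (LINT \<zeta>|circle_measure. Re (?w \<zeta>) powr p)"
      using cB by (simp add: field_simps)
  qed
qed

text \<open>Split at m = p u: if m is at least p u, the first term on the right absorbs the left
  side, otherwise the second does. The constant 2 / p^2 is half of the 4 / p^2 in the subharmonic
  function, so half of its |w|^p term is left to be moved to the other side.\<close>

lemma square_mult_powr_le:
  fixes u m p :: real
  assumes "p \<ge> 2" "0 < u" "u \<le> m"
  shows "2 * u\<^sup>2 * m powr (p - 2) \<le> 2 / p\<^sup>2 * m powr p + 2 * p powr (p - 2) * u powr p"
proof (cases "p * u \<le> m")
  case True
  then have "(p * u)\<^sup>2 * m powr (p - 2) \<le> m\<^sup>2 * m powr (p - 2)"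
    using assms by (intro mult_right_mono power_mono) auto
  also have "\<dots> = m powr p"
    using assms by (simp add: powr_diff flip: powr_numeral)
  finally have "u\<^sup>2 * m powr (p - 2) \<le> m powr p / p\<^sup>2"
    using assms by (simp add: field_simps power_mult_distrib)
  moreover have "0 \<le> 2 * p powr (p - 2) * u powr p" by simp
  ultimately have "2 * (u\<^sup>2 * m powr (p - 2)) \<le> 2 * (m powr p / p\<^sup>2) + 2 * p powr (p - 2) * u powr p"
    by linarith
  then show ?thesis by simp
next
  case False
  then have "u\<^sup>2 * m powr (p - 2) \<le> u\<^sup>2 * (p * u) powr (p - 2)"
    using assms by (intro mult_left_mono powr_mono2) auto
  also have "\<dots> = p powr (p - 2) * u powr p"
    using assms by (simp add: powr_mult powr_diff flip: powr_numeral)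
  finally have "u\<^sup>2 * m powr (p - 2) \<le> p powr (p - 2) * u powr p" .
  moreover have "0 \<le> 2 / p\<^sup>2 * m powr p" by simp
  ultimately show ?thesis by linarith
qed

lemma half_plane_mean_ge_2:
  assumes p: "p \<ge> 2" and w: "w holomorphic_on ball 0 1" and pos: "\<And>z. norm z < 1 \<Longrightarrow> Re (w z) > 0"
    and w0: "w 0 \<in> \<real>" and s: "0 \<le> s" "s < 1"
  shows "(LINT \<zeta>|circle_measure. norm (w (of_real s * \<zeta>)) powr p)
    \<le> p powr p * (LINT \<zeta>|circle_measure. Re (w (of_real s * \<zeta>)) powr p)"
proof -
  let ?w = "\<lambda>\<zeta>. w (of_real s * \<zeta>)"
  have nn: "w z \<notin> \<real>\<^sub>\<le>\<^sub>0" if "norm z < 1" for z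
    using pos[OF that] by (auto simp: complex_nonpos_Reals_iff)
  have sz: "norm (of_real s * \<zeta>) < 1" if "norm \<zeta> = 1" for \<zeta> :: complex
    using that s by (simp add: norm_mult)
  define P where "P = (\<lambda>a z. w z powr of_real a)"
  have hol: "P a holomorphic_on ball 0 1" for a
    unfolding P_def by (intro holomorphic_intros w nn) auto
  have nP: "norm (P a z) = norm (w z) powr a" for a z
    by (simp add: P_def norm_powr_of_real)
  have dP: "deriv (P a) z = of_real a * P (a - 1) z * deriv w z" if z: "norm z < 1" for a z
  proof (rule DERIV_imp_deriv)
    have "(w has_field_derivative deriv w z) (at z)"
      using z by (intro holomorphic_derivI[OF w]) auto
    from DERIV_chain2[OF has_field_derivative_powr[OF nn[OF z], of "of_real a"] this]
    show "(P a has_field_derivative of_real a * P (a - 1) z * deriv w z) (at z)"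
      by (simp add: P_def)
  qed
  \<comment> \<open>The ratio of (p/2 + 1)(p/2 - 1) to (p/2)^2. With it
    \<open>\<kappa> * |F'|^2\<close> equals the modulus of \<open>X' * cnj Y'\<close>, and the
    hypothesis of \<open>circle_submean\<close> holds.\<close>
  define \<kappa> where "\<kappa> = 1 - 4 / p\<^sup>2"
  \<comment> \<open>The subharmonic function expressed through holomorphic powers of w:
    \<open>X * cnj Y\<close> is w^2 |w|^(p-2), the real part of w^2 is 2 (Re w)^2 - |w|^2, and
    \<open>|F|^2\<close> is |w|^p.\<close>
  define F X Y where "F = P (p / 2)" "X = P (p / 2 + 1)" "Y = P (p / 2 - 1)"
  have lap: "0 \<le> \<kappa> * (norm (deriv F z))\<^sup>2 + Re (deriv X z * cnj (deriv Y z))" if z: "norm z < 1" for z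
  proof -
    have wz: "norm (w z) > 0" using nn[OF z] by auto
    have "norm (deriv X z * cnj (deriv Y z))
      = (p / 2 + 1) * (p / 2 - 1) * (norm (w z) powr (p / 2) * norm (w z) powr (p / 2 - 2)) * (norm (deriv w z))\<^sup>2"
    proof -
      have "norm (deriv X z) = (p / 2 + 1) * norm (w z) powr (p / 2) * norm (deriv w z)"
        using p by (simp only: F_X_Y_def dP[OF z] norm_mult nP norm_of_real) simp
      moreover have "norm (deriv Y z) = (p / 2 - 1) * norm (w z) powr (p / 2 - 2) * norm (deriv w z)"
        using p by (simp only: F_X_Y_def dP[OF z] norm_mult nP norm_of_real) simp
      ultimately show ?thesis
        unfolding norm_mult complex_mod_cnj by (simp only: power2_eq_square mult_ac)
    qed
    also have "norm (w z) powr (p / 2) * norm (w z) powr (p / 2 - 2) = (norm (w z) powr (p / 2 - 1))\<^sup>2"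
      by (simp add: power2_eq_square powr_add[symmetric])
    also have "(p / 2 + 1) * (p / 2 - 1) = \<kappa> * (p / 2)\<^sup>2"
      using p by (simp add: \<kappa>_def field_simps power2_eq_square)
    also have "\<kappa> * (p / 2)\<^sup>2 * (norm (w z) powr (p / 2 - 1))\<^sup>2 * (norm (deriv w z))\<^sup>2 = \<kappa> * (norm (deriv F z))\<^sup>2"
      using p by (simp add: F_X_Y_def dP[OF z] norm_mult nP power_mult_distrib power_divide)
    finally show ?thesis
      using abs_Re_le_cmod[of "deriv X z * cnj (deriv Y z)"] by linarith
  qed
  have c1: "continuous_on (sphere 0 1) (\<lambda>\<zeta>. Re (?w \<zeta>) powr p)"
    by (intro continuous_on_nonneg_powr continuous_on_Re continuous_on_hardy w s)
      (use p pos sz in \<open>auto simp: less_imp_le\<close>)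
  have c2: "continuous_on (sphere 0 1) (\<lambda>\<zeta>. norm (?w \<zeta>) powr p)"
    using p by (intro continuous_on_norm_powr continuous_on_hardy w s) auto
  have P0: "P a 0 = of_real (Re (w 0) powr a)" for a
  proof -
    from w0 obtain x where x: "w 0 = of_real x" by (auto elim: Reals_cases)
    with pos[of 0] have "x > 0" by simp
    then show ?thesis by (simp add: P_def x powr_of_real)
  qed
  have \<kappa>: "0 \<le> \<kappa>"
  proof -
    have "2\<^sup>2 \<le> p\<^sup>2" using p by (intro power_mono) auto
    then show ?thesis using p by (simp add: \<kappa>_def)
  qed
  \<comment> \<open>As \<open>w 0\<close> is a positive real number, so are its powers, and both
    terms are nonnegative at the centre.\<close>
  have "0 \<le> \<kappa> * (norm (F 0))\<^sup>2 + Re (X 0 * cnj (Y 0))"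
    using \<kappa> by (simp add: F_X_Y_def P0)
  also have "\<dots> \<le> (LINT \<zeta>|circle_measure. \<kappa> * (norm (F (of_real s * \<zeta>)))\<^sup>2
                      + Re (X (of_real s * \<zeta>) * cnj (Y (of_real s * \<zeta>))))"
    using s by (intro circle_submean lap) (auto simp: F_X_Y_def hol)
  also have "\<dots> \<le> (LINT \<zeta>|circle_measure. 2 * p powr (p - 2) * Re (?w \<zeta>) powr p - 2 / p\<^sup>2 * norm (?w \<zeta>) powr p)"
  proof (rule circle_integral_mono)
    show "continuous_on (sphere 0 1) (\<lambda>\<zeta>. \<kappa> * (norm (F (of_real s * \<zeta>)))\<^sup>2
                      + Re (X (of_real s * \<zeta>) * cnj (Y (of_real s * \<zeta>))))"
      unfolding F_X_Y_def
      by (intro continuous_intros continuous_on_hardy hol s)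
    show "continuous_on (sphere 0 1) (\<lambda>\<zeta>. 2 * p powr (p - 2) * Re (?w \<zeta>) powr p - 2 / p\<^sup>2 * norm (?w \<zeta>) powr p)"
      by (intro continuous_on_diff continuous_on_mult_left c1 c2)
    fix \<zeta> :: complex assume "norm \<zeta> = 1"
    define z where "z = of_real s * \<zeta>"
    have z: "norm z < 1" unfolding z_def by (rule sz) fact
    have wz: "Re (w z) > 0" "w z \<noteq> 0" using pos[OF z] by auto
    have "X z = Y z * w z ^ 2"
      using wz by (simp add: F_X_Y_def P_def powr_add powr_diff power2_eq_square)
    then have "X z * cnj (Y z) = w z ^ 2 * (Y z * cnj (Y z))" by simp
    also have "\<dots> = w z ^ 2 * of_real (norm (Y z) ^ 2)"
      by (simp only: complex_norm_square)
    finally have "Re (X z * cnj (Y z)) = Re (w z ^ 2) * norm (Y z) ^ 2" by simp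
    also have "Re (w z ^ 2) = 2 * Re (w z) ^ 2 - norm (w z) ^ 2"
      by (simp add: Re_power2 cmod_power2)
    also have "norm (Y z) ^ 2 = norm (w z) powr (p - 2)"
      using p by (simp add: F_X_Y_def nP power2_eq_square powr_add[symmetric])
    finally have 1: "Re (X z * cnj (Y z)) = 2 * Re (w z) ^ 2 * norm (w z) powr (p - 2) - norm (w z) ^ 2 * norm (w z) powr (p - 2)"
      by (simp add: left_diff_distrib)
    have 2: "norm (w z) ^ 2 * norm (w z) powr (p - 2) = norm (w z) powr p"
      using wz by (simp add: powr_diff flip: powr_numeral)
    have 3: "norm (F z) ^ 2 = norm (w z) powr p"
      using p by (simp add: F_X_Y_def nP power2_eq_square powr_add[symmetric])
    have 4: "2 * (Re (w z))\<^sup>2 * norm (w z) powr (p - 2)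
        \<le> 2 / p\<^sup>2 * norm (w z) powr p + 2 * p powr (p - 2) * Re (w z) powr p"
      using p wz complex_Re_le_cmod by (intro square_mult_powr_le) auto
    show "\<kappa> * (norm (F (of_real s * \<zeta>)))\<^sup>2 + Re (X (of_real s * \<zeta>) * cnj (Y (of_real s * \<zeta>)))
      \<le> 2 * p powr (p - 2) * Re (?w \<zeta>) powr p - 2 / p\<^sup>2 * norm (?w \<zeta>) powr p"
      using 4 unfolding z_def[symmetric] 1 2 3 \<kappa>_def by (simp add: algebra_simps)
  qed
  also have "\<dots> = 2 * p powr (p - 2) * (LINT \<zeta>|circle_measure. Re (?w \<zeta>) powr p)
      - 2 / p\<^sup>2 * (LINT \<zeta>|circle_measure. norm (?w \<zeta>) powr p)"
    by (subst Bochner_Integration.integral_diff;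
        (intro circle_integrable continuous_on_mult_left c1 c2)?) simp
  finally have "2 / p\<^sup>2 * (LINT \<zeta>|circle_measure. norm (?w \<zeta>) powr p)
      \<le> 2 * p powr (p - 2) * (LINT \<zeta>|circle_measure. Re (?w \<zeta>) powr p)" by simp
  moreover have "p powr (p - 2) = p powr p / p\<^sup>2"
    using p by (simp add: powr_diff flip: powr_numeral)
  ultimately show ?thesis
    using p by (simp add: field_simps)
qed

lemma half_plane_mean:
  assumes p: "1 < p"
  obtains A where "A \<ge> 0"
    "\<And>w s. w holomorphic_on ball 0 1 \<Longrightarrow> (\<And>z. norm z < 1 \<Longrightarrow> Re (w z) > 0) \<Longrightarrow> w 0 \<in> \<real> \<Longrightarrow> 0 \<le> s \<Longrightarrow> s < 1 \<Longrightarrow>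
       (LINT \<zeta>|circle_measure. norm (w (of_real s * \<zeta>)) powr p)
         \<le> A * (LINT \<zeta>|circle_measure. Re (w (of_real s * \<zeta>)) powr p)"
proof (cases "p < 2")
  case True
  then show ?thesis using half_plane_mean_lt_2[OF p] that by blast
next
  case False
  then show ?thesis
    by (intro that[of "p powr p"] half_plane_mean_ge_2) auto
qed

section \<open>Kernels on a block\<close>

definition unity_root :: "nat \<Rightarrow> nat \<Rightarrow> complex" where
  "unity_root n j = exp (2 * of_real pi * \<i> * of_nat j / of_nat n)"

lemma unity_root_conv_cis: "unity_root n j = cis (2 * pi * real j / real n)"
  by (simp add: unity_root_def cis_conv_exp mult_ac)

lemma norm_unity_root [simp]: "norm (unity_root n j) = 1"
  by (simp add: unity_root_conv_cis)

text \<open>Exchanging exponent and index turns sums over the nodes into geometric sums in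
  \<open>j\<close>.\<close>

lemma unity_root_power_swap: "unity_root n j ^ m = unity_root n m ^ j"
  by (simp add: unity_root_conv_cis Complex.DeMoivre mult_ac)

lemma unity_root_power_self [simp]: "n > 0 \<Longrightarrow> unity_root n j ^ n = 1"
  using complex_root_unity[of n j] by (simp add: unity_root_def)

lemma unity_root_orthogonality:
  assumes "m < n" "l < n"
  shows "(\<Sum>j<n. unity_root n j ^ m * cnj (unity_root n j) ^ l) = (if m = l then of_nat n else 0)"
proof -
  define q where "q = unity_root n m * cnj (unity_root n l)"
  have "unity_root n j ^ m * cnj (unity_root n j) ^ l = q ^ j" for j
    by (simp add: q_def power_mult_distrib unity_root_power_swap[of n j] flip: complex_cnj_power)
  then have eq: "(\<Sum>j<n. unity_root n j ^ m * cnj (unity_root n j) ^ l) = (\<Sum>j<n. q ^ j)" by simp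
  have unit: "unity_root n l * cnj (unity_root n l) = 1"
    by (simp add: complex_norm_square[symmetric])
  show ?thesis
  proof (cases "m = l")
    case True
    then show ?thesis unfolding eq by (simp add: q_def unit)
  next
    case False
    have "q \<noteq> 1"
    proof
      assume "q = 1"
      then have "unity_root n m * (unity_root n l * cnj (unity_root n l)) = unity_root n l"
        by (simp add: q_def mult_ac)
      then have "unity_root n m = unity_root n l" by (simp add: unit)
      then show False
        using assms False complex_root_unity_eq[of n m l] by (simp add: unity_root_def cong_def)
    qed
    moreover have "q ^ n = 1"
      using assms by (simp add: q_def power_mult_distrib flip: complex_cnj_power)
    ultimately show ?thesis unfolding eq using False by (simp add: geometric_sum)
  qed
qed

text \<open>The n-th power of \<open>cnj (unity_root n j) * y\<close> is \<open>y ^ n\<close> for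
  every \<open>j\<close>. All terms therefore share the denominator \<open>1 - y ^ n\<close>, with
  numerators of degree below \<open>n\<close> in \<open>y\<close>, and orthogonality selects the
  power \<open>m\<close>.\<close>

lemma unity_root_kernel_sum:
  assumes "norm y < 1" "m < n"
  shows "(\<Sum>j<n. unity_root n j ^ m / (1 - cnj (unity_root n j) * y)) = of_nat n * y ^ m / (1 - y ^ n)"
proof -
  have n: "n > 0" using assms by simp
  have yn: "1 - y ^ n \<noteq> 0"
    using assms n by (metis norm_one norm_power power_less_one_iff norm_ge_zero right_minus_eq less_irrefl)
  have kern: "1 / (1 - cnj (unity_root n j) * y) = (\<Sum>l<n. cnj (unity_root n j) ^ l * y ^ l) / (1 - y ^ n)" for j
  proof -
    let ?x = "cnj (unity_root n j) * y"
    have "norm ?x < 1" using assms by (simp add: norm_mult)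
    then have x: "1 - ?x \<noteq> 0" by (metis norm_one less_irrefl right_minus_eq)
    have "?x ^ n = y ^ n"
      using n by (simp add: power_mult_distrib flip: complex_cnj_power)
    then have "1 - y ^ n = (1 - ?x) * (\<Sum>l<n. ?x ^ l)"
      by (metis one_diff_power_eq)
    then show ?thesis
      using x yn by (simp add: divide_simps power_mult_distrib mult_ac)
  qed
  have "(\<Sum>j<n. unity_root n j ^ m / (1 - cnj (unity_root n j) * y))
      = (\<Sum>j<n. \<Sum>l<n. (unity_root n j ^ m * cnj (unity_root n j) ^ l) * y ^ l) / (1 - y ^ n)"
  proof -
    have "(\<Sum>j<n. unity_root n j ^ m / (1 - cnj (unity_root n j) * y))
        = (\<Sum>j<n. unity_root n j ^ m * ((\<Sum>l<n. cnj (unity_root n j) ^ l * y ^ l) / (1 - y ^ n)))"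
      by (simp flip: kern)
    then show ?thesis
      by (simp add: sum_divide_distrib sum_distrib_left mult.assoc)
  qed
  also have "(\<Sum>j<n. \<Sum>l<n. (unity_root n j ^ m * cnj (unity_root n j) ^ l) * y ^ l)
      = (\<Sum>l<n. (\<Sum>j<n. unity_root n j ^ m * cnj (unity_root n j) ^ l) * y ^ l)"
    by (subst sum.swap) (simp add: sum_distrib_right)
  also have "\<dots> = (\<Sum>l<n. (if l = m then of_nat n * y ^ m else 0))"
    using assms by (intro sum.cong) (auto simp: unity_root_orthogonality)
  also have "\<dots> = of_nat n * y ^ m" using assms by simp
  finally show ?thesis .
qed

section \<open>Cauchy kernels in the disc\<close>

lemma norm_cnj_mult_less_1: "norm a < 1 \<Longrightarrow> norm z \<le> 1 \<Longrightarrow> norm (cnj a * z) < 1"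
  using mult_left_mono[of "norm z" 1 "norm a"] by (simp add: norm_mult)

lemma cauchy_kernel_holomorphic:
  assumes "norm a < 1"
  shows "cauchy_kernel a holomorphic_on ball 0 1"
proof -
  have "1 - cnj a * z \<noteq> 0" if "norm z < 1" for z
    using norm_cnj_mult_less_1[OF assms, of z] that by auto
  then show ?thesis
    unfolding cauchy_kernel_def by (auto intro!: holomorphic_intros)
qed

lemma Re_cauchy_kernel_pos:
  assumes "norm a < 1" "norm z < 1"
  shows "Re (cauchy_kernel a z) > 0"
proof -
  have "Re (cnj a * z) < 1"
    using norm_cnj_mult_less_1[OF assms(1), of z] complex_Re_le_cmod[of "cnj a * z"] assms(2) by linarith
  then have "Re (1 - cnj a * z) > 0" by simp
  then have "Re (inverse (1 - cnj a * z)) > 0"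
    unfolding complex_inverse[of] by (auto simp add: sum_power2_gt_zero_iff intro!: divide_pos_pos)
  then show ?thesis by (simp add: cauchy_kernel_def inverse_eq_divide)
qed

lemma cauchy_kernel_in_hardy_space:
  assumes "norm a < 1" "p > 0"
  shows "cauchy_kernel a \<in> hardy_space p"
proof (rule bounded_in_hardy_space[where B = "1 / (1 - norm a)"])
  fix z :: complex assume z: "norm z < 1"
  have "1 - norm a \<le> 1 - norm (cnj a * z)"
    using z by (simp add: norm_mult mult_left_le)
  also have "\<dots> \<le> norm (1 - cnj a * z)"
    using norm_triangle_ineq2[of 1 "cnj a * z"] by simp
  finally show "norm (cauchy_kernel a z) \<le> 1 / (1 - norm a)"
    unfolding cauchy_kernel_def using assms by (simp add: norm_divide frac_le)
qed (use assms in \<open>auto intro: cauchy_kernel_holomorphic\<close>)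

text \<open>The nodes \<open>unity_root n j / r\<close> are the reflections of the kernel points in
  the unit circle; dividing by \<open>r\<close> cancels the factor \<open>r ^ m\<close> with which
  kernels at radius \<open>r\<close> damp the m-th power of z.\<close>

lemma kernel_block_sum:
  assumes "0 < r" "r < 1" "norm z < 1" "N \<le> n" "n > 0"
  shows "(\<Sum>j<n. (\<Sum>m<N. a m * (unity_root n j / of_real r) ^ m) * cauchy_kernel (of_real r * unity_root n j) z)
     = of_nat n * (\<Sum>m<N. a m * z ^ m) / (1 - (of_real r * z) ^ n)"
proof -
  have y: "norm (of_real r * z) < 1"
    using assms norm_cnj_mult_less_1[of "of_real r" z] by simp
  have "(\<Sum>j<n. (\<Sum>m<N. a m * (unity_root n j / of_real r) ^ m) * cauchy_kernel (of_real r * unity_root n j) z)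
     = (\<Sum>j<n. \<Sum>m<N. (a m / of_real r ^ m) * (unity_root n j ^ m / (1 - cnj (unity_root n j) * (of_real r * z))))"
    by (simp add: cauchy_kernel_def sum_distrib_right sum_divide_distrib power_divide mult_ac)
  also have "\<dots> = (\<Sum>m<N. (a m / of_real r ^ m) * (\<Sum>j<n. unity_root n j ^ m / (1 - cnj (unity_root n j) * (of_real r * z))))"
    by (subst sum.swap) (simp add: sum_distrib_left)
  also have "\<dots> = (\<Sum>m<N. (a m / of_real r ^ m) * (of_nat n * (of_real r * z) ^ m / (1 - (of_real r * z) ^ n)))"
    using assms y by (intro sum.cong refl arg_cong2[where f = "(*)"] unity_root_kernel_sum) auto
  also have "\<dots> = (\<Sum>m<N. of_nat n * (a m * z ^ m) / (1 - (of_real r * z) ^ n))"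
    using assms by (intro sum.cong refl) (simp add: power_mult_distrib)
  finally show ?thesis
    by (simp add: sum_divide_distrib sum_distrib_left)
qed

text \<open>The case \<open>m = 0\<close> of \<open>unity_root_kernel_sum\<close>.\<close>

lemma Re_kernel_sum_le:
  assumes "0 \<le> r" "r < 1" "norm z < 1" "n > 0" "r ^ n \<le> \<rho>" "\<rho> < 1"
  shows "(\<Sum>j<n. Re (cauchy_kernel (of_real r * unity_root n j) z)) \<le> real n / (1 - \<rho>)"
proof -
  let ?y = "of_real r * z"
  have y: "norm ?y \<le> r" using assms by (simp add: norm_mult mult_left_le)
  have "(\<Sum>j<n. cauchy_kernel (of_real r * unity_root n j) z)
      = (\<Sum>j<n. unity_root n j ^ 0 / (1 - cnj (unity_root n j) * ?y))"
    by (simp add: cauchy_kernel_def mult_ac)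
  also have "\<dots> = of_nat n * ?y ^ 0 / (1 - ?y ^ n)"
    using assms y by (intro unity_root_kernel_sum) auto
  finally have "(\<Sum>j<n. Re (cauchy_kernel (of_real r * unity_root n j) z)) = Re (of_nat n / (1 - ?y ^ n))"
    by (simp flip: Re_sum)
  also have "\<dots> \<le> norm (of_nat n / (1 - ?y ^ n))" by (rule complex_Re_le_cmod)
  also have "\<dots> = real n / norm (1 - ?y ^ n)" by (simp add: norm_divide)
  also have "\<dots> \<le> real n / (1 - \<rho>)"
  proof (rule divide_left_mono)
    have "norm (?y ^ n) \<le> r ^ n" unfolding norm_power using y by (intro power_mono) auto
    then show *: "1 - \<rho> \<le> norm (1 - ?y ^ n)"
      using assms norm_triangle_ineq2[of 1 "?y ^ n"] by simp
    then show "0 < norm (1 - ?y ^ n) * (1 - \<rho>)" using assms by (intro mult_pos_pos) auto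
  qed simp
  finally show ?thesis .
qed

lemma norm_node_less_1: "0 \<le> r \<Longrightarrow> r < 1 \<Longrightarrow> norm (of_real r * unity_root n j) < 1"
  by (simp add: norm_mult)

text \<open>Jensen is used with the values of the real parts of the kernels as weights, so the
  coefficients are raised to the power \<open>p\<close> while the kernels enter linearly. Each real
  part has mean 1, the value of the kernel at 0, which leaves the bare sum of the powers
  \<open>c j powr p\<close>.\<close>

lemma positive_block_bound:
  assumes p: "p > 1" and \<rho>: "\<rho> < 1"
  obtains C where "C \<ge> 0"
    "\<And>n r c. n > 0 \<Longrightarrow> 0 \<le> r \<Longrightarrow> r < 1 \<Longrightarrow> r ^ n \<le> \<rho> \<Longrightarrow> (\<And>j. j < n \<Longrightarrow> 0 \<le> c j) \<Longrightarrow>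
      hardy_norm p (\<lambda>z. \<Sum>j<n. of_real (c j) * cauchy_kernel (of_real r * unity_root n j) z)
        \<le> C * (real n powr (p - 1) * (\<Sum>j<n. c j powr p)) powr (1 / p)"
proof -
  obtain A where A: "A \<ge> 0"
    "\<And>w s. w holomorphic_on ball 0 1 \<Longrightarrow> (\<And>z. norm z < 1 \<Longrightarrow> Re (w z) > 0) \<Longrightarrow> w 0 \<in> \<real> \<Longrightarrow> 0 \<le> s \<Longrightarrow> s < 1 \<Longrightarrow>
       (LINT \<zeta>|circle_measure. norm (w (of_real s * \<zeta>)) powr p)
         \<le> A * (LINT \<zeta>|circle_measure. Re (w (of_real s * \<zeta>)) powr p)"
    using half_plane_mean[OF p] by blast
  \<comment> \<open>\<open>A\<close> comes from the Riesz inequality, the other factor from the mass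
    \<open>n / (1 - \<rho>)\<close> of the weights; its power of n stays visible in the
    bound.\<close>
  define C where "C = (A * (1 / (1 - \<rho>)) powr (p - 1)) powr (1 / p)"
  show ?thesis
  proof
    show "C \<ge> 0" by (simp add: C_def)
    fix n :: nat and r :: real and c :: "nat \<Rightarrow> real"
    assume n: "n > 0" and r: "0 \<le> r" "r < 1" "r ^ n \<le> \<rho>" and c: "\<And>j. j < n \<Longrightarrow> 0 \<le> c j"
    define k where "k = (\<lambda>j. cauchy_kernel (of_real r * unity_root n j))"
    define w where "w = (\<lambda>z. \<Sum>j<n. of_real (c j) * k j z)"
    define B where "B = C * (real n powr (p - 1) * (\<Sum>j<n. c j powr p)) powr (1 / p)"
    have B: "B \<ge> 0" by (simp add: B_def C_def)
    have holk: "k j holomorphic_on ball 0 1" for j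
      unfolding k_def by (intro cauchy_kernel_holomorphic norm_node_less_1 r)
    have "hardy_norm p w \<le> B"
    \<comment> \<open>The zero combination has no strictly positive real part and falls outside
      \<open>half_plane_mean\<close>.\<close>
    proof (cases "\<forall>j<n. c j = 0")
      case True
      then have "hardy_norm p w \<le> 0"
        using p by (intro hardy_norm_le_sup) (auto simp: w_def)
      with B show ?thesis by linarith
    next
      case False
      have kpos: "0 < Re (k j z)" if "norm z < 1" for j z
        unfolding k_def by (intro Re_cauchy_kernel_pos norm_node_less_1 r that)
      have hol: "w holomorphic_on ball 0 1"
        unfolding w_def by (intro holomorphic_intros holk)
      have Rew: "Re (w z) = (\<Sum>j<n. Re (k j z) * c j)" for z
        by (simp add: w_def mult.commute)
      have pos: "0 < Re (w z)" if "norm z < 1" for z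
      proof -
        from False obtain i where i: "i < n" "c i \<noteq> 0" by auto
        show ?thesis unfolding Rew
        proof (rule sum_pos2[of _ i])
          show "0 < Re (k i z) * c i" using kpos[OF that, of i] i c[of i] by (intro mult_pos_pos) auto
          show "0 \<le> Re (k j z) * c j" if "j \<in> {..<n}" for j
            using kpos[OF \<open>norm z < 1\<close>, of j] c[of j] that by (intro mult_nonneg_nonneg) auto
        qed (use i in auto)
      qed
      have w0: "w 0 \<in> \<real>" by (simp add: w_def k_def cauchy_kernel_def)
      show ?thesis
      proof (rule hardy_norm_le)
        fix s :: real assume s: "0 < s" "s < 1"
        have "hardy_mean p w s \<le> A * (LINT \<zeta>|circle_measure. Re (w (of_real s * \<zeta>)) powr p)"
          unfolding hardy_mean_def using s by (intro A(2) hol pos w0) auto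
        also have "(LINT \<zeta>|circle_measure. Re (w (of_real s * \<zeta>)) powr p)
            \<le> (LINT \<zeta>|circle_measure. (real n / (1 - \<rho>)) powr (p - 1) * (\<Sum>j<n. Re (k j (of_real s * \<zeta>)) * c j powr p))"
        proof (rule circle_integral_mono)
          fix \<zeta> :: complex assume \<zeta>: "norm \<zeta> = 1"
          then have z: "norm (of_real s * \<zeta>) < 1" using s by (simp add: norm_mult)
          show "Re (w (of_real s * \<zeta>)) powr p
            \<le> (real n / (1 - \<rho>)) powr (p - 1) * (\<Sum>j<n. Re (k j (of_real s * \<zeta>)) * c j powr p)"
            unfolding Rew
          proof (rule powr_sum_le)
            show "(\<Sum>j<n. Re (k j (of_real s * \<zeta>))) \<le> real n / (1 - \<rho>)"
              unfolding k_def by (intro Re_kernel_sum_le r z n \<rho>)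
          qed (use p c n \<rho> kpos[OF z] in \<open>auto intro: less_imp_le\<close>)
        next
          show "continuous_on (sphere 0 1) (\<lambda>\<zeta>. Re (w (of_real s * \<zeta>)) powr p)"
            using s p by (intro continuous_on_nonneg_powr continuous_on_Re continuous_on_hardy hol less_imp_le[OF pos])
              (auto simp: norm_mult)
          show "continuous_on (sphere 0 1)
              (\<lambda>\<zeta>. (real n / (1 - \<rho>)) powr (p - 1) * (\<Sum>j<n. Re (k j (of_real s * \<zeta>)) * c j powr p))"
            using s by (intro continuous_on_mult_left continuous_on_sum continuous_on_mult_right continuous_on_Re
                continuous_on_hardy holk) auto
        qed
        also have "(LINT \<zeta>|circle_measure. (real n / (1 - \<rho>)) powr (p - 1) * (\<Sum>j<n. Re (k j (of_real s * \<zeta>)) * c j powr p))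
            = (real n / (1 - \<rho>)) powr (p - 1) * (\<Sum>j<n. c j powr p)"
        proof -
          have ck: "continuous_on (sphere 0 1) (\<lambda>\<zeta>. k j (of_real s * \<zeta>))" for j
            using s by (intro continuous_on_hardy holk) auto
          have "(LINT \<zeta>|circle_measure. Re (k j (of_real s * \<zeta>))) = Re (LINT \<zeta>|circle_measure. k j (of_real s * \<zeta>))" for j
            by (intro integral_Re circle_integrable ck)
          moreover have "(LINT \<zeta>|circle_measure. k j (of_real s * \<zeta>)) = k j 0" for j
            using s by (intro circle_mean_value holk) auto
          moreover have "k j 0 = 1" for j by (simp add: k_def cauchy_kernel_def)
          ultimately have one: "(LINT \<zeta>|circle_measure. Re (k j (of_real s * \<zeta>))) = 1" for j
            by simp
          show ?thesis
            by (subst integral_mult_right_zero, subst Bochner_Integration.integral_sum)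
              (auto intro!: circle_integrable continuous_on_mult_right continuous_on_Re ck simp: one)
        qed
        also have "A * ((real n / (1 - \<rho>)) powr (p - 1) * (\<Sum>j<n. c j powr p)) = B powr p"
        proof -
          have "(real n / (1 - \<rho>)) powr (p - 1) = real n powr (p - 1) * (1 / (1 - \<rho>)) powr (p - 1)"
            using \<rho> n by (subst powr_mult[symmetric]) auto
          moreover have "0 \<le> (\<Sum>j<n. c j powr p)" by (simp add: sum_nonneg)
          ultimately show ?thesis
            using p A(1) by (simp add: B_def C_def powr_mult powr_powr)
        qed
        finally show "hardy_mean p w s \<le> B powr p" using A(1) by (simp add: mult_left_mono)
      qed (use p B in auto)
    qed
    then show "hardy_norm p (\<lambda>z. \<Sum>j<n. of_real (c j) * cauchy_kernel (of_real r * unity_root n j) z)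
        \<le> C * (real n powr (p - 1) * (\<Sum>j<n. c j powr p)) powr (1 / p)"
      by (simp add: w_def k_def B_def)
  qed
qed

text \<open>A partial sum is a full block whose coefficients from \<open>J\<close> on are replaced
  by 0. The factor 4 counts the positive and negative parts of the real and imaginary parts of the
  coefficients.\<close>

lemma block_bound:
  assumes p: "p > 1" and \<rho>: "\<rho> < 1"
  obtains C where "C \<ge> 0"
    "\<And>n r c J. n > 0 \<Longrightarrow> 0 \<le> r \<Longrightarrow> r < 1 \<Longrightarrow> r ^ n \<le> \<rho> \<Longrightarrow> J \<le> n \<Longrightarrow>
      hardy_norm p (\<lambda>z. \<Sum>j<J. c j * cauchy_kernel (of_real r * unity_root n j) z)
        \<le> C * (real n powr (p - 1) * (\<Sum>j<n. norm (c j) powr p)) powr (1 / p)"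
proof -
  obtain C where C: "C \<ge> 0"
    "\<And>n r c. n > 0 \<Longrightarrow> 0 \<le> r \<Longrightarrow> r < 1 \<Longrightarrow> r ^ n \<le> \<rho> \<Longrightarrow> (\<And>j. j < n \<Longrightarrow> 0 \<le> c j) \<Longrightarrow>
      hardy_norm p (\<lambda>z. \<Sum>j<n. of_real (c j) * cauchy_kernel (of_real r * unity_root n j) z)
        \<le> C * (real n powr (p - 1) * (\<Sum>j<n. c j powr p)) powr (1 / p)"
    using positive_block_bound[OF p \<rho>] by blast
  show ?thesis
  proof
    show "4 * C \<ge> 0" using C by simp
    fix n J :: nat and r :: real and c :: "nat \<Rightarrow> complex"
    assume n: "n > 0" and r: "0 \<le> r" "r < 1" "r ^ n \<le> \<rho>" and J: "J \<le> n"
    define B where "B = C * (real n powr (p - 1) * (\<Sum>j<n. norm (c j) powr p)) powr (1 / p)"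
    define k where "k = (\<lambda>j. cauchy_kernel (of_real r * unity_root n j))"
    define S where "S = (\<lambda>d z. \<Sum>j<n. of_real (if j < J then d j else 0) * k j z)"
    define dp dm ep em where "dp = (\<lambda>j. max 0 (Re (c j)))" "dm = (\<lambda>j. max 0 (- Re (c j)))"
      "ep = (\<lambda>j. max 0 (Im (c j)))" "em = (\<lambda>j. max 0 (- Im (c j)))"
    have part: "hardy_norm p (S d) \<le> B" if d: "\<And>j. 0 \<le> d j \<and> d j \<le> norm (c j)" for d
    proof -
      have "hardy_norm p (S d) \<le> C * (real n powr (p - 1) * (\<Sum>j<n. (if j < J then d j else 0) powr p)) powr (1 / p)"
        unfolding S_def k_def using d by (intro C(2) n r) auto
      also have "\<dots> \<le> B"
        unfolding B_def using p d C(1)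
        by (intro mult_left_mono powr_mono2 sum_mono) (auto intro!: mult_nonneg_nonneg sum_nonneg)
      finally show ?thesis .
    qed
    have kH: "k j \<in> hardy_space p" for j
      unfolding k_def using p by (intro cauchy_kernel_in_hardy_space norm_node_less_1 r) auto
    have SH: "S d \<in> hardy_space p" for d
      unfolding S_def by (intro hardy_space_sum p kH)
    have "(\<Sum>j<J. c j * k j z) = (S dp z - S dm z) + \<i> * (S ep z - S em z)" for z
    proof -
      have "(\<Sum>j<J. c j * k j z) = (\<Sum>j<n. (if j < J then c j else 0) * k j z)"
        using J by (intro sum.mono_neutral_cong_left) auto
      also have "\<dots> = (\<Sum>j<n. (of_real (if j < J then dp j else 0) * k j z - of_real (if j < J then dm j else 0) * k j z)
         + \<i> * (of_real (if j < J then ep j else 0) * k j z - of_real (if j < J then em j else 0) * k j z))"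
      proof (rule sum.cong[OF refl])
        fix j
        have "c j = (of_real (dp j) - of_real (dm j)) + \<i> * (of_real (ep j) - of_real (em j))"
          by (auto simp: dp_dm_ep_em_def complex_eq_iff max_def)
        then show "(if j < J then c j else 0) * k j z
          = (of_real (if j < J then dp j else 0) * k j z - of_real (if j < J then dm j else 0) * k j z)
         + \<i> * (of_real (if j < J then ep j else 0) * k j z - of_real (if j < J then em j else 0) * k j z)"
          by (cases "j < J") (simp_all only: if_True if_False, simp_all add: ring_distribs mult.assoc)
      qed
      also have "\<dots> = (S dp z - S dm z) + \<i> * (S ep z - S em z)"
        by (simp add: S_def sum.distrib sum_subtractf flip: sum_distrib_left)
      finally show ?thesis .
    qed
    then have "hardy_norm p (\<lambda>z. \<Sum>j<J. c j * k j z)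
      = hardy_norm p (\<lambda>z. (S dp z - S dm z) + \<i> * (S ep z - S em z))" by simp
    also have "\<dots> \<le> hardy_norm p (\<lambda>z. S dp z - S dm z) + hardy_norm p (\<lambda>z. \<i> * (S ep z - S em z))"
      by (intro hardy_norm_triangle p hardy_space_diff hardy_space_cmult SH)
    also have "hardy_norm p (\<lambda>z. S dp z - S dm z) \<le> hardy_norm p (S dp) + hardy_norm p (S dm)"
      by (intro hardy_norm_diff_le p SH)
    also have "hardy_norm p (\<lambda>z. \<i> * (S ep z - S em z)) \<le> norm \<i> * hardy_norm p (\<lambda>z. S ep z - S em z)"
      by (intro hardy_norm_cmult_le p hardy_space_diff SH)
    also have "hardy_norm p (\<lambda>z. S ep z - S em z) \<le> hardy_norm p (S ep) + hardy_norm p (S em)"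
      by (intro hardy_norm_diff_le p SH)
    also have "hardy_norm p (S dp) \<le> B"
      by (rule part) (use abs_Re_le_cmod in \<open>auto simp: dp_dm_ep_em_def intro: order_trans[OF abs_ge_self]\<close>)
    also have "hardy_norm p (S dm) \<le> B"
      by (rule part) (use abs_Re_le_cmod in \<open>auto simp: dp_dm_ep_em_def intro: order_trans[OF abs_ge_minus_self]\<close>)
    also have "hardy_norm p (S ep) \<le> B"
      by (rule part) (use abs_Im_le_cmod in \<open>auto simp: dp_dm_ep_em_def intro: order_trans[OF abs_ge_self]\<close>)
    also have "hardy_norm p (S em) \<le> B"
      by (rule part) (use abs_Im_le_cmod in \<open>auto simp: dp_dm_ep_em_def intro: order_trans[OF abs_ge_minus_self]\<close>)
    finally have "hardy_norm p (\<lambda>z. \<Sum>j<J. c j * k j z) \<le> 4 * B" by simp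
    then show "hardy_norm p (\<lambda>z. \<Sum>j<J. c j * cauchy_kernel (of_real r * unity_root n j) z)
        \<le> 4 * C * (real n powr (p - 1) * (\<Sum>j<n. norm (c j) powr p)) powr (1 / p)"
      by (simp add: k_def B_def)
  qed
qed

section \<open>Approximation of a polynomial by one block\<close>

lemma polynomial_in_hardy_space:
  fixes a :: "nat \<Rightarrow> complex"
  assumes "p > 0"
  shows "(\<lambda>z. \<Sum>m<N. a m * z ^ m) \<in> hardy_space p"
proof (rule bounded_in_hardy_space[where B = "\<Sum>m<N. norm (a m)"])
  fix z :: complex assume z: "norm z < 1"
  have "norm (\<Sum>m<N. a m * z ^ m) \<le> (\<Sum>m<N. norm (a m * z ^ m))" by (rule norm_sum)
  also have "\<dots> \<le> (\<Sum>m<N. norm (a m))"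
    using z by (intro sum_mono) (simp add: norm_mult norm_power mult_left_le power_le_one)
  finally show "norm (\<Sum>m<N. a m * z ^ m) \<le> (\<Sum>m<N. norm (a m))" .
qed (use assms in \<open>auto intro!: holomorphic_intros sum_nonneg\<close>)

text \<open>The squares differ by (1 - \<rho>^2)(1 - |x|^2): a Blaschke factor is bounded by 1 on
  the disc.\<close>

lemma norm_blaschke_le:
  fixes x :: complex
  assumes "0 \<le> \<rho>" "\<rho> < 1" "norm x \<le> 1"
  shows "norm (of_real \<rho> - x) \<le> norm (1 - of_real \<rho> * x)"
proof (rule power2_le_imp_le)
  have "(norm x)\<^sup>2 \<le> 1" using assms by (simp add: power_le_one)
  moreover have "\<rho>\<^sup>2 \<le> 1" using assms by (simp add: power_le_one)
  ultimately have "0 \<le> (1 - \<rho>\<^sup>2) * (1 - (norm x)\<^sup>2)" by simp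
  then show "(norm (of_real \<rho> - x))\<^sup>2 \<le> (norm (1 - of_real \<rho> * x))\<^sup>2"
    unfolding cmod_power2 by (simp add: power2_eq_square algebra_simps)
qed simp

text \<open>Put R = r^n. With coefficients P / n alone the error would have modulus |P| R |z^n| / |1
  - R z^n|, bounded only by R / (1 - R) times |P|, which is no contraction once R is at least 1/2.
  The factor 1 - R^2 turns the error into R P times a Blaschke factor.\<close>

lemma block_approximation:
  fixes a :: "nat \<Rightarrow> complex"
  assumes p: "p > 1" and r: "0 < r" "r < 1" and n: "N \<le> n" "n > 0" and \<rho>: "r ^ n \<le> \<rho>" "\<rho> < 1"
  defines "P \<equiv> \<lambda>z::complex. \<Sum>m<N. a m * z ^ m"
  shows "hardy_norm p (\<lambda>z. P z - (\<Sum>j<n. of_real ((1 - (r ^ n)\<^sup>2) / real n) * P (unity_root n j / of_real r)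
            * cauchy_kernel (of_real r * unity_root n j) z))
      \<le> \<rho> * hardy_norm p P"
proof -
  define R where "R = r ^ n"
  have R: "0 < R" "R \<le> \<rho>" using r \<rho> by (auto simp: R_def)
  have PH: "P \<in> hardy_space p"
    unfolding P_def using p by (intro polynomial_in_hardy_space) auto
  let ?g = "\<lambda>z. P z - (\<Sum>j<n. of_real ((1 - R\<^sup>2) / real n) * P (unity_root n j / of_real r)
            * cauchy_kernel (of_real r * unity_root n j) z)"
  have hol: "?g holomorphic_on ball 0 1"
    using r by (intro holomorphic_intros hardy_space_holomorphic[OF PH] cauchy_kernel_holomorphic norm_node_less_1) auto
  have bd: "norm (?g z) \<le> \<rho> * norm (P z)" if z: "norm z < 1" for z
  proof -
    have zn: "norm (z ^ n) \<le> 1" using z by (simp add: norm_power power_le_one)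
    have "norm (of_real R * z ^ n) < 1"
    proof -
      have "norm (of_real R * z ^ n) = R * norm (z ^ n)" using R by (simp add: norm_mult)
      with mult_left_mono[OF zn less_imp_le[OF R(1)]] R \<rho> show ?thesis by linarith
    qed
    then have nz: "1 - of_real R * z ^ n \<noteq> 0" by auto
    have "(\<Sum>j<n. of_real ((1 - R\<^sup>2) / real n) * P (unity_root n j / of_real r)
            * cauchy_kernel (of_real r * unity_root n j) z)
        = of_real ((1 - R\<^sup>2) / real n) * (\<Sum>j<n. P (unity_root n j / of_real r)
            * cauchy_kernel (of_real r * unity_root n j) z)"
      by (simp add: sum_distrib_left mult.assoc)
    also have "(\<Sum>j<n. P (unity_root n j / of_real r) * cauchy_kernel (of_real r * unity_root n j) z)
        = of_nat n * P z / (1 - (of_real r * z) ^ n)"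
      unfolding P_def using r z n by (intro kernel_block_sum) auto
    also have "(of_real r * z) ^ n = of_real R * z ^ n"
      by (simp add: R_def power_mult_distrib)
    also have "of_real ((1 - R\<^sup>2) / real n) * (of_nat n * P z / (1 - of_real R * z ^ n))
        = (1 - (of_real R)\<^sup>2) * P z / (1 - of_real R * z ^ n)"
      using n by simp
    finally have "?g z = P z * of_real R * ((of_real R - z ^ n) / (1 - of_real R * z ^ n))"
      using nz by (simp add: field_simps power2_eq_square)
    also have "norm \<dots> = R * norm (P z) * (norm (of_real R - z ^ n) / norm (1 - of_real R * z ^ n))"
      using R by (simp add: norm_mult norm_divide)
    also have "\<dots> \<le> R * norm (P z) * 1"
      using R \<rho> zn nz norm_blaschke_le[of R "z ^ n"]
      by (intro mult_left_mono) (auto simp: divide_le_eq_1)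
    also have "\<dots> \<le> \<rho> * norm (P z)"
      using R by (simp add: mult_right_mono)
    finally show ?thesis .
  qed
  show ?thesis
    unfolding R_def[symmetric]
    using R by (intro hardy_norm_dominated[OF p PH bd] hol) auto
qed

text \<open>Each node carries the arc up to the next one. The numbers \<open>v j\<close> are not
  tied to the values of \<open>h\<close> at the nodes, so they may be sampled on a circle of another
  radius.\<close>

lemma unity_root_sum_le_integral:
  fixes h :: "complex \<Rightarrow> real"
  assumes cont: "continuous_on (sphere 0 1) h" and n: "n > 0"
    and le: "\<And>j t. j < n \<Longrightarrow> \<bar>t - 2 * pi * real j / real n\<bar> \<le> 2 * pi / real n \<Longrightarrow> 0 \<le> t \<Longrightarrow> t \<le> 2 * pi \<Longrightarrow> v j \<le> h (cis t)"
  shows "(\<Sum>j<n. v j) / real n \<le> (LINT \<zeta>|circle_measure. h \<zeta>)"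
proof -
  have ch: "continuous_on S (\<lambda>t. h (cis t))" for S
    by (intro continuous_on_compose2[OF cont] continuous_intros) auto
  have int: "(\<lambda>t. h (cis t)) integrable_on {u..v}" for u v
    by (intro integrable_continuous_interval ch)
  define x where "x = (\<lambda>j. 2 * pi * real j / real n)"
  have x: "x (Suc j) = x j + 2 * pi / real n" for j
    by (simp add: x_def algebra_simps add_divide_distrib)
  have "m \<le> n \<Longrightarrow> (\<Sum>j<m. v j) * (2 * pi / real n) \<le> integral {0..x m} (\<lambda>t. h (cis t))" for m
  proof (induction m)
    case 0
    then show ?case by (simp add: x_def)
  next
    case (Suc m)
    have xm: "0 \<le> x m" "x m \<le> x (Suc m)" "x (Suc m) \<le> 2 * pi"
    proof -
      have "real (Suc m) / real n \<le> 1" using Suc.prems by simp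
      from mult_left_mono[OF this, of "2 * pi"] show "x (Suc m) \<le> 2 * pi" by (simp add: x_def)
    qed (auto simp: x_def divide_right_mono)
    have "v m * (2 * pi / real n) = integral {x m..x (Suc m)} (\<lambda>t. v m)"
      using n by (simp add: x)
    also have "\<dots> \<le> integral {x m..x (Suc m)} (\<lambda>t. h (cis t))"
    proof (rule integral_le)
      fix t assume t: "t \<in> {x m..x (Suc m)}"
      then have "\<bar>t - x m\<bar> \<le> 2 * pi / real n" "0 \<le> t" "t \<le> 2 * pi"
        using xm x[of m] by auto
      then show "v m \<le> h (cis t)"
        using le[of m t] Suc.prems by (auto simp: x_def)
    qed (auto intro: int)
    finally have "(\<Sum>j<Suc m. v j) * (2 * pi / real n)
        \<le> integral {0..x m} (\<lambda>t. h (cis t)) + integral {x m..x (Suc m)} (\<lambda>t. h (cis t))"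
      using Suc by (simp add: algebra_simps add_divide_distrib)
    also have "\<dots> = integral {0..x (Suc m)} (\<lambda>t. h (cis t))"
      using xm by (intro Henstock_Kurzweil_Integration.integral_combine int) auto
    finally show ?case .
  qed
  from this[of n] have "(\<Sum>j<n. v j) * (2 * pi / real n) \<le> integral {0..2 * pi} (\<lambda>t. h (cis t))"
    using n by (simp add: x_def)
  then show ?thesis
    unfolding circle_integral[OF cont] by (simp add: field_simps)
qed

text \<open>The coefficients of a block sample the polynomial at radius 1 / r, outside the disc,
  whereas the norm sees radii below 1 only. Uniform continuity on an annulus carries the samples to
  the circle of radius \<open>1 - \<delta>\<close>, whose mean the norm controls.\<close>

lemma grid_mean_le_hardy_norm:
  fixes f :: "complex \<Rightarrow> complex"
  assumes p: "p > 1" and f: "f \<in> hardy_space p" "continuous_on UNIV f" and \<eta>: "\<eta> > 0"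
  obtains N \<delta> where "\<delta> > 0"
    "\<And>n R. n \<ge> N \<Longrightarrow> 1 \<le> R \<Longrightarrow> R \<le> 1 + \<delta> \<Longrightarrow>
       (\<Sum>j<n. norm (f (of_real R * unity_root n j)) powr p) / real n \<le> hardy_norm p f powr p + \<eta>"
proof -
  define K where "K = {1/2..2::real} \<times> {0..2 * pi}"
  define g where "g = (\<lambda>(R, t). norm (f (of_real R * cis t)) powr p)"
  have "continuous_on K g"
    unfolding g_def case_prod_unfold
    by (rule continuous_on_norm_powr)
      (use p in \<open>auto intro!: continuous_on_compose2[OF f(2)] continuous_intros\<close>)
  moreover have "compact K" unfolding K_def by (intro compact_Times) auto
  ultimately have "uniformly_continuous_on K g" by (rule compact_uniformly_continuous)
  then obtain d where d: "d > 0" "\<And>x x'. x \<in> K \<Longrightarrow> x' \<in> K \<Longrightarrow> dist x' x < d \<Longrightarrow> dist (g x') (g x) < \<eta>"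
    using \<eta> unfolding uniformly_continuous_on_def by metis
  \<comment> \<open>Radii then differ by at most 2 \<delta> \<le> d / 2, and for n > 4 pi / d the
    arcs are shorter than d / 2. The bound 1 / 4 keeps all radii between 1/2 and 2.\<close>
  define \<delta> where "\<delta> = min (d / 4) (1 / 4)"
  have \<delta>: "\<delta> > 0" "\<delta> \<le> d / 4" "\<delta> \<le> 1 / 4" using d by (auto simp: \<delta>_def)
  obtain N where N: "real N > 4 * pi / d" using reals_Archimedean2 by blast
  show ?thesis
  proof (rule that[OF \<delta>(1)])
    fix n :: nat and R :: real assume n: "max N 1 \<le> n" and R: "1 \<le> R" "R \<le> 1 + \<delta>"
    define s where "s = 1 - \<delta>"
    have s: "0 < s" "s < 1" "1/2 \<le> s" using \<delta> by (auto simp: s_def)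
    have nd: "2 * pi / real n < d / 2"
    proof -
      have "4 * pi / d < real n" using N n by linarith
      then show ?thesis using n d by (simp add: field_simps)
    qed
    have hol: "f holomorphic_on ball 0 1" by (rule hardy_space_holomorphic) fact
    have cont: "continuous_on (sphere 0 1) (\<lambda>\<zeta>. norm (f (of_real s * \<zeta>)) powr p)"
      using s p by (intro continuous_on_hardy_powr hol) auto
    have "(\<Sum>j<n. norm (f (of_real R * unity_root n j)) powr p) / real n
        \<le> (LINT \<zeta>|circle_measure. norm (f (of_real s * \<zeta>)) powr p + \<eta>)"
    proof (rule unity_root_sum_le_integral)
      fix j t assume j: "j < n" and t: "\<bar>t - 2 * pi * real j / real n\<bar> \<le> 2 * pi / real n" "0 \<le> t" "t \<le> 2 * pi"
      let ?u = "2 * pi * real j / real n"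
      have "dist (R, ?u) (s, t) \<le> \<bar>R - s\<bar> + \<bar>?u - t\<bar>"
        unfolding dist_Pair_Pair dist_real_def by (rule order_trans[OF sqrt_sum_squares_le_sum_abs]) simp
      also have "\<dots> < d" using R t nd \<delta> by (simp add: s_def abs_minus_commute)
      finally have "dist (g (R, ?u)) (g (s, t)) < \<eta>"
        using R s \<delta> t j by (intro d(2)) (auto simp: K_def field_simps)
      then show "norm (f (of_real R * unity_root n j)) powr p \<le> norm (f (of_real s * cis t)) powr p + \<eta>"
        by (simp add: g_def dist_real_def unity_root_conv_cis)
    qed (use n in \<open>auto intro!: continuous_on_add cont\<close>)
    also have "\<dots> = hardy_mean p f s + \<eta>"
      unfolding hardy_mean_def
      by (subst Bochner_Integration.integral_add) (auto intro!: circle_integrable cont)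
    also have "\<dots> \<le> hardy_norm p f powr p + \<eta>"
      using s p f by (intro add_right_mono hardy_mean_le_norm) auto
    finally show "(\<Sum>j<n. norm (f (of_real R * unity_root n j)) powr p) / real n \<le> hardy_norm p f powr p + \<eta>" .
  qed
qed

section \<open>Density of polynomials\<close>

text \<open>The strict form of \<open>Young_powr\<close> at \<open>m = 1\<close>. \<open>A\<close>
  is a weighted arithmetic mean of t^p and 1, whose weighted geometric mean is t. The inequality ln
  x \<le> x - 1 is applied to both numbers divided by \<open>A\<close>; it is strict for 1 / A
  because A is not 1.\<close>

lemma powr_gt_tangent:
  fixes t p :: real
  assumes p: "p > 1" and t: "t \<ge> 0" "t \<noteq> 1"
  shows "t < t powr p / p + (1 - 1 / p)"
proof (cases "t = 0")
  case False
  then have t0: "t > 0" using t by simp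
  define A where "A = t powr p / p + (1 - 1 / p)"
  have A: "A > 0" using p t0 by (simp add: A_def add_pos_pos)
  have "t powr p \<noteq> 1"
    using p t0 t by (metis powr_eq_one_iff_gen less_numeral_extra(1) not_one_less_zero)
  then have "A \<noteq> 1" using p by (auto simp: A_def field_simps)
  then have "ln (1 / A) \<noteq> 1 / A - 1"
    using ln_eq_minus_one[of "1 / A"] A by auto
  then have 1: "ln (1 / A) < 1 / A - 1"
    using ln_le_minus_one[of "1 / A"] A by (simp only: order_less_le) simp
  have 2: "ln (t powr p / A) \<le> t powr p / A - 1"
    using A t0 by (intro ln_le_minus_one) auto
  have "ln t - ln A = (1 / p) * ln (t powr p / A) + (1 - 1 / p) * ln (1 / A)"
    using A t0 p by (simp add: ln_div ln_powr field_simps)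
  also have "\<dots> < (1 / p) * (t powr p / A - 1) + (1 - 1 / p) * (1 / A - 1)"
    using 1 2 p by (intro add_le_less_mono mult_left_mono mult_strict_left_mono) auto
  also have "\<dots> = (t powr p / p + (1 - 1 / p)) / A - 1"
    using p A by (simp add: field_simps)
  also have "\<dots> = 0" using A by (simp add: A_def)
  finally show ?thesis using A t0 by (simp add: A_def)
qed (use p in simp)

lemma powr_midpoint_strict:
  fixes x y p :: real
  assumes p: "p > 1" and "0 \<le> x" "0 \<le> y" "x \<noteq> y"
  shows "((x + y) / 2) powr p < (x powr p + y powr p) / 2"
proof -
  define m where "m = (x + y) / 2"
  have m: "m > 0" using assms by (auto simp: m_def)
  have "x / m < (x / m) powr p / p + (1 - 1 / p)" "y / m < (y / m) powr p / p + (1 - 1 / p)"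
    using assms m by (intro powr_gt_tangent p; auto simp: m_def field_simps)+
  then have "x / m + y / m < ((x / m) powr p + (y / m) powr p) / p + 2 * (1 - 1 / p)"
    by (simp add: add_divide_distrib)
  also have "x / m + y / m = 2"
  proof -
    have "x + y = m * 2" by (simp add: m_def)
    then show ?thesis using m by (simp flip: add_divide_distrib)
  qed
  finally have "2 / p < ((x / m) powr p + (y / m) powr p) / p" by (simp add: right_diff_distrib)
  then have "2 < (x / m) powr p + (y / m) powr p"
    using p by (simp add: divide_less_cancel)
  then have "2 < (x powr p + y powr p) / m powr p"
    using assms m by (simp add: powr_divide add_divide_distrib)
  then show ?thesis using m by (simp add: m_def[symmetric] field_simps)
qed

text \<open>Strictness has two sources: for equal norms the parallelogram law, for different norms
  the strict convexity of t^p.\<close>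

lemma norm_midpoint_powr_less:
  fixes a b :: "'a::real_inner"
  assumes p: "p > 1" and "a \<noteq> b"
  shows "norm ((a + b) /\<^sub>R 2) powr p < (norm a powr p + norm b powr p) / 2"
proof (cases "norm a = norm b")
  case True
  have "(norm (a + b))\<^sup>2 + (norm (a - b))\<^sup>2 = 2 * (norm a)\<^sup>2 + 2 * (norm b)\<^sup>2"
    by (simp add: power2_norm_eq_inner inner_add inner_diff inner_commute)
  moreover have "(norm (a - b))\<^sup>2 > 0" using assms by simp
  moreover have "(2 * norm a)\<^sup>2 = 2 * (norm a)\<^sup>2 + 2 * (norm b)\<^sup>2" using True by (simp add: power_mult_distrib)
  ultimately have "(norm (a + b))\<^sup>2 < (2 * norm a)\<^sup>2" by linarith
  then have "norm (a + b) < 2 * norm a" by (rule power2_less_imp_less) simp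
  then have "norm ((a + b) /\<^sub>R 2) powr p < norm a powr p"
    using p by (intro powr_less_mono2) auto
  then show ?thesis using True by simp
next
  case False
  have "norm ((a + b) /\<^sub>R 2) powr p \<le> ((norm a + norm b) / 2) powr p"
    using p norm_triangle_ineq[of a b] by (intro powr_mono2) auto
  also have "\<dots> < (norm a powr p + norm b powr p) / 2"
    using p False by (intro powr_midpoint_strict) auto
  finally show ?thesis .
qed

text \<open>By homogeneity it suffices to consider the compact unit sphere, where the bracket can vanish
  only if \<open>a = b\<close>.\<close>
lemma norm_powr_uniformly_convex:
  fixes p \<eta> :: real
  assumes p: "p > 1" and \<eta>: "\<eta> > 0"
  obtains C where "C \<ge> 0" "\<And>a b :: 'a::euclidean_space. norm (a - b) powr p
    \<le> \<eta> * (norm a powr p + norm b powr p) + C * ((norm a powr p + norm b powr p) / 2 - norm ((a + b) /\<^sub>R 2) powr p)"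
proof -
  define D where "D = (\<lambda>x :: 'a \<times> 'a. (norm (fst x) powr p + norm (snd x) powr p) / 2 - norm ((fst x + snd x) /\<^sub>R 2) powr p)"
  define E where "E = (\<lambda>x :: 'a \<times> 'a. norm (fst x - snd x) powr p - \<eta> * (norm (fst x) powr p + norm (snd x) powr p))"
  \<comment> \<open>On the unit sphere outside \<open>K\<close> the value of \<open>E\<close> is
    negative and the claim holds because \<open>D\<close> is nonnegative. On \<open>K\<close> the
    two components differ, so \<open>D\<close> is positive there.\<close>
  define K where "K = {x \<in> sphere 0 1. 0 \<le> E x}"
  have cE: "continuous_on S E" and cD: "continuous_on S D" for S
    unfolding E_def D_def using p
    by (intro continuous_on_add continuous_on_diff continuous_on_mult_left continuous_on_divide continuous_on_const
          continuous_on_norm_powr continuous_on_scaleR continuous_on_fst continuous_on_snd continuous_on_id; simp)+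
  have K: "compact K"
  proof -
    have "closed {x. 0 \<le> E x}"
      by (intro closed_Collect_le continuous_on_const cE)
    then have "compact (sphere 0 1 \<inter> {x. 0 \<le> E x})" by (intro compact_Int_closed) auto
    moreover have "K = sphere 0 1 \<inter> {x. 0 \<le> E x}" by (auto simp: K_def)
    ultimately show ?thesis by simp
  qed
  have D0: "0 \<le> D x" for x
    using norm_midpoint_powr_less[OF p, of "fst x" "snd x"]
    by (cases "fst x = snd x") (auto simp: D_def scaleR_2[symmetric])
  have Dpos: "0 < D x" if "x \<in> K" for x
  proof -
    have "fst x \<noteq> snd x"
    proof
      assume eq: "fst x = snd x"
      have "snd x \<noteq> 0"
        using that eq by (auto simp: K_def norm_prod_def)
      then have "E x < 0" using eq p \<eta> by (simp add: E_def)
      then show False using that by (simp add: K_def)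
    qed
    then show ?thesis using norm_midpoint_powr_less[OF p, of "fst x" "snd x"] by (simp add: D_def)
  qed
  \<comment> \<open>By compactness the maximum of \<open>E\<close> on \<open>K\<close> divided by
    the minimum of \<open>D\<close> will do.\<close>
  obtain C where C: "C \<ge> 0" "\<And>x. x \<in> K \<Longrightarrow> E x \<le> C * D x"
  proof (cases "K = {}")
    case True
    then show ?thesis using that[of 0] by simp
  next
    case False
    obtain x0 where x0: "x0 \<in> K" "\<And>x. x \<in> K \<Longrightarrow> D x0 \<le> D x"
      using continuous_attains_inf[OF K False cD] by blast
    obtain x1 where x1: "x1 \<in> K" "\<And>x. x \<in> K \<Longrightarrow> E x \<le> E x1"
      using continuous_attains_sup[OF K False cE] by blast
    show ?thesis
    proof (rule that)
      show C: "E x1 / D x0 \<ge> 0" using Dpos[OF x0(1)] x1(1) by (simp add: K_def)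
      fix x assume x: "x \<in> K"
      have "E x \<le> E x1 / D x0 * D x0" using Dpos[OF x0(1)] x1(2)[OF x] by simp
      also have "\<dots> \<le> E x1 / D x0 * D x" using x0(2)[OF x] C by (intro mult_left_mono) auto
      finally show "E x \<le> E x1 / D x0 * D x" .
    qed
  qed
  have sph: "E x \<le> C * D x" if "norm x = 1" for x
  proof (cases "x \<in> K")
    case False
    then have "E x < 0" using that by (simp add: K_def)
    also have "0 \<le> C * D x" using C D0 by simp
    finally show ?thesis by simp
  qed (rule C)
  have hom: "E (s *\<^sub>R x) = s powr p * E x" "D (s *\<^sub>R x) = s powr p * D x" if "s \<ge> 0" for s x
  proof -
    have n: "norm (s *\<^sub>R v) powr p = s powr p * norm v powr p" for v :: 'a
      using that by (simp add: powr_mult)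
    have "fst (s *\<^sub>R x) - snd (s *\<^sub>R x) = s *\<^sub>R (fst x - snd x)"
      "(fst (s *\<^sub>R x) + snd (s *\<^sub>R x)) /\<^sub>R 2 = s *\<^sub>R ((fst x + snd x) /\<^sub>R 2)"
      by (simp_all add: scaleR_diff_right scaleR_add_right)
    then show "E (s *\<^sub>R x) = s powr p * E x" "D (s *\<^sub>R x) = s powr p * D x"
      unfolding E_def D_def by (simp_all only: n fst_scaleR snd_scaleR) (simp_all add: algebra_simps)
  qed
  have all: "E x \<le> C * D x" for x
  proof (cases "x = 0")
    case False
    have "E x = norm x powr p * E (x /\<^sub>R norm x)" "D x = norm x powr p * D (x /\<^sub>R norm x)"
      using hom[of "norm x" "x /\<^sub>R norm x"] False by auto
    moreover have "norm x powr p * E (x /\<^sub>R norm x) \<le> norm x powr p * (C * D (x /\<^sub>R norm x))"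
      using False by (intro mult_left_mono sph) auto
    ultimately show ?thesis by (simp add: mult_ac)
  qed (simp add: E_def D_def)
  show ?thesis
  proof (rule that[OF C(1)])
    fix a b :: 'a
    show "norm (a - b) powr p
    \<le> \<eta> * (norm a powr p + norm b powr p) + C * ((norm a powr p + norm b powr p) / 2 - norm ((a + b) /\<^sub>R 2) powr p)"
      using all[of "(a, b)"] by (simp add: E_def D_def)
  qed
qed

text \<open>The density of the norming functional: its product with v is |v|^p and its modulus is
  |v|^(p-1). For p < 2 the second factor is unbounded near 0, but the modulus of the product tends
  to 0 as p > 1.\<close>

lemma continuous_on_duality_map:
  assumes "p > (1::real)"
  shows "continuous_on UNIV (\<lambda>v::complex. cnj v * of_real (norm v powr (p - 2)))"
proof -
  have "isCont (\<lambda>v::complex. cnj v * of_real (norm v powr (p - 2))) v" for v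
  proof (cases "v = 0")
    case True
    have "isCont (\<lambda>v::complex. norm v powr (p - 1)) 0"
      using continuous_on_norm_powr[of UNIV "\<lambda>v::complex. v" "p - 1"] assms
      by (simp add: continuous_on_eq_continuous_at)
    then have "((\<lambda>v::complex. norm v powr (p - 1)) \<longlongrightarrow> 0) (at 0)"
      by (simp add: isCont_def)
    moreover have "norm (cnj v * of_real (norm v powr (p - 2))) = norm v powr (p - 1)" for v :: complex
    proof (cases "v = 0")
      case False
      then have "norm v * norm v powr (p - 2) = norm v powr (1 + (p - 2))" unfolding powr_add by simp
      then show ?thesis by (simp add: norm_mult)
    qed simp
    ultimately have "((\<lambda>v::complex. norm (cnj v * of_real (norm v powr (p - 2)))) \<longlongrightarrow> 0) (at 0)"
      by simp
    then show ?thesis using True by (simp add: isCont_def tendsto_norm_zero_iff)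
  next
    case False
    then show ?thesis by (intro continuous_intros) auto
  qed
  then show ?thesis by (simp add: continuous_on_eq_continuous_at)
qed

text \<open>Pairing \<open>H (z \<zeta>)\<close> with the norming functional of \<open>H (r\<^sub>0 \<zeta>)\<close> gives a holomorphic function of \<open>z\<close>,
  to which the maximum principle applies.\<close>
lemma hardy_mean_mono:
  assumes p: "p > 1" and H: "H holomorphic_on ball 0 1" and r: "0 < r0" "r0 \<le> r" "r < 1"
  shows "hardy_mean p H r0 \<le> hardy_mean p H r"
proof -
  define \<phi> where "\<phi> = (\<lambda>\<zeta>. cnj (H (of_real r0 * \<zeta>)) * of_real (norm (H (of_real r0 * \<zeta>)) powr (p - 2)))"
  have r0: "0 \<le> r0" "r0 < 1" using r by auto
  have c\<phi>: "continuous_on (sphere 0 1) \<phi>"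
    unfolding \<phi>_def
    by (rule continuous_on_compose2[OF continuous_on_duality_map[OF p] continuous_on_hardy[OF H r0]]) auto
  have n\<phi>: "norm (\<phi> \<zeta>) = norm (H (of_real r0 * \<zeta>)) powr (p - 1)" for \<zeta>
  proof (cases "H (of_real r0 * \<zeta>) = 0")
    case False
    then have "norm (H (of_real r0 * \<zeta>)) * norm (H (of_real r0 * \<zeta>)) powr (p - 2)
      = norm (H (of_real r0 * \<zeta>)) powr (1 + (p - 2))" unfolding powr_add by simp
    then show ?thesis by (simp add: \<phi>_def norm_mult)
  qed (simp add: \<phi>_def)
  define g where "g = (\<lambda>z. integral (cbox 0 (2 * pi)) (\<lambda>t. H (z * cis t) * \<phi> (cis t)))"
  have cz: "continuous_on (sphere 0 1) (\<lambda>\<zeta>. H (z * \<zeta>))" if "norm z < 1" for z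
    by (intro continuous_on_compose2[OF holomorphic_on_imp_continuous_on[OF H]] continuous_intros)
      (use that in \<open>auto simp: norm_mult\<close>)
  have cc: "continuous_on S (\<lambda>t. \<phi> (cis t))" for S
    by (intro continuous_on_compose2[OF c\<phi>] continuous_intros) auto
  have g_eq: "(LINT \<zeta>|circle_measure. H (z * \<zeta>) * \<phi> \<zeta>) = g z /\<^sub>R (2 * pi)" if "norm z < 1" for z
    using that by (subst circle_integral) (auto intro!: continuous_on_mult cz c\<phi> simp: g_def cbox_interval)
  have hol: "g holomorphic_on ball 0 1"
    unfolding g_def
  proof (rule leibniz_rule_holomorphic[where fx = "\<lambda>z t. deriv H (z * cis t) * cis t * \<phi> (cis t)"])
    fix z t assume z: "z \<in> ball (0::complex) 1"
    then have zt: "z * cis t \<in> ball 0 1" by (simp add: norm_mult)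
    have "(H has_field_derivative deriv H (z * cis t)) (at (z * cis t))"
      using zt by (intro holomorphic_derivI[OF H]) auto
    then have "((\<lambda>z. H (z * cis t)) has_field_derivative deriv H (z * cis t) * cis t) (at z)"
      by (rule DERIV_chain2) (auto intro!: derivative_eq_intros)
    then have "((\<lambda>z. H (z * cis t) * \<phi> (cis t)) has_field_derivative deriv H (z * cis t) * cis t * \<phi> (cis t)) (at z)"
      by (rule DERIV_cmult_right)
    then show "((\<lambda>z. H (z * cis t) * \<phi> (cis t)) has_field_derivative deriv H (z * cis t) * cis t * \<phi> (cis t))
         (at z within ball 0 1)" by (rule has_field_derivative_at_within)
  next
    fix z assume "z \<in> ball (0::complex) 1"
    then have z: "norm z < 1" by simp
    show "(\<lambda>t. H (z * cis t) * \<phi> (cis t)) integrable_on cbox 0 (2 * pi)"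
      by (intro integrable_continuous continuous_on_mult cc continuous_on_compose2[OF cz[OF z]] continuous_intros) auto
  next
    have "deriv H holomorphic_on ball 0 1" by (intro holomorphic_deriv H) auto
    then have cd: "continuous_on (ball 0 1) (deriv H)" by (rule holomorphic_on_imp_continuous_on)
    show "continuous_on (ball 0 1 \<times> cbox 0 (2 * pi)) (\<lambda>(z, t). deriv H (z * cis t) * cis t * \<phi> (cis t))"
      unfolding case_prod_unfold
      by (intro continuous_on_mult continuous_on_compose2[OF cd] continuous_on_compose2[OF cc[of UNIV]] continuous_intros)
        (auto simp: norm_mult)
  qed auto
  have cm: "continuous_on (sphere 0 1) (\<lambda>\<zeta>. norm (H (of_real s * \<zeta>)) powr p)" if "0 \<le> s" "s < 1" for s
    using p that by (intro continuous_on_hardy_powr H) auto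
  \<comment> \<open>Young's inequality takes the place of Hoelder's. The mean at \<open>r0\<close>
    then occurs on both sides, on the right with coefficient 1 - 1 / p, and is absorbed at the
    end.\<close>
  define B where "B = hardy_mean p H r / p + (1 - 1 / p) * hardy_mean p H r0"
  have bd: "norm (g z) \<le> 2 * pi * B" if z: "norm z = r" for z
  proof -
    define u where "u = z / of_real r"
    have u: "norm u = 1" "z = of_real r * u" using z r by (auto simp: u_def norm_divide)
    have cr: "continuous_on (sphere 0 1) (\<lambda>\<zeta>. norm (H (z * \<zeta>)) powr p)"
      using p z r by (intro continuous_on_norm_powr cz) auto
    have "norm (LINT \<zeta>|circle_measure. H (z * \<zeta>) * \<phi> \<zeta>) \<le> (LINT \<zeta>|circle_measure. norm (H (z * \<zeta>) * \<phi> \<zeta>))"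
      by (rule integral_norm_bound)
    also have "\<dots> \<le> (LINT \<zeta>|circle_measure. norm (H (z * \<zeta>)) powr p / p + (1 - 1 / p) * norm (H (of_real r0 * \<zeta>)) powr p)"
    proof (rule circle_integral_mono)
      fix \<zeta> :: complex
      show "norm (H (z * \<zeta>) * \<phi> \<zeta>) \<le> norm (H (z * \<zeta>)) powr p / p + (1 - 1 / p) * norm (H (of_real r0 * \<zeta>)) powr p"
        using Young_powr[OF p, of "norm (H (z * \<zeta>))" "norm (H (of_real r0 * \<zeta>))"]
        by (simp add: norm_mult n\<phi> mult.commute)
    qed (use z r p in \<open>auto intro!: continuous_on_norm continuous_on_mult continuous_on_add continuous_on_divide
          continuous_on_const cz c\<phi> cr cm\<close>)
    also have "\<dots> = (LINT \<zeta>|circle_measure. norm (H (z * \<zeta>)) powr p) / p + (1 - 1 / p) * hardy_mean p H r0"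
      unfolding hardy_mean_def using r p
      by (subst Bochner_Integration.integral_add)
        (auto intro!: circle_integrable continuous_on_divide continuous_on_mult continuous_on_const cr cm)
    also have "(LINT \<zeta>|circle_measure. norm (H (z * \<zeta>)) powr p) = hardy_mean p H r"
      unfolding hardy_mean_def u(2)
      using circle_integral_rotate[OF cm[of r] u(1)] r by (simp add: mult.assoc)
    finally have "norm (g z /\<^sub>R (2 * pi)) \<le> B"
      using z r by (simp only: g_eq B_def)
    then show ?thesis by (simp add: field_simps)
  qed
  have "norm (g (of_real r0)) \<le> 2 * pi * B"
  proof (rule maximum_modulus_frontier[of g "cball 0 r"])
    show "g holomorphic_on interior (cball 0 r)"
      using r by (intro holomorphic_on_subset[OF hol]) auto
    show "continuous_on (closure (cball 0 r)) g"
      using r by (intro continuous_on_subset[OF holomorphic_on_imp_continuous_on[OF hol]]) auto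
    fix z :: complex assume "z \<in> frontier (cball 0 r)"
    then show "norm (g z) \<le> 2 * pi * B" using r by (intro bd) simp
  qed (use r in auto)
  also have "g (of_real r0) = of_real (2 * pi * hardy_mean p H r0)"
  proof -
    have "H (of_real r0 * \<zeta>) * \<phi> \<zeta> = of_real (norm (H (of_real r0 * \<zeta>)) powr p)" for \<zeta>
    proof (cases "H (of_real r0 * \<zeta>) = 0")
      case False
      then have "(norm (H (of_real r0 * \<zeta>)))\<^sup>2 * norm (H (of_real r0 * \<zeta>)) powr (p - 2)
        = norm (H (of_real r0 * \<zeta>)) powr p" by (simp add: powr_diff flip: powr_numeral)
      then show ?thesis
        unfolding \<phi>_def mult.assoc[symmetric] complex_norm_square[symmetric] of_real_mult[symmetric] by simp
    qed (use p in \<open>simp add: \<phi>_def\<close>)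
    then have "g (of_real r0) /\<^sub>R (2 * pi) = of_real (hardy_mean p H r0)"
      using r0 g_eq[of "of_real r0"] by (simp add: hardy_mean_def)
    then show ?thesis by (simp add: scaleR_conv_of_real field_simps)
  qed
  finally have "\<bar>hardy_mean p H r0\<bar> \<le> B" by (simp add: norm_mult)
  then have "hardy_mean p H r0 \<le> hardy_mean p H r / p + (1 - 1 / p) * hardy_mean p H r0"
    by (simp add: B_def)
  then have "hardy_mean p H r0 / p \<le> hardy_mean p H r / p"
    by (simp add: algebra_simps)
  then show ?thesis using p by (simp add: divide_le_cancel)
qed

section \<open>Dilations and Taylor polynomials\<close>

lemma hardy_mean_dilation:
  "hardy_mean p (\<lambda>z. f (of_real s * z)) r = hardy_mean p f (r * s)"
  by (simp add: hardy_mean_def mult_ac)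

lemma dilation_holomorphic:
  assumes "f holomorphic_on ball 0 1" "0 \<le> s" "s < 1"
  shows "(\<lambda>z. f (of_real s * z)) holomorphic_on ball 0 1"
proof -
  have "of_real s * z \<in> ball 0 1" if "z \<in> ball 0 1" for z :: complex
    using assms norm_cnj_mult_less_1[of "of_real s" z] that by simp
  then have "(f \<circ> (\<lambda>z. of_real s * z)) holomorphic_on ball 0 1"
    by (intro holomorphic_on_compose_gen[OF _ assms(1)] holomorphic_intros) auto
  then show ?thesis by (simp add: o_def)
qed

text \<open>Uniform convexity: the means of \<open>(f + f\<^sub>s) / 2\<close> near the boundary are almost as large as those of
  \<open>f\<close>, which forces \<open>f - f\<^sub>s\<close> to be small.\<close>
lemma dilation_approximates:
  assumes p: "p > 1" and f: "f \<in> hardy_space p" and \<epsilon>: "\<epsilon> > 0"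
  obtains s where "0 < s" "s < 1" "hardy_norm p (\<lambda>z. f z - f (of_real s * z)) \<le> \<epsilon>"
proof -
  define N where "N = hardy_norm p f powr p"
  have N: "N \<ge> 0" by (simp add: N_def)
  have hol: "f holomorphic_on ball 0 1" using f by (rule hardy_space_holomorphic)
  \<comment> \<open>\<open>\<eta>\<close> and, once \<open>C\<close> is known, \<open>e\<close> are
    sized so that each of the two terms of the final estimate is at most \<epsilon>^p / 2; the added
    1 guards against \<open>N = 0\<close> and \<open>C = 0\<close>.\<close>
  define \<eta> where "\<eta> = \<epsilon> powr p / (4 * (N + 1))"
  have \<eta>: "\<eta> > 0" using \<epsilon> N by (simp add: \<eta>_def)
  obtain C where C: "C \<ge> 0" "\<And>a b :: complex. norm (a - b) powr p
    \<le> \<eta> * (norm a powr p + norm b powr p) + C * ((norm a powr p + norm b powr p) / 2 - norm ((a + b) /\<^sub>R 2) powr p)"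
    using norm_powr_uniformly_convex[OF p \<eta>] by blast
  define e where "e = \<epsilon> powr p / (4 * (C + 1))"
  have e: "e > 0" using \<epsilon> C by (simp add: e_def)
  have N_eq: "N = (SUP r\<in>{0<..<1}. hardy_mean p f r)"
  proof -
    have "0 \<le> (SUP r\<in>{0<..<1}. hardy_mean p f r)"
      by (rule order_trans[OF hardy_mean_nonneg], rule cSUP_upper[where x = "1/2"])
        (use f in \<open>auto simp: hardy_space_def\<close>)
    then show ?thesis using p by (simp add: N_def hardy_norm_def powr_powr)
  qed
  \<comment> \<open>A radius at which the mean of \<open>f\<close> is within \<open>e\<close> of its
    supremum; on this single circle the closeness of \<open>f\<close> and its dilation is a matter
    of uniform continuity.\<close>
  have "N - e < (SUP r\<in>{0<..<1}. hardy_mean p f r)" using e N_eq by simp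
  then obtain r0 where r0: "0 < r0" "r0 < 1" "N - e < hardy_mean p f r0"
    by (subst (asm) less_cSUP_iff) (use f in \<open>auto simp: hardy_space_def\<close>)
  define K where "K = {0..1::real} \<times> sphere (0::complex) 1"
  define g where "g = (\<lambda>(s, \<zeta>). norm ((f (of_real r0 * \<zeta>) + f (of_real r0 * (of_real s * \<zeta>))) /\<^sub>R 2) powr p)"
  have cf: "continuous_on K (\<lambda>x. f (of_real r0 * h x))"
    if "continuous_on K h" "\<And>x. x \<in> K \<Longrightarrow> norm (h x) \<le> 1" for h :: "real \<times> complex \<Rightarrow> complex"
  proof (intro continuous_on_compose2[OF holomorphic_on_imp_continuous_on[OF hol]] continuous_on_mult that continuous_on_const)
    have "norm (of_real r0 * h x) < 1" if "x \<in> K" for x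
      using norm_cnj_mult_less_1[of "of_real r0" "h x"] r0 \<open>\<And>x. x \<in> K \<Longrightarrow> norm (h x) \<le> 1\<close>[OF that] by simp
    then show "(\<lambda>x. of_real r0 * h x) ` K \<subseteq> ball 0 1" by auto
  qed
  have "continuous_on K g"
    unfolding g_def case_prod_unfold using p
    by (intro continuous_on_norm_powr continuous_on_scaleR continuous_on_const continuous_on_add cf
        continuous_on_mult continuous_on_of_real continuous_on_fst continuous_on_snd continuous_on_id)
      (auto simp: K_def norm_mult)
  moreover have "compact K" unfolding K_def by (intro compact_Times) auto
  ultimately have "uniformly_continuous_on K g" by (rule compact_uniformly_continuous)
  then obtain d where d: "d > 0" "\<And>x x'. x \<in> K \<Longrightarrow> x' \<in> K \<Longrightarrow> dist x' x < d \<Longrightarrow> dist (g x') (g x) < e"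
    using e unfolding uniformly_continuous_on_def by metis
  define s where "s = 1 - min (d / 2) (1 / 2)"
  have s: "0 < s" "s < 1" "\<bar>1 - s\<bar> < d" using d by (auto simp: s_def)
  have hols: "(\<lambda>z. f (of_real s * z)) holomorphic_on ball 0 1"
    using s by (intro dilation_holomorphic hol) auto
  define G where "G = (\<lambda>z. (f z + f (of_real s * z)) /\<^sub>R 2)"
  define D where "D = (\<lambda>z. f z - f (of_real s * z))"
  have holG: "G holomorphic_on ball 0 1" and holD: "D holomorphic_on ball 0 1"
    unfolding G_def D_def scaleR_conv_of_real by (intro holomorphic_intros hol hols)+
  have c: "continuous_on (sphere 0 1) (\<lambda>\<zeta>. norm (h (of_real r * \<zeta>)) powr p)"
    if "h holomorphic_on ball 0 1" "0 < r" "r < 1" for h r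
    using that p by (intro continuous_on_hardy_powr) auto
  have "(LINT \<zeta>|circle_measure. norm (f (of_real r0 * \<zeta>)) powr p - e) \<le> hardy_mean p G r0"
    unfolding hardy_mean_def
  proof (rule circle_integral_mono)
    fix \<zeta> :: complex assume "norm \<zeta> = 1"
    then have "dist (g (s, \<zeta>)) (g (1, \<zeta>)) < e"
      using s by (intro d(2)) (auto simp: K_def dist_Pair_Pair dist_real_def abs_minus_commute)
    then show "norm (f (of_real r0 * \<zeta>)) powr p - e \<le> norm (G (of_real r0 * \<zeta>)) powr p"
      by (simp add: g_def G_def dist_real_def mult_ac scaleR_2[symmetric])
  qed (use r0 in \<open>auto intro!: continuous_on_diff continuous_on_const c hol holG\<close>)
  also have "(LINT \<zeta>|circle_measure. norm (f (of_real r0 * \<zeta>)) powr p - e) = hardy_mean p f r0 - e"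
    unfolding hardy_mean_def using r0
    by (subst Bochner_Integration.integral_diff) (auto intro!: circle_integrable c hol)
  finally have Gr0: "N - 2 * e \<le> hardy_mean p G r0" using r0 by linarith
  \<comment> \<open>From \<open>r0\<close> the estimate passes to all larger radii: the means of
    \<open>G\<close> increase, while those of \<open>f\<close> and of its dilation stay below
    \<open>N\<close>.\<close>
  have Dr: "hardy_mean p D r \<le> \<epsilon> powr p" if r: "r0 \<le> r" "r < 1" for r
  proof -
    have r': "0 < r" using r r0 by simp
    have "hardy_mean p D r \<le> (LINT \<zeta>|circle_measure.
       \<eta> * (norm (f (of_real r * \<zeta>)) powr p + norm (f (of_real s * (of_real r * \<zeta>))) powr p)
       + C * ((norm (f (of_real r * \<zeta>)) powr p + norm (f (of_real s * (of_real r * \<zeta>))) powr p) / 2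
          - norm (G (of_real r * \<zeta>)) powr p))"
      unfolding hardy_mean_def
    proof (rule circle_integral_mono)
      fix \<zeta> :: complex
      show "norm (D (of_real r * \<zeta>)) powr p \<le> \<eta> * (norm (f (of_real r * \<zeta>)) powr p + norm (f (of_real s * (of_real r * \<zeta>))) powr p)
       + C * ((norm (f (of_real r * \<zeta>)) powr p + norm (f (of_real s * (of_real r * \<zeta>))) powr p) / 2
          - norm (G (of_real r * \<zeta>)) powr p)"
        unfolding D_def G_def by (rule C(2))
    qed (intro continuous_on_add continuous_on_mult_left continuous_on_diff continuous_on_divide continuous_on_const
           c[OF hol] c[OF hols] c[OF holG] c[OF holD] r' r; simp)+
    also have "\<dots> = \<eta> * (hardy_mean p f r + hardy_mean p f (r * s))
       + C * ((hardy_mean p f r + hardy_mean p f (r * s)) / 2 - hardy_mean p G r)"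
      unfolding hardy_mean_dilation[symmetric]
      unfolding hardy_mean_def
      using circle_integrable[OF c[OF hol r' r(2)]] circle_integrable[OF c[OF hols r' r(2)]]
        circle_integrable[OF c[OF holG r' r(2)]]
      by simp
    also have "\<dots> \<le> \<eta> * (N + N) + C * ((N + N) / 2 - (N - 2 * e))"
    proof -
      have "hardy_mean p f r \<le> N" unfolding N_def using r r' p f by (intro hardy_mean_le_norm) auto
      moreover have "hardy_mean p f (r * s) \<le> N"
        unfolding N_def using r r' s p f mult_strict_mono[of r 1 s 1] by (intro hardy_mean_le_norm) auto
      moreover have "N - 2 * e \<le> hardy_mean p G r"
        using Gr0 hardy_mean_mono[OF p holG r0(1) r] by linarith
      ultimately show ?thesis
        using C \<eta> by (intro add_mono mult_left_mono diff_mono divide_right_mono) auto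
    qed
    also have "\<dots> = \<epsilon> powr p / 2 * (N / (N + 1)) + \<epsilon> powr p / 2 * (C / (C + 1))"
    proof -
      have half: "x / (4 * y) * (2 * z) = x / 2 * (z / y)" for x y z :: real by simp
      have "\<eta> * (N + N) = \<epsilon> powr p / 2 * (N / (N + 1))"
        using half[of "\<epsilon> powr p" "N + 1" N] by (simp only: \<eta>_def mult_2)
      moreover have "C * ((N + N) / 2 - (N - 2 * e)) = e * (2 * C)" by (simp add: algebra_simps)
      moreover have "e * (2 * C) = \<epsilon> powr p / 2 * (C / (C + 1))"
        unfolding e_def by (rule half)
      ultimately show ?thesis by simp
    qed
    also have "\<dots> \<le> \<epsilon> powr p / 2 * 1 + \<epsilon> powr p / 2 * 1"
      using N C by (intro add_mono mult_left_mono) auto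
    finally show ?thesis by simp
  qed
  have "hardy_norm p D \<le> \<epsilon>"
  proof (rule hardy_norm_le)
    fix r :: real assume r: "0 < r" "r < 1"
    show "hardy_mean p D r \<le> \<epsilon> powr p"
    \<comment> \<open>Radii below \<open>r0\<close> are covered by the monotonicity of the means of
      \<open>D\<close>.\<close>
    proof (cases "r0 \<le> r")
      case False
      then have "hardy_mean p D r \<le> hardy_mean p D r0"
        using r r0 by (intro hardy_mean_mono p holD) auto
      also have "\<dots> \<le> \<epsilon> powr p" using r0 by (intro Dr) auto
      finally show ?thesis .
    qed (use r Dr in auto)
  qed (use p \<epsilon> in auto)
  then show ?thesis using that s by (simp add: D_def)
qed

text \<open>A dilation has absolutely summable Taylor coefficients, so its Taylor polynomials
  converge uniformly on the disc and hence in norm.\<close>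

lemma polynomials_dense:
  assumes p: "p > 1" and f: "f \<in> hardy_space p" and \<epsilon>: "\<epsilon> > 0"
  obtains a :: "nat \<Rightarrow> complex" and N where "hardy_norm p (\<lambda>z. f z - (\<Sum>m<N. a m * z ^ m)) \<le> \<epsilon>"
proof -
  have hol: "f holomorphic_on ball 0 1" using f by (rule hardy_space_holomorphic)
  obtain s where s: "0 < s" "s < 1" "hardy_norm p (\<lambda>z. f z - f (of_real s * z)) \<le> \<epsilon> / 2"
    using dilation_approximates[OF p f, of "\<epsilon> / 2"] \<epsilon> by auto
  have hols: "(\<lambda>z. f (of_real s * z)) holomorphic_on ball 0 1"
    using s by (intro dilation_holomorphic hol) auto
  obtain a where a: "\<And>z. norm z < 1 \<Longrightarrow> (\<lambda>n. a n * z ^ n) sums f z"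
    by (rule holomorphic_sums_disc[OF hol]) blast
  have sm: "summable (\<lambda>n. norm (a n * of_real s ^ n))"
    using s by (intro summable_norm_disc[OF a]) auto
  define b where "b = (\<lambda>n. norm (a n * of_real s ^ n))"
  have "(\<lambda>N. \<Sum>n<N. b n) \<longlonglongrightarrow> (\<Sum>n. b n)"
    unfolding b_def by (intro summable_LIMSEQ sm)
  then have "\<forall>\<^sub>F N in sequentially. (\<Sum>n. b n) - \<epsilon> / 2 < (\<Sum>n<N. b n)"
    using \<epsilon> by (intro order_tendstoD) auto
  then obtain N where N: "(\<Sum>n. b n) - \<epsilon> / 2 < (\<Sum>n<N. b n)"
    by (auto simp: eventually_sequentially)
  let ?P = "\<lambda>z. \<Sum>m<N. (a m * of_real s ^ m) * z ^ m"
  have P: "?P \<in> hardy_space p" using p by (intro polynomial_in_hardy_space) auto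
  have tail: "hardy_norm p (\<lambda>z. f (of_real s * z) - ?P z) \<le> \<epsilon> / 2"
    and fP: "(\<lambda>z. f (of_real s * z) - ?P z) \<in> hardy_space p"
  proof -
    have bd: "norm (f (of_real s * z) - ?P z) \<le> \<epsilon> / 2" if z: "norm z < 1" for z
    proof -
      have "norm (of_real s * z) < 1" using s z norm_cnj_mult_less_1[of "of_real s" z] by auto
      from a[OF this] have 1: "(\<lambda>n. (a n * of_real s ^ n) * z ^ n) sums f (of_real s * z)"
        by (simp add: power_mult_distrib mult.assoc)
      have nb: "norm ((a n * of_real s ^ n) * z ^ n) \<le> b n" for n
        using z by (simp add: b_def norm_mult norm_power mult_left_le power_le_one)
      have smn: "summable (\<lambda>n. norm ((a n * of_real s ^ n) * z ^ n))"
        by (rule summable_comparison_test'[of b 0]) (use sm nb in \<open>auto simp: b_def\<close>)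
      have "f (of_real s * z) - ?P z = (\<Sum>n. (a (n + N) * of_real s ^ (n + N)) * z ^ (n + N))"
        using sums_split_initial_segment[OF 1, of N] by (simp add: sums_iff)
      also have "norm \<dots> \<le> (\<Sum>n. norm ((a (n + N) * of_real s ^ (n + N)) * z ^ (n + N)))"
        using smn by (intro summable_norm) (subst summable_iff_shift)
      also have "\<dots> \<le> (\<Sum>n. b (n + N))"
        by (intro suminf_le nb summable_ignore_initial_segment[OF smn]
            summable_ignore_initial_segment[OF sm[folded b_def]])
      also have "\<dots> = (\<Sum>n. b n) - (\<Sum>n<N. b n)"
        using sm unfolding b_def by (rule suminf_minus_initial_segment)
      also have "\<dots> \<le> \<epsilon> / 2" using N by simp
      finally show ?thesis .
    qed
    have holf: "(\<lambda>z. f (of_real s * z) - ?P z) holomorphic_on ball 0 1"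
      by (intro holomorphic_intros hols)
    have "0 < p" "0 \<le> \<epsilon> / 2" using p \<epsilon> by auto
    note * = holf this bd
    show "hardy_norm p (\<lambda>z. f (of_real s * z) - ?P z) \<le> \<epsilon> / 2"
      by (rule hardy_norm_le_sup[OF *])
    show "(\<lambda>z. f (of_real s * z) - ?P z) \<in> hardy_space p"
      by (rule bounded_in_hardy_space[OF *])
  qed
  have fs: "(\<lambda>z. f z - f (of_real s * z)) \<in> hardy_space p"
    using hardy_space_diff[OF p f hardy_space_add[OF p fP P]] by simp
  have "hardy_norm p (\<lambda>z. (f z - f (of_real s * z)) + (f (of_real s * z) - ?P z)) \<le> \<epsilon> / 2 + \<epsilon> / 2"
    by (intro order_trans[OF hardy_norm_triangle[OF p fs fP]] add_mono s tail)
  then show ?thesis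
    by (intro that[of "\<lambda>m. a m * of_real s ^ m" N]) simp
qed

section \<open>Iterated corrections\<close>

text \<open>The corrections are taken from consecutive index intervals, so they glue to one coefficient sequence.\<close>
lemma representing_system_contraction:
  fixes X :: "('a \<Rightarrow> complex) set"
  assumes X: "range x \<subseteq> X" and \<delta>: "0 \<le> \<delta>" "\<delta> < 1" and nonneg: "\<And>f. 0 \<le> nrm f"
    and step: "\<And>f N. f \<in> X \<Longrightarrow> \<exists>N' c. N < N' \<and> (\<lambda>z. f z - (\<Sum>i=N..<N'. c i * x i z)) \<in> X \<and>
      nrm (\<lambda>z. f z - (\<Sum>i=N..<N'. c i * x i z)) \<le> \<delta> * nrm f \<and>
      (\<forall>m. N \<le> m \<and> m \<le> N' \<longrightarrow> nrm (\<lambda>z. f z - (\<Sum>i=N..<m. c i * x i z)) \<le> C * nrm f)"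
  shows "representing_system X nrm x"
  unfolding representing_system_def
proof (intro conjI ballI X)
  fix f assume f: "f \<in> X"
  define R where "R = (\<lambda>m (c :: nat \<Rightarrow> complex) z. f z - (\<Sum>i<m. c i * x i z))"
  \<comment> \<open>A state is an end index together with a coefficient sequence. A transition
    freezes the entries below the old end, contracts the remainder at the new end and bounds it in
    between.\<close>
  define Q where "Q = (\<lambda>s t. fst s < fst t \<and> (\<forall>i<fst s. snd t i = snd s i)
     \<and> nrm (R (fst t) (snd t)) \<le> \<delta> * nrm (R (fst s) (snd s))
     \<and> (\<forall>m. fst s \<le> m \<and> m \<le> fst t \<longrightarrow> nrm (R m (snd t)) \<le> C * nrm (R (fst s) (snd s))))"
  have "\<exists>S. \<forall>k. R (fst (S k)) (snd (S k)) \<in> X \<and> Q (S k) (S (Suc k))"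
  proof (rule dependent_nat_choice[where P = "\<lambda>_ s. R (fst s) (snd s) \<in> X" and Q = "\<lambda>_. Q"])
    show "\<exists>s. R (fst s) (snd s) \<in> X"
      using f by (intro exI[of _ "(0, \<lambda>_. 0)"]) (simp add: R_def)
    fix s assume s: "R (fst s) (snd s) \<in> X"
    obtain N' c where c: "fst s < N'" "(\<lambda>z. R (fst s) (snd s) z - (\<Sum>i=fst s..<N'. c i * x i z)) \<in> X"
      "nrm (\<lambda>z. R (fst s) (snd s) z - (\<Sum>i=fst s..<N'. c i * x i z)) \<le> \<delta> * nrm (R (fst s) (snd s))"
      "\<And>m. fst s \<le> m \<Longrightarrow> m \<le> N' \<Longrightarrow>
        nrm (\<lambda>z. R (fst s) (snd s) z - (\<Sum>i=fst s..<m. c i * x i z)) \<le> C * nrm (R (fst s) (snd s))"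
      using step[OF s, of "fst s"] by blast
    define c' where "c' = (\<lambda>i. if i < fst s then snd s i else c i)"
    have eq: "R m c' = (\<lambda>z. R (fst s) (snd s) z - (\<Sum>i=fst s..<m. c i * x i z))" if "fst s \<le> m" for m
    proof
      fix z
      have "(\<Sum>i<m. c' i * x i z) = (\<Sum>i<fst s. c' i * x i z) + (\<Sum>i=fst s..<m. c' i * x i z)"
        using that by (simp add: lessThan_atLeast0 sum.atLeastLessThan_concat)
      then show "R m c' z = R (fst s) (snd s) z - (\<Sum>i=fst s..<m. c i * x i z)"
        by (simp add: R_def c'_def)
    qed
    show "\<exists>t. R (fst t) (snd t) \<in> X \<and> Q s t"
      using c eq by (intro exI[of _ "(N', c')"]) (auto simp: Q_def c'_def)
  qed
  then obtain S where S: "\<And>k. Q (S k) (S (Suc k))" by blast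
  define N where "N = (\<lambda>k. fst (S k))"
  have Nless: "N k < N (Suc k)" for k using S[of k] by (simp add: Q_def N_def)
  then have mono: "strict_mono N" by (simp add: strict_mono_Suc_iff)
  have agree: "snd (S k') i = snd (S k) i" if "k \<le> k'" "i < N k" for k k' i
    using that(1)
  proof (induction k' rule: dec_induct)
    case (step l)
    have "N k \<le> N l" using mono step.hyps by (simp add: strict_mono_less_eq)
    then show ?case using S[of l] step.IH that(2) by (auto simp: Q_def N_def)
  qed simp
  \<comment> \<open>At stage i + 1 the end index already exceeds i, so the entry of index i is
    frozen.\<close>
  define c where "c = (\<lambda>i. snd (S (Suc i)) i)"
  have Nk: "k \<le> N k" for k using mono by (rule strict_mono_imp_increasing)
  have c_eq: "c i = snd (S k) i" if "i < N k" for i k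
  proof (cases "k \<le> Suc i")
    case True
    then show ?thesis unfolding c_def by (rule agree) fact
  next
    case False
    have "i < N (Suc i)" using Nk[of "Suc i"] by simp
    then show ?thesis unfolding c_def using False by (intro agree[symmetric]) auto
  qed
  then have R_eq: "R m c = R m (snd (S k))" if "m \<le> N k" for m k
    using that by (auto simp: R_def fun_eq_iff intro!: sum.cong)
  define a where "a = nrm (R (N 0) (snd (S 0)))"
  have decay: "nrm (R (N k) (snd (S k))) \<le> \<delta> ^ k * a" for k
  proof (induction k)
    case (Suc k)
    have "nrm (R (N (Suc k)) (snd (S (Suc k)))) \<le> \<delta> * nrm (R (N k) (snd (S k)))"
      using S[of k] by (simp add: Q_def N_def)
    also have "\<dots> \<le> \<delta> * (\<delta> ^ k * a)" using Suc \<delta> by (intro mult_left_mono) auto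
    finally show ?case by (simp add: mult_ac)
  qed (simp add: a_def)
  \<comment> \<open>The absolute value allows a constant \<open>C\<close> of either sign.\<close>
  have "(\<lambda>k. \<bar>C\<bar> * (\<delta> ^ k * a)) \<longlonglongrightarrow> \<bar>C\<bar> * (0 * a)"
    using \<delta> by (intro tendsto_intros) auto
  then have lim: "(\<lambda>k. \<bar>C\<bar> * (\<delta> ^ k * a)) \<longlonglongrightarrow> 0" by simp
  have "(\<lambda>m. nrm (R m c)) \<longlonglongrightarrow> 0"
  proof (rule LIMSEQ_I)
    fix e :: real assume "e > 0"
    then obtain k0 where k0: "\<And>k. k \<ge> k0 \<Longrightarrow> \<bar>\<bar>C\<bar> * (\<delta> ^ k * a)\<bar> < e"
      using LIMSEQ_D[OF lim] by auto
    have "norm (nrm (R m c) - 0) < e" if m: "m \<ge> N k0" for m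
    proof -
      \<comment> \<open>The stage whose interval contains the position m.\<close>
      define k where "k = (LEAST k. m < N (Suc k))"
      have "m < N (Suc m)" using Nk[of "Suc m"] by simp
      then have k1: "m < N (Suc k)" unfolding k_def by (rule LeastI)
      have k2: "N k \<le> m"
      \<comment> \<open>The chain may start at any index, so \<open>N 0 \<le> m\<close> has to come
        from \<open>m \<ge> N k0\<close>.\<close>
      proof (cases k)
        case 0
        then show ?thesis using m mono strict_mono_less_eq[OF mono, of 0 k0] by simp
      next
        case (Suc l)
        then have "\<not> m < N (Suc l)" using not_less_Least[of l "\<lambda>k. m < N (Suc k)"] by (simp add: k_def)
        then show ?thesis using Suc by simp
      qed
      have "N k0 < N (Suc k)" using m k1 by simp
      then have "k0 \<le> k" using strict_mono_less[OF mono] by auto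
      have "nrm (R m c) = nrm (R m (snd (S (Suc k))))" using R_eq[of m "Suc k"] k1 by simp
      also have "\<dots> \<le> C * nrm (R (N k) (snd (S k)))"
        using S[of k] k1 k2 by (simp add: Q_def N_def)
      also have "\<dots> \<le> \<bar>C\<bar> * (\<delta> ^ k * a)"
        by (intro mult_mono decay nonneg) auto
      also have "\<dots> < e" using k0[OF \<open>k0 \<le> k\<close>] by linarith
      finally show ?thesis using nonneg[of "R m c"] by simp
    qed
    then show "\<exists>no. \<forall>m\<ge>no. norm (nrm (R m c) - 0) < e" by blast
  qed
  then show "\<exists>c. (\<lambda>N. nrm (\<lambda>z. f z - (\<Sum>i<N. c i * x i z))) \<longlonglongrightarrow> 0"
    unfolding R_def by blast
qed

section \<open>Blocks in the lexicographic enumeration\<close>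

lemma lex_enum_block:
  assumes "lex_enum n i = (k, 0)" "j < n k"
  shows "lex_enum n (i + j) = (k, j)"
  using assms(2)
proof (induction j)
  case (Suc j)
  then have "lex_enum n (i + j) = (k, j)" by simp
  with Suc.prems show ?case by simp
qed (use assms in simp)

lemma lex_enum_block_start:
  assumes "\<And>k. k \<ge> 1 \<Longrightarrow> n k > 0" "k \<ge> 1" "fst (lex_enum n N) < k"
  obtains i where "lex_enum n i = (k, 0)" "N < i"
proof -
  have "(k, 0) \<in> range (lex_enum n)"
    using assms by (subst lex_enum_range) auto
  then obtain i where i: "lex_enum n i = (k, 0)" by (metis rangeE)
  have "\<not> i \<le> N"
  proof
    assume "i \<le> N"
    then consider "i = N" | "i < N" by linarith
    then show False
    proof cases
      case 2
      from lex_enum_strict[OF this, of n] show False using i assms(3)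
        by (cases "lex_enum n N") auto
    qed (use i assms in simp)
  qed
  then show ?thesis using i that by simp
qed

lemma grid_point_eq: "grid_point n r (k, j) = of_real (r k) * unity_root (n k) j"
  by (simp add: grid_point_def unity_root_def)

lemma grid_block_step:
  fixes n :: "nat \<Rightarrow> nat" and r :: "nat \<Rightarrow> real"
  assumes n: "\<And>k. k \<ge> 1 \<Longrightarrow> n k > 0" and r: "\<And>k. k \<ge> 1 \<Longrightarrow> r k \<in> {0..<1}"
    and lim: "r \<longlonglongrightarrow> 1" and M: "M > 0" "\<And>k. k \<ge> 1 \<Longrightarrow> real (n k) * (1 - r k) \<ge> M" and p: "p > 1"
  defines "K \<equiv> \<lambda>k j. cauchy_kernel (of_real (r k) * unity_root (n k) j)"
  obtains \<delta> C where "0 \<le> \<delta>" "\<delta> < 1" "C \<ge> 0"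
    "\<And>f k0. f \<in> hardy_space p \<Longrightarrow> \<exists>k d. k \<ge> k0 \<and> k \<ge> 1 \<and>
      hardy_norm p (\<lambda>z. f z - (\<Sum>j<n k. d j * K k j z)) \<le> \<delta> * hardy_norm p f \<and>
      (\<forall>J\<le>n k. hardy_norm p (\<lambda>z. \<Sum>j<J. d j * K k j z) \<le> C * hardy_norm p f)"
proof -
  \<comment> \<open>One bound for all the powers \<open>r k ^ n k\<close>, by r \<le> exp (r -
    1).\<close>
  define \<rho> where "\<rho> = exp (- M)"
  have \<rho>: "0 < \<rho>" "\<rho> < 1" using M by (auto simp: \<rho>_def)
  have pow: "r k ^ n k \<le> \<rho>" if "k \<ge> 1" for k
  proof -
    have "r k ^ n k \<le> exp (- (1 - r k)) ^ n k"
      using r[OF that] exp_ge_add_one_self[of "- (1 - r k)"] by (intro power_mono) auto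
    also have "\<dots> = exp (- (real (n k) * (1 - r k)))"
      by (simp add: exp_of_nat_mult[symmetric] algebra_simps)
    also have "\<dots> \<le> \<rho>" using M(2)[OF that] by (simp add: \<rho>_def)
    finally show ?thesis .
  qed
  obtain C where C: "C \<ge> 0"
    "\<And>n r c J. n > 0 \<Longrightarrow> 0 \<le> r \<Longrightarrow> r < 1 \<Longrightarrow> r ^ n \<le> \<rho> \<Longrightarrow> J \<le> n \<Longrightarrow>
      hardy_norm p (\<lambda>z. \<Sum>j<J. c j * cauchy_kernel (of_real r * unity_root n j) z)
        \<le> C * (real n powr (p - 1) * (\<Sum>j<n. norm (c j) powr p)) powr (1 / p)"
    using block_bound[OF p \<rho>(2)] by blast
  show ?thesis
  proof (rule that[of "(1 + \<rho>) / 2" "4 * C"])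
    fix f and k0 :: nat
    assume f: "f \<in> hardy_space p"
    define F where "F = hardy_norm p f"
    show "\<exists>k d. k \<ge> k0 \<and> k \<ge> 1 \<and>
      hardy_norm p (\<lambda>z. f z - (\<Sum>j<n k. d j * K k j z)) \<le> (1 + \<rho>) / 2 * hardy_norm p f \<and>
      (\<forall>J\<le>n k. hardy_norm p (\<lambda>z. \<Sum>j<J. d j * K k j z) \<le> 4 * C * hardy_norm p f)"
    \<comment> \<open>Density provides polynomials only for a positive tolerance, and
      \<open>\<epsilon> * F\<close> is 0 here; zero coefficients serve instead.\<close>
    proof (cases "F = 0")
      case True
      have "hardy_norm p (\<lambda>z. 0) \<le> 0"
        using p by (intro hardy_norm_le_sup) auto
      then show ?thesis using True C by (intro exI[of _ "max 1 k0"] exI[of _ "\<lambda>_. 0"]) (simp add: F_def)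
    next
      case False
      then have F: "F > 0" using hardy_norm_nonneg[of p f] by (simp add: F_def)
      \<comment> \<open>Makes \<epsilon> + \<rho> (1 + \<epsilon>) \<le> 2 \<epsilon> + \<rho> = (1
        + \<rho>) / 2.\<close>
      define \<epsilon> where "\<epsilon> = (1 - \<rho>) / 4"
      have \<epsilon>: "0 < \<epsilon>" "\<epsilon> \<le> 1" using \<rho> by (auto simp: \<epsilon>_def)
      obtain a :: "nat \<Rightarrow> complex" and L where aL: "hardy_norm p (\<lambda>z. f z - (\<Sum>m<L. a m * z ^ m)) \<le> \<epsilon> * F"
        using polynomials_dense[OF p f, of "\<epsilon> * F"] \<epsilon> F by (auto simp: mult_pos_pos)
      define P where "P = (\<lambda>z. \<Sum>m<L. a m * z ^ m)"
      have PH: "P \<in> hardy_space p" unfolding P_def using p by (intro polynomial_in_hardy_space) auto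
      have fP: "(\<lambda>z. f z - P z) \<in> hardy_space p" by (intro hardy_space_diff p f PH)
      have fPn: "hardy_norm p (\<lambda>z. f z - P z) \<le> \<epsilon> * F" using aL by (simp add: P_def)
      have Pn: "hardy_norm p P \<le> (1 + \<epsilon>) * F"
        using hardy_norm_diff_le[OF p f fP] fPn by (simp add: F_def algebra_simps)
      have "(1 + \<epsilon>) * F \<le> 2 * F" using \<epsilon> F by (intro mult_right_mono) auto
      with Pn have Pn2: "hardy_norm p P \<le> 2 * F" by linarith
      have F': "(2 * F) powr p > 0" using F by simp
      have cP: "continuous_on UNIV P" unfolding P_def by (intro continuous_intros)
      \<comment> \<open>The slack \<open>(2 * F) powr p\<close> is as large as the bound for the
        main term, since a multiple of the norm is enough here. Together they give at most
        \<open>(4 * F) powr p\<close>, whence the constant \<open>4 * C\<close>.\<close>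
      obtain L' \<delta> where L': "\<delta> > 0" "\<And>n R. n \<ge> L' \<Longrightarrow> 1 \<le> R \<Longrightarrow> R \<le> 1 + \<delta> \<Longrightarrow>
         (\<Sum>j<n. norm (P (of_real R * unity_root n j)) powr p) / real n \<le> hardy_norm p P powr p + (2 * F) powr p"
        by (rule grid_mean_le_hardy_norm[OF p PH cP F']) blast
      define B where "B = real (max L L')"
      \<comment> \<open>The second bound on \<open>r k\<close> forces a large \<open>n k\<close>:
        with fewer than \<open>B\<close> nodes, \<open>n k * (1 - r k)\<close> would be less than
        \<open>M\<close>. The first brings the sampling radius 1 / r k below 1 + \<delta>.\<close>
      have "\<forall>\<^sub>F k in sequentially. max (1 / (1 + \<delta>)) (1 - M / (B + 1)) < r k"
        using lim L'(1) M(1) by (intro order_tendstoD) (auto simp: B_def)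
      moreover have "\<forall>\<^sub>F k in sequentially. max k0 1 \<le> k" by (rule eventually_ge_at_top)
      ultimately have "\<forall>\<^sub>F k in sequentially. max (1 / (1 + \<delta>)) (1 - M / (B + 1)) < r k \<and> max k0 1 \<le> k"
        by eventually_elim simp
      then obtain k where k: "1 / (1 + \<delta>) < r k" "1 - M / (B + 1) < r k" "k0 \<le> k" "1 \<le> k"
        by (auto simp: eventually_sequentially)
      have nk: "n k > 0" using n k by simp
      have "0 < 1 / (1 + \<delta>)" using L' by simp
      then have rk: "0 < r k" "r k < 1" using k r[OF k(4)] by (linarith, simp)
      have "L \<le> n k" "L' \<le> n k"
      proof -
        have "B \<le> real (n k)"
        proof (rule ccontr)
          assume "\<not> B \<le> real (n k)"
          then have "real (n k) * (1 - r k) \<le> B * (1 - r k)" using rk by (intro mult_right_mono) auto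
          also have "\<dots> \<le> B * (M / (B + 1))"
            using k by (intro mult_left_mono) (auto simp: B_def)
          also have "\<dots> < M" using M(1) by (simp add: B_def field_simps)
          finally show False using M(2)[OF k(4)] by simp
        qed
        then show "L \<le> n k" "L' \<le> n k" by (auto simp: B_def)
      qed
      define R where "R = 1 / r k"
      have R: "1 \<le> R" "R \<le> 1 + \<delta>" using k rk L' by (auto simp: R_def field_simps)
      have PR: "P (unity_root (n k) j / of_real (r k)) = P (of_real R * unity_root (n k) j)" for j
        by (simp add: R_def)
      define d where "d = (\<lambda>j. of_real ((1 - (r k ^ n k)\<^sup>2) / real (n k)) * P (unity_root (n k) j / of_real (r k)))"
      have KH: "K k j \<in> hardy_space p" for j
        unfolding K_def using p rk by (intro cauchy_kernel_in_hardy_space norm_node_less_1) auto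
      have gH: "(\<lambda>z. \<Sum>j<n k. d j * K k j z) \<in> hardy_space p"
        by (intro hardy_space_sum p KH)
      have "hardy_norm p (\<lambda>z. P z - (\<Sum>j<n k. d j * K k j z)) \<le> \<rho> * hardy_norm p P"
        unfolding d_def K_def P_def using p rk nk \<open>L \<le> n k\<close> pow[OF k(4)] \<rho> by (intro block_approximation) auto
      also have "\<dots> \<le> \<rho> * ((1 + \<epsilon>) * F)" using Pn \<rho> by (intro mult_left_mono) auto
      finally have Pg: "hardy_norm p (\<lambda>z. P z - (\<Sum>j<n k. d j * K k j z)) \<le> \<rho> * ((1 + \<epsilon>) * F)" .
      have "hardy_norm p (\<lambda>z. f z - (\<Sum>j<n k. d j * K k j z))
        = hardy_norm p (\<lambda>z. (f z - P z) + (P z - (\<Sum>j<n k. d j * K k j z)))" by simp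
      also have "\<dots> \<le> \<epsilon> * F + \<rho> * ((1 + \<epsilon>) * F)"
        by (intro order_trans[OF hardy_norm_triangle] add_mono fPn Pg p fP hardy_space_diff PH gH)
      also have "\<dots> \<le> (1 + \<rho>) / 2 * F"
      proof -
        have "\<rho> * \<epsilon> \<le> \<epsilon>" using \<rho> \<epsilon> by simp
        moreover have "\<epsilon> + \<rho> * (1 + \<epsilon>) = \<epsilon> + \<rho> + \<rho> * \<epsilon>" by (simp add: algebra_simps)
        moreover have "2 * \<epsilon> + \<rho> = (1 + \<rho>) / 2" by (simp add: \<epsilon>_def field_simps)
        ultimately have "\<epsilon> + \<rho> * (1 + \<epsilon>) \<le> (1 + \<rho>) / 2" by linarith
        from mult_right_mono[OF this less_imp_le[OF F]] show ?thesis by (simp add: algebra_simps)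
      qed
      finally have 1: "hardy_norm p (\<lambda>z. f z - (\<Sum>j<n k. d j * K k j z)) \<le> (1 + \<rho>) / 2 * F" .
      have 2: "hardy_norm p (\<lambda>z. \<Sum>j<J. d j * K k j z) \<le> 4 * C * F" if "J \<le> n k" for J
      proof -
        have dn: "norm (d j) \<le> norm (P (of_real R * unity_root (n k) j)) / real (n k)" for j
        proof -
          have "0 \<le> r k ^ n k" "r k ^ n k \<le> 1" using rk by (auto simp: power_le_one)
          then have "\<bar>1 - (r k ^ n k)\<^sup>2\<bar> \<le> 1" by (simp add: abs_le_iff power_le_one)
          then have "norm (complex_of_real ((1 - (r k ^ n k)\<^sup>2) / real (n k))) \<le> 1 / real (n k)"
            unfolding norm_of_real by (simp add: divide_right_mono)
          from mult_right_mono[OF this norm_ge_zero] show ?thesis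
            unfolding d_def PR norm_mult by simp
        qed
        \<comment> \<open>The weight n^(p-1) cancels against the n^(-p) of the coefficients up to 1
          / n and leaves an average over the nodes.\<close>
        have "real (n k) powr (p - 1) * (\<Sum>j<n k. norm (d j) powr p)
          \<le> real (n k) powr (p - 1) * (\<Sum>j<n k. (norm (P (of_real R * unity_root (n k) j)) / real (n k)) powr p)"
          using p dn by (intro mult_left_mono sum_mono powr_mono2) auto
        also have "\<dots> = (\<Sum>j<n k. norm (P (of_real R * unity_root (n k) j)) powr p) / real (n k)"
          using nk by (simp add: powr_divide sum_divide_distrib[symmetric] powr_diff)
        also have "\<dots> \<le> hardy_norm p P powr p + (2 * F) powr p"
          using \<open>L' \<le> n k\<close> R by (intro L'(2)) auto
        also have "\<dots> \<le> (2 * F) powr p + (2 * F) powr p"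
          using Pn2 p hardy_norm_nonneg by (intro add_right_mono powr_mono2) auto
        also have "\<dots> = 2 powr 1 * (2 * F) powr p" by simp
        also have "\<dots> \<le> 2 powr p * (2 * F) powr p" using p by (intro mult_right_mono powr_mono) auto
        also have "\<dots> = (4 * F) powr p" using F by (simp flip: powr_mult)
        finally have "(real (n k) powr (p - 1) * (\<Sum>j<n k. norm (d j) powr p)) powr (1 / p) \<le> ((4 * F) powr p) powr (1 / p)"
          using p by (intro powr_mono2) (auto intro!: mult_nonneg_nonneg sum_nonneg)
        also have "\<dots> = 4 * F" using p F by (simp add: powr_powr)
        finally have "C * (real (n k) powr (p - 1) * (\<Sum>j<n k. norm (d j) powr p)) powr (1 / p) \<le> C * (4 * F)"
          using C(1) by (rule mult_left_mono)
        moreover have "hardy_norm p (\<lambda>z. \<Sum>j<J. d j * K k j z)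
          \<le> C * (real (n k) powr (p - 1) * (\<Sum>j<n k. norm (d j) powr p)) powr (1 / p)"
          unfolding K_def using nk rk pow[OF k(4)] that by (intro C(2)) auto
        ultimately show ?thesis by simp
      qed
      show ?thesis using 1 2 k by (intro exI[of _ k] exI[of _ d]) (simp add: F_def)
    qed
  qed (use \<rho> C in auto)
qed

theorem theorem1p1:
  fixes n :: "nat \<Rightarrow> nat" and r :: "nat \<Rightarrow> real"
  assumes "\<And>k. k \<ge> 1 \<Longrightarrow> n k > 0"
    and "\<And>k. k \<ge> 1 \<Longrightarrow> r k \<in> {0..<1}"
    and "r \<longlonglongrightarrow> 1"
    and "\<exists>M>0. \<forall>k\<ge>1. real (n k) * (1 - r k) \<ge> M"
  shows "\<forall>p::real. p > 1 \<longrightarrow>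
    representing_system (hardy_space p) (hardy_norm p)
      (\<lambda>i. cauchy_kernel (grid_point n r (lex_enum n i)))"
proof (intro allI impI)
  fix p :: real assume p: "p > 1"
  obtain M where M: "M > 0" "\<And>k. k \<ge> 1 \<Longrightarrow> real (n k) * (1 - r k) \<ge> M"
    using assms(4) by blast
  define K where "K = (\<lambda>k j. cauchy_kernel (of_real (r k) * unity_root (n k) j))"
  define x where "x = (\<lambda>i. cauchy_kernel (grid_point n r (lex_enum n i)))"
  obtain \<delta> C where \<delta>: "0 \<le> \<delta>" "\<delta> < 1" "C \<ge> 0" and step:
    "\<And>f k0. f \<in> hardy_space p \<Longrightarrow> \<exists>k d. k \<ge> k0 \<and> k \<ge> 1 \<and>
      hardy_norm p (\<lambda>z. f z - (\<Sum>j<n k. d j * K k j z)) \<le> \<delta> * hardy_norm p f \<and>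
      (\<forall>J\<le>n k. hardy_norm p (\<lambda>z. \<Sum>j<J. d j * K k j z) \<le> C * hardy_norm p f)"
    using grid_block_step[OF assms(1-3) M p] unfolding K_def by blast
  have xH: "x i \<in> hardy_space p" for i
  proof -
    obtain k j where kj: "lex_enum n i = (k, j)" by (cases "lex_enum n i")
    have "range (lex_enum n) = {(k, j). k \<ge> 1 \<and> j < n k}"
      by (rule lex_enum_range) (rule assms(1))
    with rangeI[of "lex_enum n" i] have "lex_enum n i \<in> {(k, j). k \<ge> 1 \<and> j < n k}"
      by (simp only:)
    then have "k \<ge> 1" by (simp add: kj)
    then have "r k \<in> {0..<1}" by (rule assms(2))
    then show ?thesis
      unfolding x_def kj grid_point_eq
      using p by (intro cauchy_kernel_in_hardy_space norm_node_less_1) auto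
  qed
  show "representing_system (hardy_space p) (hardy_norm p) (\<lambda>i. cauchy_kernel (grid_point n r (lex_enum n i)))"
    unfolding x_def[symmetric]
  \<comment> \<open>A remainder inside the block is \<open>f\<close> minus a partial sum of norm at
    most \<open>C\<close> times that of \<open>f\<close>, hence \<open>1 + C\<close>.\<close>
  proof (rule representing_system_contraction[OF _ \<delta>(1,2) hardy_norm_nonneg, where C = "1 + C"])
    show "range x \<subseteq> hardy_space p" using xH by auto
    fix f N assume f: "f \<in> hardy_space p"
    obtain k d where k: "k \<ge> Suc (fst (lex_enum n N))" "k \<ge> 1"
      and d: "hardy_norm p (\<lambda>z. f z - (\<Sum>j<n k. d j * K k j z)) \<le> \<delta> * hardy_norm p f"
        "\<And>J. J \<le> n k \<Longrightarrow> hardy_norm p (\<lambda>z. \<Sum>j<J. d j * K k j z) \<le> C * hardy_norm p f"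
      using step[OF f] by blast
    obtain i0 where i0: "lex_enum n i0 = (k, 0)" "N < i0"
      using lex_enum_block_start[of n k N] assms(1) k by auto
    have xK: "x (i0 + j) = K k j" if "j < n k" for j
      using lex_enum_block[where j = j, OF i0(1) that] by (simp add: x_def K_def grid_point_eq)
    \<comment> \<open>The positions from \<open>N\<close> up to \<open>i0\<close>, in particular
      what is left of the current block, receive coefficient 0.\<close>
    define c where "c = (\<lambda>i. if i0 \<le> i then d (i - i0) else 0)"
    \<comment> \<open>For m \<le> i0 the truncated difference \<open>m - i0\<close> is 0 and the
      right side is empty, so partial sums that stop before the block are included.\<close>
    have sum_eq: "(\<Sum>i=N..<m. c i * x i z) = (\<Sum>j<m - i0. d j * K k j z)" if "m \<le> i0 + n k" for m z
    proof -
      have "(\<Sum>i=N..<m. c i * x i z) = (\<Sum>i=i0..<m. c i * x i z)"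
        using i0(2) by (intro sum.mono_neutral_right) (auto simp: c_def)
      also have "\<dots> = (\<Sum>j<m - i0. c (i0 + j) * x (i0 + j) z)"
        by (rule sum.reindex_bij_witness[of _ "\<lambda>j. i0 + j" "\<lambda>i. i - i0"]) auto
      also have "\<dots> = (\<Sum>j<m - i0. d j * K k j z)"
        using that by (intro sum.cong) (auto simp: c_def xK)
      finally show ?thesis .
    qed
    have rk: "r k \<in> {0..<1}" by (rule assms(2)) fact
    have sH: "(\<lambda>z. \<Sum>j<J. d j * K k j z) \<in> hardy_space p" for J
    proof (intro hardy_space_sum p)
      show "K k j \<in> hardy_space p" for j
        unfolding K_def using p rk
        by (intro cauchy_kernel_in_hardy_space norm_node_less_1) auto
    qed
    have "hardy_norm p (\<lambda>z. f z - (\<Sum>j<m - i0. d j * K k j z)) \<le> (1 + C) * hardy_norm p f"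
      if "m \<le> i0 + n k" for m
    proof -
      have "m - i0 \<le> n k" using that by simp
      from d(2)[OF this] show ?thesis
        using hardy_norm_diff_le[OF p f sH[of "m - i0"]] by (simp add: algebra_simps)
    qed
    then show "\<exists>N' c. N < N' \<and> (\<lambda>z. f z - (\<Sum>i=N..<N'. c i * x i z)) \<in> hardy_space p \<and>
      hardy_norm p (\<lambda>z. f z - (\<Sum>i=N..<N'. c i * x i z)) \<le> \<delta> * hardy_norm p f \<and>
      (\<forall>m. N \<le> m \<and> m \<le> N' \<longrightarrow> hardy_norm p (\<lambda>z. f z - (\<Sum>i=N..<m. c i * x i z)) \<le> (1 + C) * hardy_norm p f)"
      using d(1) i0(2) hardy_space_diff[OF p f sH]
      by (intro exI[of _ "i0 + n k"] exI[of _ c]) (simp add: sum_eq)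
  qed
qed

end
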